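(* For all real $\beta>1$, $\mathrm{Tr}(e^{-\beta H})=\zeta_{k,\infty}(\beta)$.
   Context: $k$ is a global function field (a finite extension of $\mathbb{F}_p(T)$ for a prime $p$), $\infty$ is a place of $k$, $\mathcal{O}\subset k$ is the Dedekind ring of elements having no pole away from $\infty$, and $\mathfrak{I}_{\mathcal{O}}$ is the set of nonzero ideals of $\mathcal{O}$, with $\mathbf{N}\mathfrak{a}=\mathrm{Card}(\mathcal{O}/\mathfrak{a})$. $\mathbf{N}\mathfrak{p}$ is the cardinality of the residue field of a place $\mathfrak{p}$. $H$ is the unbounded operator on $\ell^2(\mathfrak{I}_{\mathcal{O}})$ defined on the standard orthonormal basis $(\varepsilon_{\mathfrak{a}})_{\mathfrak{a}\in\mathfrak{I}_{\mathcal{O}}}$ by $H\varepsilon_{\mathfrak{a}}=(\log\mathbf{N}\mathfrak{a})\varepsilon_{\mathfrak{a}}$. $\zeta_{k,\infty}$ is the zeta function of $k$ without the factor at $\infty$: for $\mathrm{Re}\,s>1$, $\zeta_{k,\infty}(s)=\prod_{\mathfrak{p}\neq\infty}(1-\mathbf{N}\mathfrak{p}^{-s})^{-1}$, the product being over all places $\mathfrak{p}\neq\infty$ of $k$. *)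

theory Defs
  imports "HOL-Analysis.Analysis" "HOL-Algebra.Algebra"
begin

section \<open>Global function fields, places, the ring of functions regular away from a place\<close>

text \<open>Since \<open>p \<cdot> \<one> = \<zero>\<close>, the field \<open>generate_field k {}\<close> is the prime field \<open>\<bbbF>\<^sub>p\<close>, and
  \<open>generate_field k {T}\<close> with \<open>T\<close> transcendental over it is the rational function field \<open>\<bbbF>\<^sub>p(T)\<close>.\<close>

definition global_function_field :: "('a, 'b) ring_scheme \<Rightarrow> bool" where
  "global_function_field k \<longleftrightarrow> field k \<and>
     (\<exists>(p::nat) T. Factorial_Ring.prime p \<and> [p] \<cdot>\<^bsub>k\<^esub> \<one>\<^bsub>k\<^esub> = \<zero>\<^bsub>k\<^esub> \<and> T \<in> carrier k \<and>
        ring.transcendental k (generate_field k {}) T \<and>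
        ring.finite_dimension k (generate_field k {T}) (carrier k))"

text \<open>A place is represented by its normalised discrete valuation
  \<open>k - {\<zero>} \<rightarrow> \<int>\<close> (with \<open>v \<zero> = \<infinity>\<close> understood). Normalisation (surjectivity) and extensionality
  make this representative unique.\<close>

definition places :: "('a, 'b) ring_scheme \<Rightarrow> ('a \<Rightarrow> int) set" where
  "places k = {v. v \<in> extensional (carrier k - {\<zero>\<^bsub>k\<^esub>}) \<and>
     v ` (carrier k - {\<zero>\<^bsub>k\<^esub>}) = UNIV \<and>
     (\<forall>x \<in> carrier k - {\<zero>\<^bsub>k\<^esub>}. \<forall>y \<in> carrier k - {\<zero>\<^bsub>k\<^esub>}.
        v (x \<otimes>\<^bsub>k\<^esub> y) = v x + v y \<and>
        (x \<oplus>\<^bsub>k\<^esub> y \<noteq> \<zero>\<^bsub>k\<^esub> \<longrightarrow> min (v x) (v y) \<le> v (x \<oplus>\<^bsub>k\<^esub> y)))}"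

definition valuation_ring_set :: "('a, 'b) ring_scheme \<Rightarrow> ('a \<Rightarrow> int) \<Rightarrow> 'a set" where
  "valuation_ring_set k v = {x \<in> carrier k. x = \<zero>\<^bsub>k\<^esub> \<or> 0 \<le> v x}"

definition valuation_ideal :: "('a, 'b) ring_scheme \<Rightarrow> ('a \<Rightarrow> int) \<Rightarrow> 'a set" where
  "valuation_ideal k v = {x \<in> carrier k. x = \<zero>\<^bsub>k\<^esub> \<or> 0 < v x}"

definition place_norm :: "('a, 'b) ring_scheme \<Rightarrow> ('a \<Rightarrow> int) \<Rightarrow> nat" where
  "place_norm k v =
     card (carrier ((k\<lparr>carrier := valuation_ring_set k v\<rparr>) Quot valuation_ideal k v))"

definition regular_ring :: "('a, 'b) ring_scheme \<Rightarrow> ('a \<Rightarrow> int) \<Rightarrow> ('a, 'b) ring_scheme" where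
  "regular_ring k pinf =
     k\<lparr>carrier := {x \<in> carrier k. \<forall>v \<in> places k - {pinf}. x \<in> valuation_ring_set k v}\<rparr>"

definition nonzero_ideals :: "('a, 'b) ring_scheme \<Rightarrow> 'a set set" where
  "nonzero_ideals R = {I. ideal I R \<and> I \<noteq> {\<zero>\<^bsub>R\<^esub>}}"

definition ideal_norm :: "('a, 'b) ring_scheme \<Rightarrow> 'a set \<Rightarrow> nat" where
  "ideal_norm R I = card (carrier (R Quot I))"


section \<open>The zeta function without the factor at a place\<close>

text \<open>The product is the unconditional limit of the finite partial products; it is only
  meaningful where the limit exists.\<close>

definition euler_partial_product ::
    "('a, 'b) ring_scheme \<Rightarrow> complex \<Rightarrow> ('a \<Rightarrow> int) set \<Rightarrow> complex" where
  "euler_partial_product k s F = (\<Prod>v\<in>F. inverse (1 - of_nat (place_norm k v) powr (- s)))"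

definition euler_product_converges ::
    "('a, 'b) ring_scheme \<Rightarrow> ('a \<Rightarrow> int) \<Rightarrow> complex \<Rightarrow> bool" where
  "euler_product_converges k pinf s \<longleftrightarrow>
     (\<exists>z. (euler_partial_product k s \<longlongrightarrow> z) (finite_subsets_at_top (places k - {pinf})))"

definition zeta_away :: "('a, 'b) ring_scheme \<Rightarrow> ('a \<Rightarrow> int) \<Rightarrow> complex \<Rightarrow> complex" where
  "zeta_away k pinf s =
     Lim (finite_subsets_at_top (places k - {pinf})) (euler_partial_product k s)"


section \<open>Operators on \<open>\<ell>\<^sup>2(I)\<close>\<close>

definition ell2 :: "'i set \<Rightarrow> ('i \<Rightarrow> complex) set" where
  "ell2 I = {f. (\<forall>i. i \<notin> I \<longrightarrow> f i = 0) \<and> (\<lambda>i. (cmod (f i))\<^sup>2) summable_on I}"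

definition ell2_inner :: "'i set \<Rightarrow> ('i \<Rightarrow> complex) \<Rightarrow> ('i \<Rightarrow> complex) \<Rightarrow> complex" where
  "ell2_inner I f g = (\<Sum>\<^sub>\<infinity>i\<in>I. cnj (f i) * g i)"

definition ell2_norm :: "'i set \<Rightarrow> ('i \<Rightarrow> complex) \<Rightarrow> real" where
  "ell2_norm I f = sqrt (\<Sum>\<^sub>\<infinity>i\<in>I. (cmod (f i))\<^sup>2)"

definition ell2_basis :: "'i \<Rightarrow> 'i \<Rightarrow> complex" where
  "ell2_basis i = (\<lambda>j. if j = i then 1 else 0)"

definition bounded_op :: "'i set \<Rightarrow> (('i \<Rightarrow> complex) \<Rightarrow> ('i \<Rightarrow> complex)) \<Rightarrow> bool" where
  "bounded_op I B \<longleftrightarrow> B \<in> ell2 I \<rightarrow>\<^sub>E ell2 I \<and>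
     (\<forall>f\<in>ell2 I. \<forall>g\<in>ell2 I. B (\<lambda>i. f i + g i) = (\<lambda>i. B f i + B g i)) \<and>
     (\<forall>c. \<forall>f\<in>ell2 I. B (\<lambda>i. c * f i) = (\<lambda>i. c * B f i)) \<and>
     (\<exists>C. \<forall>f\<in>ell2 I. ell2_norm I (B f) \<le> C * ell2_norm I f)"

text \<open>\<open>P = \<bar>B\<bar>\<close>: for \<open>P\<close> positive, the last condition says \<open>P\<^sup>2 = P\<^sup>* P = B\<^sup>* B\<close>.\<close>

definition is_abs_op ::
    "'i set \<Rightarrow> (('i \<Rightarrow> complex) \<Rightarrow> ('i \<Rightarrow> complex)) \<Rightarrow> (('i \<Rightarrow> complex) \<Rightarrow> ('i \<Rightarrow> complex)) \<Rightarrow> bool" where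
  "is_abs_op I B P \<longleftrightarrow> bounded_op I P \<and>
     (\<forall>f\<in>ell2 I. ell2_inner I f (P f) \<in> \<real>\<^sub>\<ge>\<^sub>0) \<and>
     (\<forall>f\<in>ell2 I. \<forall>g\<in>ell2 I. ell2_inner I (P f) (P g) = ell2_inner I (B f) (B g))"

definition trace_class :: "'i set \<Rightarrow> (('i \<Rightarrow> complex) \<Rightarrow> ('i \<Rightarrow> complex)) \<Rightarrow> bool" where
  "trace_class I B \<longleftrightarrow> bounded_op I B \<and>
     (\<exists>P. is_abs_op I B P \<and>
        (\<lambda>i. ell2_inner I (ell2_basis i) (P (ell2_basis i))) summable_on I)"

definition op_trace :: "'i set \<Rightarrow> (('i \<Rightarrow> complex) \<Rightarrow> ('i \<Rightarrow> complex)) \<Rightarrow> complex" where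
  "op_trace I B = (\<Sum>\<^sub>\<infinity>i\<in>I. ell2_inner I (ell2_basis i) (B (ell2_basis i)))"

text \<open>Unbounded operators are represented by their graphs.\<close>

type_synonym 'i unbounded_op = "(('i \<Rightarrow> complex) \<times> ('i \<Rightarrow> complex)) set"

definition scale_op :: "complex \<Rightarrow> 'i unbounded_op \<Rightarrow> 'i unbounded_op" where
  "scale_op c A = {(f, \<lambda>i. c * g i) | f g. (f, g) \<in> A}"

text \<open>The exponential of a self-adjoint operator \<open>A\<close> that is bounded above: the bounded operator
  given by the norm-convergent series \<open>\<Sum>n. A\<^sup>n f / n!\<close> on every entire vector \<open>f\<close> of \<open>A\<close>, i.e.
  every \<open>f\<close> in the domain of all powers of \<open>A\<close> with \<open>\<Sum>n. \<parallel>A\<^sup>n f\<parallel> r\<^sup>n / n! < \<infinity>\<close> for all \<open>r\<close>.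
  The entire vectors of a self-adjoint operator are dense, so there is exactly one such operator,
  and it agrees with the one from the spectral theorem. Below, \<open>g n\<close> is \<open>A\<^sup>n f\<close>.\<close>

definition is_exp_op :: "'i set \<Rightarrow> 'i unbounded_op \<Rightarrow> (('i \<Rightarrow> complex) \<Rightarrow> ('i \<Rightarrow> complex)) \<Rightarrow> bool" where
  "is_exp_op I A B \<longleftrightarrow> bounded_op I B \<and>
     (\<forall>g. (\<forall>n. (g n, g (Suc n)) \<in> A) \<and>
          (\<forall>r>0. summable (\<lambda>n. ell2_norm I (g n) * r ^ n / fact n)) \<longrightarrow>
        (\<lambda>N. ell2_norm I (\<lambda>i. B (g 0) i - (\<Sum>n<N. g n i / fact n))) \<longlonglongrightarrow> 0)"

definition exp_op :: "'i set \<Rightarrow> 'i unbounded_op \<Rightarrow> ('i \<Rightarrow> complex) \<Rightarrow> ('i \<Rightarrow> complex)" where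
  "exp_op I A = (THE B. is_exp_op I A B)"


section \<open>The Hamiltonian\<close>

text \<open>The self-adjoint operator with \<open>\<epsilon>\<^sub>\<aa> \<mapsto> (log N\<aa>) \<epsilon>\<^sub>\<aa>\<close>, on its maximal domain; this is the
  closure of the operator defined by this formula on the linear span of the basis.\<close>

definition hamiltonian :: "('a, 'b) ring_scheme \<Rightarrow> 'a set unbounded_op" where
  "hamiltonian R =
     {(f, g). f \<in> ell2 (nonzero_ideals R) \<and> g \<in> ell2 (nonzero_ideals R) \<and>
        (\<forall>a \<in> nonzero_ideals R. g a = of_real (ln (real (ideal_norm R a))) * f a)}"

lemma ell2_basis_scaled_in_ell2:
  assumes "i \<in> I"
  shows "(\<lambda>j. c * ell2_basis i j) \<in> ell2 I"
proof -
  have "(\<lambda>j. (cmod (c * ell2_basis i j))\<^sup>2) summable_on {i}"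
    by simp
  then have "(\<lambda>j. (cmod (c * ell2_basis i j))\<^sup>2) summable_on I"
    by (rule summable_on_cong_neutral[THEN iffD1, rotated -1])
       (use assms in \<open>auto simp: ell2_basis_def\<close>)
  then show ?thesis
    using assms by (auto simp: ell2_def ell2_basis_def)
qed

lemma hamiltonian_basis:
  assumes "a \<in> nonzero_ideals R"
  shows "(ell2_basis a, \<lambda>b. of_real (ln (real (ideal_norm R a))) * ell2_basis a b) \<in> hamiltonian R"
  using ell2_basis_scaled_in_ell2[OF assms] ell2_basis_scaled_in_ell2[OF assms, of 1]
  by (auto simp: hamiltonian_def ell2_basis_def)

end

(*
  Let T be transcendental with k finite of degree n over F_p(T), and identify places with normalised
  discrete valuations. Expanding elements of a subring R in powers of a nonzero y with digits that are
  incongruent modulo y, and comparing with the number of elements of bounded degree in a basis, gives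
  card (R / y R) <= p^(n deg y) for every polynomial y in T, and a finite bound for every y. This
  counting argument replaces the theory of extensions of valuations: it shows that residue fields are
  finite, that an element has finitely many zeros and poles, that there are at most n p^(f+1) places
  with residue field of size between p^f and p^(f+1), and that a maximal subring containing x but not
  1/x is a discrete valuation ring. It also yields Riemann's inequality for the finite sets
  L(E) = {x. v x >= E v for all v}, and from it strong approximation away from the
  place at infinity. By strong approximation the nonzero ideals of the ring are exactly the sets
  {x. v x >= m v for all finite v}, with m of finite support, and their norms are products of powers
  of the norms of places. The Euler product then is the sum of N(a)^(-beta) over the nonzero ideals a,
  which is the trace of the diagonal operator exp(-beta H).
*)
theory Submission
  imports Defs
begin

section \<open>Index of subgroups\<close>

text \<open>All invariants are indices and cardinalities, never dimensions, so no constant field has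
  to be determined, and one multiplicativity law (\<open>quot_tower\<close>) does the work of exact
  sequences. The counting estimates hold at first only up to a constant factor, caused by common
  denominators; they are applied to M-th powers, and the constant vanishes as M grows. In divisor
  language \<open>rho E\<close> is q^(l(D) - deg D) with D = -E, and Riemann's inequality says that
  it stays away from 0. The obstacle is that no product formula is at hand. Its substitute is the
  exact norm q^n of the pole divisor of T: counting with 1/T bounds this norm above, the growth of
  L(m Dinf) bounds it below. It follows that the divisor of a nonzero polynomial in T has norm at
  most 1, which is the direction needed. Riemann-Roch and canonical divisors do not occur: Riemann's
  inequality makes the infimum of \<open>rho\<close> positive, and a proper divisor of
  \<open>res_card v\<close> is at most half of it, which is where the factor 2 in the choice of a
  nearly minimal \<open>rho\<close> comes from.\<close>

definition add_subgroup :: "'g::ab_group_add set \<Rightarrow> bool" where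
  "add_subgroup A \<longleftrightarrow> 0 \<in> A \<and> (\<forall>x\<in>A. \<forall>y\<in>A. x - y \<in> A)"

text \<open>\<open>B\<close> need not lie in \<open>A\<close>: this is the image of \<open>A\<close>
  in the whole group modulo \<open>B\<close>. Since \<open>card\<close> of an infinite set is 0,
  finiteness is stated separately from \<open>idx\<close>.\<close>

definition quot :: "'g::ab_group_add set \<Rightarrow> 'g set \<Rightarrow> 'g set set" where
  "quot A B = (\<lambda>a. (+) a ` B) ` A"

abbreviation idx :: "'g::ab_group_add set \<Rightarrow> 'g set \<Rightarrow> nat" where
  "idx A B \<equiv> card (quot A B)"

lemma add_subgroup_zero: "add_subgroup A \<Longrightarrow> 0 \<in> A"
  and add_subgroup_diff: "add_subgroup A \<Longrightarrow> x \<in> A \<Longrightarrow> y \<in> A \<Longrightarrow> x - y \<in> A"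
  by (auto simp: add_subgroup_def)

lemma add_subgroup_uminus: "add_subgroup A \<Longrightarrow> x \<in> A \<Longrightarrow> - x \<in> A"
  using add_subgroup_diff[of A 0 x] add_subgroup_zero[of A] by simp

lemma add_subgroup_add: "add_subgroup A \<Longrightarrow> x \<in> A \<Longrightarrow> y \<in> A \<Longrightarrow> x + y \<in> A"
  using add_subgroup_diff[of A x "- y"] add_subgroup_uminus[of A y] by simp

lemma add_subgroup_commute: "add_subgroup A \<Longrightarrow> x - y \<in> A \<longleftrightarrow> y - x \<in> A"
  using add_subgroup_uminus[of A "x - y"] add_subgroup_uminus[of A "y - x"] by auto

lemma add_subgroup_zero_set: "add_subgroup {0}"
  by (simp add: add_subgroup_def)

lemma add_subgroup_sum:
  assumes "add_subgroup A" "\<And>i. i \<in> I \<Longrightarrow> f i \<in> A"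
  shows "sum f I \<in> A"
  using assms(2) by (induction I rule: infinite_finite_induct)
    (auto intro: add_subgroup_add assms(1) add_subgroup_zero)

lemma coset_eq_iff:
  assumes "add_subgroup B"
  shows "(+) a ` B = (+) b ` B \<longleftrightarrow> a - b \<in> B"
proof
  assume "(+) a ` B = (+) b ` B"
  then have "a + 0 \<in> (+) b ` B"
    using add_subgroup_zero[OF assms] by blast
  then show "a - b \<in> B" by auto
next
  have *: "(+) a ` B \<subseteq> (+) b ` B" if "a - b \<in> B" for a b
  proof
    fix x assume "x \<in> (+) a ` B"
    then obtain c where "c \<in> B" "x = a + c" by auto
    then have "x = b + ((a - b) + c)" "(a - b) + c \<in> B"
      using add_subgroup_add[OF assms that] by auto
    then show "x \<in> (+) b ` B" by blast
  qed
  assume "a - b \<in> B"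
  then show "(+) a ` B = (+) b ` B"
    using *[of a b] *[of b a] add_subgroup_commute[OF assms, of a b] by auto
qed

lemma obtain_transversal:
  obtains Z where "Z \<subseteq> A" "bij_betw (\<lambda>a. (+) a ` B) Z (quot A B)"
proof -
  have "\<exists>Z\<subseteq>A. inj_on (\<lambda>a. (+) a ` B) Z \<and> (\<lambda>a. (+) a ` B) ` A = (\<lambda>a. (+) a ` B) ` Z"
    by (rule subset_image_inj[THEN iffD1]) auto
  then show ?thesis
    using that by (auto simp: quot_def bij_betw_def)
qed

text \<open>\<open>f\<close> need not be additive: preserving and reflecting congruence makes it
  well defined and injective on cosets, and \<open>surj\<close> asks for a preimage only modulo
  \<open>B'\<close>. It serves for multiplication by a constant as well as for the second
  isomorphism theorem, where \<open>f\<close> is the identity.\<close>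

lemma quot_bij_transfer:
  assumes B: "add_subgroup B" and B': "add_subgroup B'"
    and f: "\<And>x. x \<in> A \<Longrightarrow> f x \<in> A'"
    and cong: "\<And>x y. x \<in> A \<Longrightarrow> y \<in> A \<Longrightarrow> f x - f y \<in> B' \<longleftrightarrow> x - y \<in> B"
    and surj: "\<And>a. a \<in> A' \<Longrightarrow> \<exists>x\<in>A. f x - a \<in> B'"
  shows "(finite (quot A B) \<longleftrightarrow> finite (quot A' B')) \<and> idx A B = idx A' B'"
proof -
  obtain Z where Z: "Z \<subseteq> A" "bij_betw (\<lambda>a. (+) a ` B) Z (quot A B)"
    by (rule obtain_transversal)
  have "bij_betw (\<lambda>x. (+) (f x) ` B') Z (quot A' B')"
    unfolding bij_betw_def
  proof
    show "inj_on (\<lambda>x. (+) (f x) ` B') Z"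
    proof (rule inj_onI)
      fix x y assume xy: "x \<in> Z" "y \<in> Z" "(+) (f x) ` B' = (+) (f y) ` B'"
      then have "x - y \<in> B"
        using cong[of x y] Z(1) by (auto simp: coset_eq_iff[OF B'])
      then have "(+) x ` B = (+) y ` B" by (simp add: coset_eq_iff[OF B])
      with Z(2) xy show "x = y" by (auto simp: bij_betw_def inj_on_def)
    qed
    show "(\<lambda>x. (+) (f x) ` B') ` Z = quot A' B'"
    proof
      show "(\<lambda>x. (+) (f x) ` B') ` Z \<subseteq> quot A' B'"
        using Z(1) f by (auto simp: quot_def)
      show "quot A' B' \<subseteq> (\<lambda>x. (+) (f x) ` B') ` Z"
      proof
        fix Q assume "Q \<in> quot A' B'"
        then obtain a where a: "a \<in> A'" "Q = (+) a ` B'" by (auto simp: quot_def)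
        obtain x where x: "x \<in> A" "f x - a \<in> B'" using surj[OF a(1)] by auto
        have "(+) x ` B \<in> (\<lambda>a. (+) a ` B) ` Z"
          using Z(2) x by (auto simp: quot_def bij_betw_def)
        then obtain y where y: "y \<in> Z" "(+) x ` B = (+) y ` B" by auto
        then have "f x - f y \<in> B'"
          using cong[of x y] x Z(1) by (auto simp: coset_eq_iff[OF B])
        then have "(+) (f y) ` B' = Q"
          unfolding a coset_eq_iff[OF B', symmetric] using x(2) coset_eq_iff[OF B'] by metis
        with y show "Q \<in> (\<lambda>x. (+) (f x) ` B') ` Z" by auto
      qed
    qed
  qed
  with Z(2) show ?thesis
    using bij_betw_finite bij_betw_same_card by metis
qed

lemma quot_inj_transfer:
  assumes B: "add_subgroup B" and B': "add_subgroup B'"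
    and f: "\<And>x. x \<in> A \<Longrightarrow> f x \<in> A'"
    and cong: "\<And>x y. x \<in> A \<Longrightarrow> y \<in> A \<Longrightarrow> f x - f y \<in> B' \<Longrightarrow> x - y \<in> B"
    and fin: "finite (quot A' B')"
  shows "finite (quot A B)" "idx A B \<le> idx A' B'"
proof -
  obtain Z where Z: "Z \<subseteq> A" "bij_betw (\<lambda>a. (+) a ` B) Z (quot A B)"
    by (rule obtain_transversal)
  have "inj_on (\<lambda>x. (+) (f x) ` B') Z"
  proof (rule inj_onI)
    fix x y assume xy: "x \<in> Z" "y \<in> Z" "(+) (f x) ` B' = (+) (f y) ` B'"
    then have "x - y \<in> B"
      using cong[of x y] Z(1) by (auto simp: coset_eq_iff[OF B'])
    then have "(+) x ` B = (+) y ` B" by (simp add: coset_eq_iff[OF B])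
    with Z(2) xy show "x = y" by (auto simp: bij_betw_def inj_on_def)
  qed
  moreover have "(\<lambda>x. (+) (f x) ` B') ` Z \<subseteq> quot A' B'"
    using Z(1) f by (auto simp: quot_def)
  ultimately have "finite Z" "card Z \<le> idx A' B'"
    using fin by (meson finite_subset finite_imageD, meson card_inj_on_le)
  with Z(2) show "finite (quot A B)" "idx A B \<le> idx A' B'"
    using bij_betw_finite bij_betw_same_card by metis+
qed

text \<open>A coset of \<open>C\<close> is represented by exactly one sum of a representative for
  A/B and one for B/C. The product formula survives infinite indices because then
  \<open>card\<close> is 0 on both sides; that both factors are nonempty lets finiteness pass from
  the product to each factor.\<close>

lemma quot_tower:
  assumes A: "add_subgroup A" and B: "add_subgroup B" and C: "add_subgroup C"
    and sub: "C \<subseteq> B" "B \<subseteq> A"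
  shows "idx A C = idx A B * idx B C"
    and "finite (quot A B) \<Longrightarrow> finite (quot B C) \<Longrightarrow> finite (quot A C)"
    and "finite (quot A C) \<Longrightarrow> finite (quot A B)"
    and "finite (quot A C) \<Longrightarrow> finite (quot B C)"
proof -
  obtain Z where Z: "Z \<subseteq> A" "bij_betw (\<lambda>a. (+) a ` B) Z (quot A B)"
    by (rule obtain_transversal)
  obtain Y where Y: "Y \<subseteq> B" "bij_betw (\<lambda>a. (+) a ` C) Y (quot B C)"
    by (rule obtain_transversal)
  have "A \<noteq> {}" "B \<noteq> {}"
    using add_subgroup_zero[OF A] add_subgroup_zero[OF B] by auto
  then have "quot A B \<noteq> {}" "quot B C \<noteq> {}"
    by (simp_all only: quot_def image_is_empty not_False_eq_True)
  then have ne: "Z \<noteq> {}" "Y \<noteq> {}"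
    using bij_betw_imp_surj_on[OF Z(2)] bij_betw_imp_surj_on[OF Y(2)] by (metis image_empty)+
  have bij: "bij_betw (\<lambda>(x, y). (+) (x + y) ` C) (Z \<times> Y) (quot A C)"
    unfolding bij_betw_def
  proof
    show "inj_on (\<lambda>(x, y). (+) (x + y) ` C) (Z \<times> Y)"
    proof (rule inj_onI, clarsimp)
      fix x y x' y' assume xy: "x \<in> Z" "y \<in> Y" "x' \<in> Z" "y' \<in> Y" "(+) (x + y) ` C = (+) (x' + y') ` C"
      have eq: "(x + y) - (x' + y') \<in> C" by (rule coset_eq_iff[OF C, THEN iffD1, OF xy(5)])
      have "y - y' \<in> B" by (rule add_subgroup_diff[OF B]) (use xy Y(1) in auto)
      moreover have "(x + y) - (x' + y') \<in> B" using eq sub by auto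
      ultimately have "((x + y) - (x' + y')) - (y - y') \<in> B" by (rule add_subgroup_diff[OF B, rotated])
      then have "x - x' \<in> B" by (simp add: algebra_simps)
      then have "(+) x ` B = (+) x' ` B" by (rule coset_eq_iff[OF B, THEN iffD2])
      then have x: "x = x'" using inj_onD[OF bij_betw_imp_inj_on[OF Z(2)]] xy by blast
      then have "y - y' \<in> C" using eq by simp
      then have "(+) y ` C = (+) y' ` C" by (rule coset_eq_iff[OF C, THEN iffD2])
      then show "x = x' \<and> y = y'" using inj_onD[OF bij_betw_imp_inj_on[OF Y(2)]] xy x by blast
    qed
    show "(\<lambda>(x, y). (+) (x + y) ` C) ` (Z \<times> Y) = quot A C"
    proof
      show "(\<lambda>(x, y). (+) (x + y) ` C) ` (Z \<times> Y) \<subseteq> quot A C"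
      proof clarify
        fix x y assume "x \<in> Z" "y \<in> Y"
        then have "x + y \<in> A"
          using Z(1) Y(1) sub by (intro add_subgroup_add[OF A]) auto
        then show "(+) (x + y) ` C \<in> quot A C" unfolding quot_def by (rule imageI)
      qed
      show "quot A C \<subseteq> (\<lambda>(x, y). (+) (x + y) ` C) ` (Z \<times> Y)"
      proof
        fix Q assume "Q \<in> quot A C"
        then obtain a where a: "a \<in> A" "Q = (+) a ` C" by (auto simp: quot_def)
        then have "(+) a ` B \<in> (\<lambda>a. (+) a ` B) ` Z"
          using Z(2) by (auto simp: bij_betw_def quot_def)
        then obtain x where x: "x \<in> Z" "a - x \<in> B" by (auto simp: coset_eq_iff[OF B])
        then have "(+) (a - x) ` C \<in> (\<lambda>a. (+) a ` C) ` Y"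
          using Y(2) by (auto simp: bij_betw_def quot_def)
        then obtain y where y: "y \<in> Y" "(a - x) - y \<in> C" by (auto simp: coset_eq_iff[OF C])
        then have "Q = (+) (x + y) ` C"
          unfolding a coset_eq_iff[OF C] by (simp add: algebra_simps)
        with x y show "Q \<in> (\<lambda>(x, y). (+) (x + y) ` C) ` (Z \<times> Y)" by force
      qed
    qed
  qed
  have cX: "card Z = idx A B" "finite Z \<longleftrightarrow> finite (quot A B)"
    using Z(2) bij_betw_finite bij_betw_same_card by metis+
  have cY: "card Y = idx B C" "finite Y \<longleftrightarrow> finite (quot B C)"
    using Y(2) bij_betw_finite bij_betw_same_card by metis+
  show "idx A C = idx A B * idx B C"
    using bij_betw_same_card[OF bij] cX cY by (simp add: card_cartesian_product)
  have "finite (quot A C) \<longleftrightarrow> finite Z \<and> finite Y"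
    using bij_betw_finite[OF bij] ne by (auto simp: finite_cartesian_product_iff)
  then show "finite (quot A B) \<Longrightarrow> finite (quot B C) \<Longrightarrow> finite (quot A C)"
    "finite (quot A C) \<Longrightarrow> finite (quot A B)" "finite (quot A C) \<Longrightarrow> finite (quot B C)"
    using cX cY by auto
qed

lemma quot_zero:
  shows "idx A {0} = card A" "finite (quot A {0}) \<longleftrightarrow> finite A"
proof -
  have "bij_betw (\<lambda>a. (+) a ` {0}) A (quot A {0})"
    by (auto simp: bij_betw_def quot_def inj_on_def)
  then show "idx A {0} = card A" "finite (quot A {0}) \<longleftrightarrow> finite A"
    using bij_betw_finite bij_betw_same_card by metis+
qed

lemma idx_pos: "finite (quot A B) \<Longrightarrow> add_subgroup A \<Longrightarrow> idx A B > 0"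
  by (auto simp: card_gt_0_iff quot_def dest: add_subgroup_zero)

lemma idx_1_imp_subset:
  assumes "add_subgroup A" and B: "add_subgroup B" and "idx A B = 1"
  shows "A \<subseteq> B"
proof
  fix a assume "a \<in> A"
  obtain q where q: "quot A B = {q}" using assms(3) by (auto simp: card_1_singleton_iff)
  have "(+) a ` B \<in> quot A B" unfolding quot_def using \<open>a \<in> A\<close> by (rule imageI)
  moreover have "(+) 0 ` B \<in> quot A B"
    unfolding quot_def using add_subgroup_zero[OF assms(1)] by (rule imageI)
  ultimately have "(+) a ` B = (+) 0 ` B" unfolding q singleton_iff by simp
  then have "a - 0 \<in> B" by (rule coset_eq_iff[OF B, THEN iffD1])
  then show "a \<in> B" by simp
qed

text \<open>Counting only sees finite sets of pairwise incongruent elements. A uniform bound on them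
  yields finiteness too, because an infinite transversal has a subset with \<open>Suc N\<close>
  elements.\<close>

lemma quot_bounded:
  assumes B: "add_subgroup B"
    and bound: "\<And>Z. finite Z \<Longrightarrow> Z \<subseteq> A \<Longrightarrow> (\<And>x y. x \<in> Z \<Longrightarrow> y \<in> Z \<Longrightarrow> x \<noteq> y \<Longrightarrow> x - y \<notin> B) \<Longrightarrow> card Z \<le> N"
  shows "finite (quot A B)" "idx A B \<le> N"
proof -
  obtain Z where Z: "Z \<subseteq> A" "bij_betw (\<lambda>a. (+) a ` B) Z (quot A B)"
    by (rule obtain_transversal)
  have *: "card Y \<le> N" if "finite Y" "Y \<subseteq> Z" for Y
  proof (rule bound[OF that(1)])
    show "Y \<subseteq> A" using that Z(1) by auto
    fix x y assume "x \<in> Y" "y \<in> Y" "x \<noteq> y"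
    then show "x - y \<notin> B"
      using Z(2) that(2) coset_eq_iff[OF B, of x y] by (metis bij_betw_def inj_onD subsetD)
  qed
  have fin: "finite Z"
  proof (rule ccontr)
    assume "infinite Z"
    then obtain Y where "finite Y" "card Y = Suc N" "Y \<subseteq> Z"
      using infinite_arbitrarily_large by blast
    with *[of Y] show False by simp
  qed
  show "finite (quot A B)" "idx A B \<le> N"
    using *[OF fin order_refl] fin bij_betw_finite[OF Z(2)] bij_betw_same_card[OF Z(2)] by auto
qed

lemma card_le_idx:
  assumes B: "add_subgroup B" and fin: "finite (quot A B)" and Z: "Z \<subseteq> A"
    and sep: "\<And>x y. x \<in> Z \<Longrightarrow> y \<in> Z \<Longrightarrow> x \<noteq> y \<Longrightarrow> x - y \<notin> B"
  shows "card Z \<le> idx A B"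
proof (rule card_inj_on_le[OF _ _ fin])
  show "inj_on (\<lambda>a. (+) a ` B) Z"
    using sep by (auto simp: inj_on_def coset_eq_iff[OF B])
  show "(\<lambda>a. (+) a ` B) ` Z \<subseteq> quot A B"
    using Z by (auto simp: quot_def)
qed

section \<open>Discrete valuations of a field and weak approximation\<close>

text \<open>The value at \<open>0\<close> is junk; the condition \<open>m \<le> v x\<close>, read with \<open>v 0 = \<infinity>\<close>, is \<open>vge v m x\<close>.\<close>

definition is_place :: "('k::field \<Rightarrow> int) \<Rightarrow> bool" where
  "is_place v \<longleftrightarrow> v 0 = 0 \<and> (\<exists>x. x \<noteq> 0 \<and> v x = 1) \<and>
     (\<forall>x y. x \<noteq> 0 \<longrightarrow> y \<noteq> 0 \<longrightarrow> v (x * y) = v x + v y) \<and>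
     (\<forall>x y. x \<noteq> 0 \<longrightarrow> y \<noteq> 0 \<longrightarrow> x + y \<noteq> 0 \<longrightarrow> min (v x) (v y) \<le> v (x + y))"

definition vge :: "('k::field \<Rightarrow> int) \<Rightarrow> int \<Rightarrow> 'k \<Rightarrow> bool" where
  "vge v m x \<longleftrightarrow> x = 0 \<or> m \<le> v x"

lemma vge_zero [simp]: "vge v m 0"
  by (simp add: vge_def)

lemma vge_mono: "vge v m x \<Longrightarrow> n \<le> m \<Longrightarrow> vge v n x"
  by (auto simp: vge_def)

lemma place_mult: "is_place v \<Longrightarrow> x \<noteq> 0 \<Longrightarrow> y \<noteq> 0 \<Longrightarrow> v (x * y) = v x + v y"
  by (auto simp: is_place_def)

lemma place_one: "is_place v \<Longrightarrow> v 1 = 0"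
  using place_mult[of v 1 1] by simp

lemma place_uminus: assumes "is_place v" shows "v (- x) = v x"
proof (cases "x = 0")
  case False
  have "v (- 1) + v (- 1) = 0"
    using place_mult[OF assms, of "- 1" "- 1"] place_one[OF assms] by simp
  then show ?thesis using place_mult[OF assms, of "- 1" x] False by simp
qed simp

lemma place_inverse: assumes "is_place v" shows "v (inverse x) = - v x"
proof (cases "x = 0")
  case True
  then show ?thesis using assms by (simp add: is_place_def)
next
  case False
  then show ?thesis
    using place_mult[OF assms, of x "inverse x"] place_one[OF assms] by simp
qed

lemma place_divide: "is_place v \<Longrightarrow> x \<noteq> 0 \<Longrightarrow> y \<noteq> 0 \<Longrightarrow> v (x / y) = v x - v y"
  using place_mult[of v x "inverse y"] place_inverse[of v y] by (simp add: divide_inverse)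

lemma place_power: "is_place v \<Longrightarrow> x \<noteq> 0 \<Longrightarrow> v (x ^ n) = int n * v x"
  by (induction n) (auto simp: place_one place_mult algebra_simps)

lemma place_prod:
  "is_place v \<Longrightarrow> (\<And>i. i \<in> I \<Longrightarrow> f i \<noteq> 0) \<Longrightarrow> v (prod f I) = (\<Sum>i\<in>I. v (f i))"
  by (induction I rule: infinite_finite_induct) (auto simp: place_one place_mult)

lemma place_uniformizer: "is_place v \<Longrightarrow> \<exists>x. x \<noteq> 0 \<and> v x = 1"
  by (simp add: is_place_def)

lemma place_value:
  assumes "is_place v" shows "\<exists>x. x \<noteq> 0 \<and> v x = m"
proof -
  obtain p where p: "p \<noteq> 0" "v p = 1" using place_uniformizer[OF assms] by auto
  show ?thesis
  proof (cases "m \<ge> 0")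
    case True
    then show ?thesis
      using place_power[OF assms p(1), of "nat m"] p by (intro exI[of _ "p ^ nat m"]) auto
  next
    case False
    then show ?thesis
      using place_power[OF assms p(1), of "nat (- m)"] p place_inverse[OF assms]
      by (intro exI[of _ "inverse (p ^ nat (- m))"]) auto
  qed
qed

lemma vge_add: "is_place v \<Longrightarrow> vge v m x \<Longrightarrow> vge v m y \<Longrightarrow> vge v m (x + y)"
  unfolding vge_def is_place_def by (cases "x = 0 \<or> y = 0") (auto, smt (verit))

lemma vge_uminus: "is_place v \<Longrightarrow> vge v m (- x) \<longleftrightarrow> vge v m x"
  by (simp add: vge_def place_uminus)

lemma vge_diff: "is_place v \<Longrightarrow> vge v m x \<Longrightarrow> vge v m y \<Longrightarrow> vge v m (x - y)"
  using vge_add[of v m x "- y"] vge_uminus[of v m y] by simp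

lemma vge_mult: "is_place v \<Longrightarrow> vge v m x \<Longrightarrow> vge v n y \<Longrightarrow> vge v (m + n) (x * y)"
  by (auto simp: vge_def place_mult)

lemma vge_sum: "is_place v \<Longrightarrow> (\<And>i. i \<in> I \<Longrightarrow> vge v m (f i)) \<Longrightarrow> vge v m (sum f I)"
  by (induction I rule: infinite_finite_induct) (auto intro: vge_add)

lemma vge_scale: "is_place v \<Longrightarrow> c \<noteq> 0 \<Longrightarrow> vge v (m + v c) (c * x) \<longleftrightarrow> vge v m x"
  by (auto simp: vge_def place_mult)

lemma vge_power: "is_place v \<Longrightarrow> vge v m x \<Longrightarrow> vge v (int n * m) (x ^ n)"
  by (cases "n = 0") (auto simp: vge_def place_power place_one intro: mult_left_mono)

text \<open>Strict ultrametric principle: as x = y - (y - x), an element \<open>y\<close> of value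
  at least \<open>v x + 1\<close> would force the same on \<open>x\<close>. With \<open>vge\<close>
  the case \<open>y = x\<close> is included.\<close>

lemma place_eqI:
  assumes v: "is_place v" and "x \<noteq> 0" and d: "vge v (v x + 1) (y - x)"
  shows "y \<noteq> 0" "v y = v x"
proof -
  show y: "y \<noteq> 0"
    using d \<open>x \<noteq> 0\<close> place_uminus[OF v, of x] by (auto simp: vge_def)
  have "vge v (v x) y" using vge_add[OF v, of "v x" x "y - x"] d by (auto simp: vge_def)
  moreover have "\<not> vge v (v x + 1) y"
    using vge_diff[OF v _ d, of y] \<open>x \<noteq> 0\<close> by (auto simp: vge_def)
  ultimately show "v y = v x" using y by (auto simp: vge_def)
qed

text \<open>Units for \<open>v\<close> are units for \<open>w\<close>, hence \<open>w\<close> is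
  \<open>w p\<close> times \<open>v\<close> for a uniformizer \<open>p\<close> of \<open>v\<close>.
  This factor is nonnegative and divides the value 1 of \<open>w\<close>, so it is 1.\<close>

lemma place_le_imp_eq:
  assumes v: "is_place v" and w: "is_place w" and le: "\<And>x. vge v 0 x \<Longrightarrow> vge w 0 x"
  shows "v = w"
proof -
  have unit: "w x = 0" if "v x = 0" for x
    using le[of x] le[of "inverse x"] that place_inverse[OF v, of x] place_inverse[OF w, of x] w
    by (cases "x = 0") (auto simp: vge_def is_place_def)
  obtain p where p: "p \<noteq> 0" "v p = 1" using place_uniformizer[OF v] by auto
  have pw: "w x = v x * w p" if x: "x \<noteq> 0" for x
  proof (cases "v x \<ge> 0")
    case True
    have "w (x / p ^ nat (v x)) = 0"
      by (rule unit) (use True p x in \<open>simp add: place_divide[OF v] place_power[OF v]\<close>)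
    then show ?thesis using True p x by (simp add: place_divide[OF w] place_power[OF w])
  next
    case False
    have "w (x * p ^ nat (- v x)) = 0"
      by (rule unit) (use False p x in \<open>simp add: place_mult[OF v] place_power[OF v]\<close>)
    then show ?thesis using False p x by (simp add: place_mult[OF w] place_power[OF w])
  qed
  have "w p \<ge> 0" using le[of p] p by (auto simp: vge_def)
  moreover obtain q where "q \<noteq> 0" "w q = 1" using place_uniformizer[OF w] by auto
  ultimately have "w p = 1" using pw[of q] zmult_eq_1_iff[of "v q" "w p"] by simp
  then have "v x = w x" for x
    using pw[of x] v w by (cases "x = 0") (auto simp: is_place_def)
  then show ?thesis by auto
qed

section \<open>Weak approximation\<close>

lemma separate_places:
  assumes v: "is_place v" and w: "is_place w" and "v \<noteq> w"
  shows "\<exists>z. z \<noteq> 0 \<and> v z > 0 \<and> w z < 0"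
proof -
  obtain x where x: "vge v 0 x" "\<not> vge w 0 x" using place_le_imp_eq[OF v w] assms(3) by auto
  obtain y where y: "vge w 0 y" "\<not> vge v 0 y" using place_le_imp_eq[OF w v] assms(3) by auto
  \<comment> \<open>Each of \<open>x\<close> and \<open>y\<close> is integral at one place and has a
    pole at the other, so the quotient has a zero at \<open>v\<close> and a pole at
    \<open>w\<close>.\<close>
  show ?thesis
    by (rule exI[of _ "x / y"])
      (use x y in \<open>auto simp: vge_def place_divide[OF v] place_divide[OF w]\<close>)
qed

lemma place_one_plus_pos: "is_place v \<Longrightarrow> c = 0 \<or> v c > 0 \<Longrightarrow> 1 + c \<noteq> 0 \<and> v (1 + c) = 0"
  using place_eqI[of v 1 "1 + c"] place_one[of v] by (auto simp: vge_def)

lemma place_one_plus_neg: "is_place v \<Longrightarrow> v c < 0 \<Longrightarrow> 1 + c \<noteq> 0 \<and> v (1 + c) = v c"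
  using place_eqI[of v c "1 + c"] place_one[of v] by (cases "c = 0") (auto simp: vge_def is_place_def)

text \<open>Induction on \<open>F\<close>: \<open>c\<close> handles the old places, \<open>y\<close>
  separates the new \<open>w\<close> from \<open>v\<close>, and a high power of \<open>c\<close>
  outweighs the values of \<open>y\<close> on \<open>F\<close>. If \<open>c\<close> has no pole at
  \<open>w\<close>, then c^r y works. Otherwise c^r is replaced by c^r / (1 + c^r), which is a unit
  at both \<open>v\<close> and \<open>w\<close> and keeps the value of c^r on
  \<open>F\<close>.\<close>

lemma isolate_place:
  assumes "finite F" and v: "is_place v" and F: "\<And>w. w \<in> F \<Longrightarrow> is_place w" and "v \<notin> F"
  shows "\<exists>c. c \<noteq> 0 \<and> v c < 0 \<and> (\<forall>w\<in>F. w c > 0)"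
  using assms(1) F assms(4)
proof (induction F)
  case empty
  then show ?case using place_value[OF v, of "- 1"] by auto
next
  case (insert w F)
  then obtain c where c: "c \<noteq> 0" "v c < 0" "\<And>w'. w' \<in> F \<Longrightarrow> w' c > 0" by auto
  have w: "is_place w" using insert by auto
  have v': "is_place w'" if "w' \<in> F" for w' using insert that by auto
  obtain y where y: "y \<noteq> 0" "w y > 0" "v y < 0"
    using separate_places[OF w v] insert by auto
  \<comment> \<open>Exceeds every absolute value of \<open>y\<close> on \<open>F\<close>, and is
    positive even for empty \<open>F\<close>.\<close>
  define r where "r = nat (1 + (\<Sum>w'\<in>F. \<bar>w' y\<bar>))"
  have r: "int r * w' c + w' y > 0" if "w' \<in> F" for w'
  proof -
    have "\<bar>w' y\<bar> \<le> (\<Sum>w'\<in>F. \<bar>w' y\<bar>)"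
      by (rule member_le_sum) (use insert that in auto)
    then have "\<bar>w' y\<bar> < int r" by (simp add: r_def)
    moreover have "int r * w' c \<ge> int r * 1" using c(3)[OF that] by (intro mult_left_mono) auto
    ultimately show ?thesis by linarith
  qed
  have "(\<Sum>w'\<in>F. \<bar>w' y\<bar>) \<ge> 0" by (rule sum_nonneg) auto
  then have r0: "r > 0" unfolding r_def zero_less_nat_eq by linarith
  show ?case
  proof (cases "w c \<ge> 0")
    case True
    have vv: "u (c ^ r * y) = int r * u c + u y" if "is_place u" for u
      using c y by (simp add: place_mult[OF that] place_power[OF that])
    have "int r * v c \<le> 0" "int r * w c \<ge> 0"
      using c True by (auto simp: mult_le_0_iff)
    then show ?thesis
      by (intro exI[of _ "c ^ r * y"]) (use vv[OF v] vv[OF w] vv[OF v'] r c y in auto)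
  next
    case False
    have neg: "1 + c ^ r \<noteq> 0 \<and> u (1 + c ^ r) = int r * u c" if "is_place u" "u c < 0" for u
      using place_one_plus_neg[OF that(1), of "c ^ r"] place_power[OF that(1) c(1), of r] that r0
      by (auto simp: mult_less_0_iff)
    have pos: "u (1 + c ^ r) = 0" if "is_place u" "u c > 0" for u
      using place_one_plus_pos[OF that(1), of "c ^ r"] place_power[OF that(1) c(1), of r] that r0
      by (auto simp: zero_less_mult_iff)
    have nz: "1 + c ^ r \<noteq> 0" using neg[OF v] c by auto
    have val: "u (c ^ r * y / (1 + c ^ r)) = int r * u c + u y - u (1 + c ^ r)" if "is_place u" for u
      using c y nz by (simp add: place_mult[OF that] place_power[OF that] place_divide[OF that])
    have "0 < u (c ^ r * y / (1 + c ^ r))" if "u \<in> F" for u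
      using val[OF v'[OF that]] pos[OF v'[OF that]] c(3)[OF that] r[OF that] by simp
    then show ?thesis
      by (intro exI[of _ "c ^ r * y / (1 + c ^ r)"])
        (use val[OF v] val[OF w] neg[OF v] neg[OF w] c y nz False in auto)
  qed
qed

text \<open>For \<open>c\<close> from \<open>isolate_place\<close> the quotient c^r / (1 + c^r)
  tends to 1 where \<open>c\<close> has a pole and to 0 where it has a zero.\<close>

lemma approx_idempotent:
  assumes "finite F" and v: "is_place v" and F: "\<And>w. w \<in> F \<Longrightarrow> is_place w" and "v \<notin> F"
  shows "\<exists>e. vge v m (e - 1) \<and> (\<forall>w\<in>F. vge w m e)"
proof -
  obtain c where c: "c \<noteq> 0" "v c < 0" "\<And>w. w \<in> F \<Longrightarrow> w c > 0"
    using isolate_place[OF assms] by auto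
  define r where "r = nat (max 1 m)"
  have r: "r > 0" "int r \<ge> m" by (auto simp: r_def)
  have 1: "1 + c ^ r \<noteq> 0 \<and> v (1 + c ^ r) = int r * v c"
    using place_one_plus_neg[OF v, of "c ^ r"] place_power[OF v c(1), of r] c(2) r(1)
    by (auto simp: mult_less_0_iff)
  have "c ^ r / (1 + c ^ r) - 1 = - inverse (1 + c ^ r)"
    using 1 by (simp add: field_simps)
  moreover have "int r * v c \<le> int r * (- 1)" using c by (intro mult_left_mono) auto
  ultimately have "vge v m (c ^ r / (1 + c ^ r) - 1)"
    using 1 r by (auto simp: vge_def place_uminus[OF v] place_inverse[OF v])
  moreover have "vge w m (c ^ r / (1 + c ^ r))" if "w \<in> F" for w
  proof -
    have w: "is_place w" using F that by auto
    have "w (1 + c ^ r) = 0"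
      using place_one_plus_pos[OF w, of "c ^ r"] place_power[OF w c(1), of r] c(3)[OF that] r
      by (auto simp: zero_less_mult_iff)
    moreover have "int r * w c \<ge> int r * 1" using c(3)[OF that] by (intro mult_left_mono) auto
    with r have "m \<le> int r * w c" by linarith
    ultimately show ?thesis
      using 1 c(1) by (auto simp: vge_def place_divide[OF w] place_power[OF w])
  qed
  ultimately show ?thesis by blast
qed

lemma weak_approximation:
  assumes fin: "finite F" and F: "\<And>v. v \<in> F \<Longrightarrow> is_place v"
  shows "\<exists>x. \<forall>v\<in>F. vge v (m v) (x - a v)"
proof -
  \<comment> \<open>One precision for all idempotents: it is at least every
    \<open>m v - v (a w)\<close>, so an error of value \<open>b\<close> multiplied by any
    \<open>a w\<close> still has value at least \<open>m v\<close>.\<close>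
  define b where "b = (\<Sum>v\<in>F. \<Sum>w\<in>F. \<bar>m v\<bar> + \<bar>v (a w)\<bar>)"
  have b: "m v - v (a w) \<le> b" if "v \<in> F" "w \<in> F" for v w
  proof -
    have "\<bar>m v\<bar> + \<bar>v (a w)\<bar> \<le> (\<Sum>w\<in>F. \<bar>m v\<bar> + \<bar>v (a w)\<bar>)"
      using that fin by (intro member_le_sum[where f = "\<lambda>w. \<bar>m v\<bar> + \<bar>v (a w)\<bar>"]) auto
    moreover have "(\<Sum>w\<in>F. \<bar>m v\<bar> + \<bar>v (a w)\<bar>) \<le> b"
      unfolding b_def
      using that fin by (intro member_le_sum[where f = "\<lambda>v. \<Sum>w\<in>F. \<bar>m v\<bar> + \<bar>v (a w)\<bar>"] sum_nonneg) auto
    ultimately show ?thesis by linarith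
  qed
  have "\<exists>e. vge v b (e - 1) \<and> (\<forall>w\<in>F - {v}. vge w b e)" if "v \<in> F" for v
    by (rule approx_idempotent) (use fin F that in auto)
  then obtain e where e: "\<And>v. v \<in> F \<Longrightarrow> vge v b (e v - 1)"
    "\<And>v w. v \<in> F \<Longrightarrow> w \<in> F \<Longrightarrow> w \<noteq> v \<Longrightarrow> vge w b (e v)"
    by (metis DiffI singletonD)
  have "vge v (m v) ((\<Sum>w\<in>F. e w * a w) - a v)" if v: "v \<in> F" for v
  proof -
    have "(\<Sum>w\<in>F. e w * a w) - a v = (e v - 1) * a v + (\<Sum>w\<in>F - {v}. e w * a w)"
      using fin v by (simp add: sum.remove algebra_simps)
    moreover have "vge v (m v) (u * a w)" if "w \<in> F" "vge v b u" for u w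
    proof -
      have "vge v (v (a w)) (a w)" by (simp add: vge_def)
      from vge_mult[OF F[OF v] that(2) this] b[OF v that(1)] show ?thesis
        by (elim vge_mono) auto
    qed
    moreover have "vge v b (e w)" if "w \<in> F - {v}" for w
      using e(2)[of w v] v that by auto
    ultimately show ?thesis
      using e(1)[OF v] v by (auto intro!: vge_add[OF F[OF v]] vge_sum[OF F[OF v]])
  qed
  then show ?thesis by blast
qed

section \<open>Fractional ideals cut out by valuations\<close>

definition vball :: "('k::field \<Rightarrow> int) \<Rightarrow> int \<Rightarrow> 'k set" where
  "vball v m = {x. vge v m x}"

definition res_card :: "('k::field \<Rightarrow> int) \<Rightarrow> nat" where
  "res_card v = idx (vball v 0) (vball v 1)"

text \<open>Three choices of \<open>Q\<close> matter: all places give the Riemann-Roch space of the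
  divisor -E, all places but one a fractional ideal of the ring of regular functions, and a finite
  set a fractional ideal of a semilocal ring. A larger \<open>E\<close> gives a smaller set.\<close>

definition vset :: "('k::field \<Rightarrow> int) set \<Rightarrow> (('k \<Rightarrow> int) \<Rightarrow> int) \<Rightarrow> 'k set" where
  "vset Q E = {x. \<forall>v\<in>Q. vge v (E v) x}"

lemma add_subgroup_vball: "is_place v \<Longrightarrow> add_subgroup (vball v m)"
  by (auto simp: add_subgroup_def vball_def intro: vge_diff)

lemma add_subgroup_vset: "(\<And>v. v \<in> Q \<Longrightarrow> is_place v) \<Longrightarrow> add_subgroup (vset Q E)"
  by (auto simp: add_subgroup_def vset_def intro: vge_diff)

lemma vset_mono: "(\<And>v. v \<in> Q \<Longrightarrow> E v \<le> E' v) \<Longrightarrow> vset Q E' \<subseteq> vset Q E"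
  by (auto simp: vset_def intro: vge_mono)

lemma vset_cong: "(\<And>v. v \<in> Q \<Longrightarrow> E v = E' v) \<Longrightarrow> vset Q E = vset Q E'"
  by (auto simp: vset_def)

lemma vset_scale:
  assumes "\<And>v. v \<in> Q \<Longrightarrow> is_place v" "c \<noteq> 0"
  shows "(*) c ` vset Q E = vset Q (\<lambda>v. E v + v c)"
proof
  show "(*) c ` vset Q E \<subseteq> vset Q (\<lambda>v. E v + v c)"
    using assms by (auto simp: vset_def vge_scale)
  show "vset Q (\<lambda>v. E v + v c) \<subseteq> (*) c ` vset Q E"
  proof
    fix x assume "x \<in> vset Q (\<lambda>v. E v + v c)"
    then have "vge v (E v) (x / c)" if "v \<in> Q" for v
      using vge_scale[OF assms(1)[OF that] assms(2), of "E v" "x / c"] that assms(2)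
      by (auto simp: vset_def)
    then show "x \<in> (*) c ` vset Q E"
      using assms(2) by (intro image_eqI[of _ _ "x / c"]) (auto simp: vset_def)
  qed
qed

text \<open>Multiplication by an element of value \<open>m\<close> carries the pair of balls at
  exponent 0 to the pair at exponent \<open>m\<close>.\<close>

lemma vball_index:
  assumes v: "is_place v"
  shows "idx (vball v m) (vball v (m + 1)) = res_card v"
    and "finite (quot (vball v m) (vball v (m + 1))) \<longleftrightarrow> finite (quot (vball v 0) (vball v 1))"
proof -
  obtain c where c: "c \<noteq> 0" "v c = m" using place_value[OF v] by blast
  note scale = vge_scale[OF v c(1), unfolded c(2)]
  have "(finite (quot (vball v 0) (vball v 1)) \<longleftrightarrow> finite (quot (vball v m) (vball v (m + 1)))) \<and>
    idx (vball v 0) (vball v 1) = idx (vball v m) (vball v (m + 1))"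
  proof (rule quot_bij_transfer[OF add_subgroup_vball[OF v] add_subgroup_vball[OF v], where f = "(*) c"])
    show "c * x \<in> vball v m" if "x \<in> vball v 0" for x
      using that scale[of 0 x] by (simp add: vball_def)
    show "c * x - c * y \<in> vball v (m + 1) \<longleftrightarrow> x - y \<in> vball v 1" for x y
      using scale[of 1 "x - y"] by (simp add: vball_def algebra_simps)
    show "\<exists>x\<in>vball v 0. c * x - a \<in> vball v (m + 1)" if "a \<in> vball v m" for a
      by (rule bexI[of _ "a / c"]) (use that c scale[of 0 "a / c"] in \<open>auto simp: vball_def\<close>)
  qed
  then show "idx (vball v m) (vball v (m + 1)) = res_card v"
    "finite (quot (vball v m) (vball v (m + 1))) \<longleftrightarrow> finite (quot (vball v 0) (vball v 1))"
    by (simp_all add: res_card_def)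
qed

text \<open>The number \<open>res_card v\<close> is meaningful only if the residue field is finite.\<close>

definition fin_place :: "('k::field \<Rightarrow> int) \<Rightarrow> bool" where
  "fin_place v \<longleftrightarrow> is_place v \<and> finite (quot (vball v 0) (vball v 1))"

lemma res_card_ge_2:
  assumes "fin_place v" shows "res_card v \<ge> 2"
proof -
  have v: "is_place v" using assms by (simp add: fin_place_def)
  have "card {0, 1 :: 'a} \<le> res_card v"
    unfolding res_card_def
    by (rule card_le_idx[OF add_subgroup_vball[OF v]])
      (use assms place_one[OF v] place_uminus[OF v, of 1] in \<open>auto simp: fin_place_def vball_def vge_def\<close>)
  then show ?thesis by simp
qed

text \<open>By the second isomorphism theorem A / B is C / V' for C = A + V', which lies between the
  ball V and the smaller ball V'. So the index divides that of V / V', and equality means C = V,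
  that is, every residue at \<open>v\<close> comes from \<open>A\<close>. Strong approximation later
  exploits the divisibility.\<close>

lemma vset_step:
  fixes E :: "('k::field \<Rightarrow> int) \<Rightarrow> int"
  assumes Q: "\<And>w. w \<in> Q \<Longrightarrow> is_place w" and v: "fin_place v" "v \<in> Q"
  defines "A \<equiv> vset Q E" and "B \<equiv> vset Q (E(v := E v + 1))"
  shows "finite (quot A B)" "idx A B dvd res_card v"
    and "(\<forall>a. vge v (E v) a \<longrightarrow> (\<exists>x\<in>A. vge v (E v + 1) (x - a))) \<longleftrightarrow> idx A B = res_card v"
proof -
  have pv: "is_place v" using v by (simp add: fin_place_def)
  define V where "V = vball v (E v)"
  define V' where "V' = vball v (E v + 1)"
  define C where "C = {x + y |x y. x \<in> A \<and> y \<in> V'}"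
  have sA: "add_subgroup A" and sB: "add_subgroup B"
    unfolding A_def B_def by (auto intro!: add_subgroup_vset Q)
  have sV: "add_subgroup V" and sV': "add_subgroup V'"
    unfolding V_def V'_def by (auto intro!: add_subgroup_vball pv)
  have sC: "add_subgroup C"
    unfolding add_subgroup_def
  proof (intro conjI ballI)
    show "0 \<in> C"
      unfolding C_def using add_subgroup_zero[OF sA] add_subgroup_zero[OF sV'] by force
    fix c d assume "c \<in> C" "d \<in> C"
    then obtain x y x' y' where "c = x + y" "d = x' + y'" "x \<in> A" "x' \<in> A" "y \<in> V'" "y' \<in> V'"
      unfolding C_def by blast
    then have "c - d = (x - x') + (y - y')" "x - x' \<in> A" "y - y' \<in> V'"
      using add_subgroup_diff[OF sA] add_subgroup_diff[OF sV'] by auto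
    then show "c - d \<in> C" unfolding C_def by blast
  qed
  have "V' \<subseteq> V" by (auto simp: V_def V'_def vball_def intro: vge_mono)
  have AV: "A \<subseteq> V" using v(2) by (auto simp: A_def V_def vset_def vball_def)
  have CV: "C \<subseteq> V"
    using AV \<open>V' \<subseteq> V\<close> by (auto simp: C_def intro!: add_subgroup_add[OF sV])
  have "y \<in> C" if "y \<in> V'" for y
    unfolding C_def using that add_subgroup_zero[OF sA] by force
  then have VC: "V' \<subseteq> C" by auto
  have BA: "x \<in> B \<longleftrightarrow> x \<in> V'" if "x \<in> A" for x
    using that v(2) unfolding A_def B_def V'_def vset_def vball_def by auto
  have finV: "finite (quot V V')" "idx V V' = res_card v"
    using v(1) vball_index[OF pv] by (auto simp: V_def V'_def fin_place_def)
  have tower: "idx V V' = idx V C * idx C V'" "finite (quot C V')" "finite (quot V C)"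
    using quot_tower[OF sV sC sV' VC CV] finV by auto
  have AC: "(finite (quot A B) \<longleftrightarrow> finite (quot C V')) \<and> idx A B = idx C V'"
  proof (rule quot_bij_transfer[OF sB sV', where f = "\<lambda>x. x"])
    show "x \<in> C" if "x \<in> A" for x
      unfolding C_def using that add_subgroup_zero[OF sV'] by force
    show "x - y \<in> V' \<longleftrightarrow> x - y \<in> B" if "x \<in> A" "y \<in> A" for x y
      using BA[OF add_subgroup_diff[OF sA that]] by simp
    show "\<exists>x\<in>A. x - a \<in> V'" if "a \<in> C" for a
    proof -
      from that obtain x y where "x \<in> A" "y \<in> V'" "a = x + y" unfolding C_def by blast
      then show ?thesis using add_subgroup_uminus[OF sV', of y] by (intro bexI[of _ x]) auto
    qed
  qed
  then show "finite (quot A B)" "idx A B dvd res_card v" using tower finV by auto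
  have full: "V \<subseteq> C \<longleftrightarrow> idx A B = res_card v"
  proof
    assume "V \<subseteq> C"
    with CV have "V = C" by auto
    then show "idx A B = res_card v" using AC finV by simp
  next
    assume "idx A B = res_card v"
    then have "idx V C * idx C V' = 1 * idx C V'" using AC tower(1) finV(2) by presburger
    moreover have "idx C V' \<noteq> 0" using idx_pos[OF tower(2) sC] by simp
    ultimately have "idx V C = 1" by (metis mult_cancel2)
    then show "V \<subseteq> C" by (rule idx_1_imp_subset[OF sV sC])
  qed
  have "V \<subseteq> C \<longleftrightarrow> (\<forall>a\<in>V. \<exists>x\<in>A. x - a \<in> V')"
  proof -
    have "a \<in> C \<longleftrightarrow> (\<exists>x\<in>A. x - a \<in> V')" for a
    proof
      assume "a \<in> C"
      then obtain x y where "x \<in> A" "y \<in> V'" "a = x + y" unfolding C_def by blast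
      then show "\<exists>x\<in>A. x - a \<in> V'"
        using add_subgroup_uminus[OF sV', of y] by (intro bexI[of _ x]) auto
    next
      assume "\<exists>x\<in>A. x - a \<in> V'"
      then obtain x where "x \<in> A" "x - a \<in> V'" by auto
      then have "x \<in> A" "a - x \<in> V'" "a = x + (a - x)"
        using add_subgroup_commute[OF sV'] by auto
      then show "a \<in> C" unfolding C_def by blast
    qed
    then show ?thesis by blast
  qed
  with full show "(\<forall>a. vge v (E v) a \<longrightarrow> (\<exists>x\<in>A. vge v (E v + 1) (x - a))) \<longleftrightarrow> idx A B = res_card v"
    by (auto simp: V_def V'_def vball_def)
qed

text \<open>Exponents are raised by one at one place at a time, and each step has full index
  \<open>res_card v\<close> once all residues are attained. The assumption \<open>approx\<close>
  leaves the source of this open: weak approximation for finite \<open>Q\<close>, strong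
  approximation for the ring away from \<open>pinf\<close>.\<close>

lemma vset_index:
  assumes Q: "\<And>w. w \<in> Q \<Longrightarrow> is_place w" and G: "finite G" "G \<subseteq> Q" "\<And>v. v \<in> G \<Longrightarrow> fin_place v"
    and n: "\<And>v. v \<notin> G \<Longrightarrow> n v = 0"
    and approx: "\<And>m v a. v \<in> G \<Longrightarrow> (\<And>w. w \<notin> G \<Longrightarrow> m w = 0) \<Longrightarrow> vge v (E v + int (m v)) a \<Longrightarrow>
       \<exists>x\<in>vset Q (\<lambda>w. E w + int (m w)). vge v (E v + int (m v) + 1) (x - a)"
  shows "finite (quot (vset Q E) (vset Q (\<lambda>v. E v + int (n v)))) \<and>
    idx (vset Q E) (vset Q (\<lambda>v. E v + int (n v))) = (\<Prod>v\<in>G. res_card v ^ n v)"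
  using n
proof (induction "\<Sum>v\<in>G. n v" arbitrary: n)
  case 0
  then have "n v = 0" for v using G(1) by (cases "v \<in> G") auto
  moreover have "quot A A = {A}" if "add_subgroup A" for A :: "'a set"
  proof -
    have "(+) a ` A = A" if "a \<in> A" for a
      using coset_eq_iff[OF \<open>add_subgroup A\<close>, of a 0] that by simp
    then show ?thesis using add_subgroup_zero[OF that] by (auto simp: quot_def)
  qed
  ultimately show ?case using add_subgroup_vset[of Q E] Q by simp
next
  case (Suc N)
  then obtain v where v: "v \<in> G" "n v > 0"
    by (metis gr0I nat.distinct(1) sum.neutral)
  define m where "m = n(v := n v - 1)"
  have m: "m w = 0" if "w \<notin> G" for w using Suc.prems that v by (auto simp: m_def)
  have "(\<Sum>v\<in>G. n v) = n v + (\<Sum>w\<in>G - {v}. n w)" "(\<Sum>v\<in>G. m v) = m v + (\<Sum>w\<in>G - {v}. m w)"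
    using v G(1) by (auto intro: sum.remove)
  then have "N = (\<Sum>v\<in>G. m v)" using Suc(2) v by (simp add: m_def)
  from Suc.hyps(1)[OF this m] have IH: "finite (quot (vset Q E) (vset Q (\<lambda>v. E v + int (m v))))"
    "idx (vset Q E) (vset Q (\<lambda>v. E v + int (m v))) = (\<Prod>v\<in>G. res_card v ^ m v)" by auto
  define E' where "E' = (\<lambda>w. E w + int (m w))"
  have E': "E'(v := E' v + 1) = (\<lambda>w. E w + int (n w))"
    using v by (auto simp: E'_def m_def)
  note step = vset_step[of Q v E', OF Q G(3)[OF v(1)], unfolded E']
  have "idx (vset Q E') (vset Q (\<lambda>w. E w + int (n w))) = res_card v"
    using approx[OF v(1) m] G(2) v(1) by (subst step(3)[symmetric]) (auto simp: E'_def)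
  moreover have "finite (quot (vset Q E') (vset Q (\<lambda>w. E w + int (n w))))"
    using step(1) G(2) v(1) by auto
  moreover have "vset Q (\<lambda>w. E w + int (n w)) \<subseteq> vset Q E'"
    by (intro vset_mono) (auto simp: E'_def m_def)
  moreover have "vset Q E' \<subseteq> vset Q E"
    by (intro vset_mono) (auto simp: E'_def)
  moreover have "(\<Prod>w\<in>G. res_card w ^ n w) = (\<Prod>v\<in>G. res_card v ^ m v) * res_card v"
  proof -
    have "(\<Prod>w\<in>G - {v}. res_card w ^ n w) = (\<Prod>w\<in>G - {v}. res_card w ^ m w)"
      by (intro prod.cong) (auto simp: m_def)
    moreover have "res_card v ^ n v = res_card v ^ m v * res_card v"
      using v by (simp add: m_def flip: power_Suc2)
    ultimately show ?thesis using v G(1) by (simp add: prod.remove mult_ac)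
  qed
  ultimately show ?case
    using quot_tower[of "vset Q E" "vset Q E'" "vset Q (\<lambda>w. E w + int (n w))"]
      add_subgroup_vset[of Q] Q IH by (auto simp: E'_def)
qed

text \<open>Here Q = G is finite, and an element close to \<open>a\<close> at \<open>v\<close> and
  close to 0 on the rest of \<open>G\<close> provides the residues.\<close>

lemma weak_approximation_index:
  assumes G: "finite G" "\<And>v. v \<in> G \<Longrightarrow> fin_place v" and n: "\<And>v. v \<notin> G \<Longrightarrow> n v = 0"
  shows "idx (vset G E) (vset G (\<lambda>v. E v + int (n v))) = (\<Prod>v\<in>G. res_card v ^ n v)"
proof -
  have "\<exists>x\<in>vset G (\<lambda>w. E w + int (m w)). vge v (E v + int (m v) + 1) (x - a)"
    if "v \<in> G" "vge v (E v + int (m v)) a" for m v a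
  proof -
    obtain x where x: "\<And>w. w \<in> G \<Longrightarrow> vge w (E w + int (m w) + 1) (x - (if w = v then a else 0))"
      using weak_approximation[OF G(1), of "\<lambda>w. E w + int (m w) + 1" "\<lambda>w. if w = v then a else 0"]
        G(2) by (auto simp: fin_place_def)
    have "vge w (E w + int (m w)) x" if "w \<in> G" for w
    proof (cases "w = v")
      case True
      have "is_place v" using G(2) \<open>v \<in> G\<close> by (auto simp: fin_place_def)
      then show ?thesis
        using vge_add[OF _ vge_mono[OF x[OF that]] \<open>vge v (E v + int (m v)) a\<close>[folded True]] True by simp
    next
      case False
      then show ?thesis using x[OF that] by (auto elim: vge_mono)
    qed
    then show ?thesis using x[OF \<open>v \<in> G\<close>] by (auto simp: vset_def)
  qed
  then show ?thesis
    using vset_index[of G G n E] G n by (auto simp: fin_place_def)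
qed

section \<open>Existence of places\<close>

definition is_subring :: "'k::field set \<Rightarrow> bool" where
  "is_subring R \<longleftrightarrow> add_subgroup R \<and> 1 \<in> R \<and> (\<forall>x\<in>R. \<forall>y\<in>R. x * y \<in> R)"

lemma subring_group: "is_subring R \<Longrightarrow> add_subgroup R"
  and subring_one: "is_subring R \<Longrightarrow> 1 \<in> R"
  and subring_mult: "is_subring R \<Longrightarrow> x \<in> R \<Longrightarrow> y \<in> R \<Longrightarrow> x * y \<in> R"
  by (auto simp: is_subring_def)

lemma subring_zero: "is_subring R \<Longrightarrow> 0 \<in> R"
  and subring_add: "is_subring R \<Longrightarrow> x \<in> R \<Longrightarrow> y \<in> R \<Longrightarrow> x + y \<in> R"
  and subring_diff: "is_subring R \<Longrightarrow> x \<in> R \<Longrightarrow> y \<in> R \<Longrightarrow> x - y \<in> R"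
  and subring_uminus: "is_subring R \<Longrightarrow> x \<in> R \<Longrightarrow> - x \<in> R"
  and subring_sum: "is_subring R \<Longrightarrow> (\<And>i. i \<in> I \<Longrightarrow> f i \<in> R) \<Longrightarrow> sum f I \<in> R"
  using subring_group
  by (auto intro: add_subgroup_zero add_subgroup_add add_subgroup_diff add_subgroup_uminus add_subgroup_sum)

lemma subring_power: "is_subring R \<Longrightarrow> x \<in> R \<Longrightarrow> x ^ n \<in> R"
  by (induction n) (auto intro: subring_one subring_mult)

lemma add_subgroup_multiples:
  assumes "add_subgroup A" shows "add_subgroup ((*) (z::'k::field) ` A)"
  unfolding add_subgroup_def
proof (intro conjI ballI)
  show "0 \<in> (*) z ` A" using add_subgroup_zero[OF assms] by force
  fix x y assume "x \<in> (*) z ` A" "y \<in> (*) z ` A"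
  then obtain a b where "x = z * a" "y = z * b" "a \<in> A" "b \<in> A" by auto
  then show "x - y \<in> (*) z ` A"
    using add_subgroup_diff[OF assms, of a b] by (auto simp: right_diff_distrib[symmetric])
qed

section \<open>Polynomials with coefficients in a subring\<close>

definition polys_over :: "'k::field set \<Rightarrow> 'k poly set" where
  "polys_over R = {f. \<forall>i. Polynomial.coeff f i \<in> R}"

lemma polys_over_diff: "is_subring R \<Longrightarrow> f \<in> polys_over R \<Longrightarrow> g \<in> polys_over R \<Longrightarrow> f - g \<in> polys_over R"
  and polys_over_add: "is_subring R \<Longrightarrow> f \<in> polys_over R \<Longrightarrow> g \<in> polys_over R \<Longrightarrow> f + g \<in> polys_over R"
  and polys_over_mult: "is_subring R \<Longrightarrow> f \<in> polys_over R \<Longrightarrow> g \<in> polys_over R \<Longrightarrow> f * g \<in> polys_over R"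
  and polys_over_smult: "is_subring R \<Longrightarrow> c \<in> R \<Longrightarrow> f \<in> polys_over R \<Longrightarrow> Polynomial.smult c f \<in> polys_over R"
  and polys_over_monom: "is_subring R \<Longrightarrow> c \<in> R \<Longrightarrow> Polynomial.monom c n \<in> polys_over R"
  and polys_over_pCons: "is_subring R \<Longrightarrow> c \<in> R \<Longrightarrow> f \<in> polys_over R \<Longrightarrow> pCons c f \<in> polys_over R"
  by (auto simp: polys_over_def Polynomial.coeff_mult coeff_pCons subring_zero
      intro: subring_diff subring_add subring_mult subring_sum split: nat.splits)

lemma polys_over_zero: "is_subring R \<Longrightarrow> 0 \<in> polys_over R"
  and polys_over_one: "is_subring R \<Longrightarrow> 1 \<in> polys_over R"
  by (auto simp: polys_over_def subring_zero coeff_1 subring_one)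

lemma polys_over_sum: "is_subring R \<Longrightarrow> (\<And>i. i \<in> I \<Longrightarrow> f i \<in> polys_over R) \<Longrightarrow> sum f I \<in> polys_over R"
  by (induction I rule: infinite_finite_induct) (auto intro: polys_over_add polys_over_zero)

lemma is_subring_adjoin:
  assumes "is_subring R" shows "is_subring ((\<lambda>f. poly f z) ` polys_over R)"
proof -
  have "poly f z - poly g z \<in> (\<lambda>f. poly f z) ` polys_over R" "poly f z * poly g z \<in> (\<lambda>f. poly f z) ` polys_over R"
    if "f \<in> polys_over R" "g \<in> polys_over R" for f g
    using polys_over_diff[OF assms that] polys_over_mult[OF assms that]
    by (auto simp flip: poly_diff poly_mult)
  moreover have "0 \<in> (\<lambda>f. poly f z) ` polys_over R" "1 \<in> (\<lambda>f. poly f z) ` polys_over R"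
    using polys_over_zero[OF assms] polys_over_one[OF assms] by (force intro: image_eqI[of _ _ 0] image_eqI[of _ _ 1])+
  ultimately show ?thesis by (auto simp: is_subring_def add_subgroup_def)
qed

text \<open>Maximality acts in two ways: a larger ring in which \<open>x\<close> stays a non-unit
  does not exist, which puts the inverses of all 1 - x a into \<open>R\<close>; and adjoining any
  \<open>z\<close> outside \<open>R\<close> makes \<open>x\<close> invertible, which gives an
  equation for \<open>z\<close>.\<close>

locale maximal_subring =
  fixes R :: "'k::field set" and x :: 'k
  assumes R: "is_subring R" and x: "x \<in> R" "x \<noteq> 0" "inverse x \<notin> R"
    and maximal: "\<And>R'. is_subring R' \<Longrightarrow> R \<subseteq> R' \<Longrightarrow> inverse x \<notin> R' \<Longrightarrow> R' \<subseteq> R"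
begin

text \<open>Powers of u = 1 - x a are congruent to 1 modulo \<open>x\<close>, so 1/x = r / u^i would
  give x (r - b) = 1 with r - b in \<open>R\<close>. Thus localising at \<open>u\<close> does not
  make \<open>x\<close> invertible, and by maximality it adds nothing: \<open>x\<close> lies in the
  Jacobson radical.\<close>

lemma unit_one_minus:
  assumes a: "a \<in> R"
  shows "1 - x * a \<noteq> 0" "inverse (1 - x * a) \<in> R"
proof -
  define u where "u = 1 - x * a"
  have no: "x * b \<noteq> 1" if "b \<in> R" for b
    using that x inverse_unique[of x b] by auto
  then show u0: "1 - x * a \<noteq> 0" using a by auto
  have uR: "u \<in> R" unfolding u_def using a x R by (intro subring_diff subring_mult subring_one)
  define R' where "R' = {r / u ^ i |r i. r \<in> R}"
  have pow: "\<exists>b\<in>R. u ^ i = 1 + x * b" for i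
  proof (induction i)
    case 0
    then show ?case using subring_zero[OF R] by force
  next
    case (Suc i)
    then obtain b where b: "b \<in> R" "u ^ i = 1 + x * b" by auto
    have "u ^ Suc i = 1 + x * (b - a - x * a * b)"
      unfolding power_Suc b(2) by (simp add: u_def algebra_simps)
    moreover have "b - a - x * a * b \<in> R"
      using a b x R by (intro subring_diff subring_mult)
    ultimately show ?case by blast
  qed
  have "is_subring R'"
    unfolding is_subring_def add_subgroup_def
  proof (intro conjI ballI)
    show "0 \<in> R'" "1 \<in> R'"
      unfolding R'_def using subring_zero[OF R] subring_one[OF R] by (force intro: exI[of _ 0])+
    fix y z assume "y \<in> R'" "z \<in> R'"
    then obtain r i s j where *: "y = r / u ^ i" "z = s / u ^ j" "r \<in> R" "s \<in> R" unfolding R'_def by blast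
    have "y - z = (r * u ^ j - s * u ^ i) / u ^ (i + j)"
      using u0 unfolding *(1,2) u_def[symmetric] by (simp add: diff_frac_eq power_add)
    moreover have "r * u ^ j - s * u ^ i \<in> R"
      using * uR R by (intro subring_diff subring_mult subring_power)
    ultimately show "y - z \<in> R'" unfolding R'_def by blast
    have "y * z = (r * s) / u ^ (i + j)" using * by (simp add: power_add)
    moreover have "r * s \<in> R" using * R by (intro subring_mult)
    ultimately show "y * z \<in> R'" unfolding R'_def by blast
  qed
  moreover have "R \<subseteq> R'" unfolding R'_def by (force intro: exI[of _ 0])
  moreover have "inverse x \<notin> R'"
  proof
    assume "inverse x \<in> R'"
    then obtain r i where ri: "inverse x = r / u ^ i" "r \<in> R" unfolding R'_def by blast
    obtain b where b: "b \<in> R" "u ^ i = 1 + x * b" using pow by blast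
    have "u ^ i = x * r" using ri x u0 by (simp add: u_def field_simps)
    then have "x * (r - b) = 1" using b by (simp add: algebra_simps)
    then show False using no[of "r - b"] ri b R by (auto intro: subring_diff)
  qed
  ultimately have "R' \<subseteq> R" by (rule maximal)
  moreover have "inverse u \<in> R'" unfolding R'_def using subring_one[OF R]
    by (auto intro!: exI[of _ 1] simp: divide_inverse)
  ultimately show "inverse (1 - x * a) \<in> R" by (auto simp: u_def)
qed

lemma adjoin_unit:
  assumes "z \<notin> R" shows "\<exists>f\<in>polys_over R. x * poly f z = 1"
proof -
  define R' where "R' = (\<lambda>f. poly f z) ` polys_over R"
  have "is_subring R'" unfolding R'_def by (rule is_subring_adjoin[OF R])
  moreover have "R \<subseteq> R'"
  proof
    fix a assume "a \<in> R"
    then have "[:a:] \<in> polys_over R"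
      by (intro polys_over_pCons polys_over_zero R)
    then show "a \<in> R'" unfolding R'_def by (force intro: image_eqI[of _ _ "[:a:]"])
  qed
  moreover have "z \<in> R'"
  proof -
    have "[:0, 1:] \<in> polys_over R"
      by (intro polys_over_pCons polys_over_zero subring_zero subring_one R)
    then show ?thesis unfolding R'_def by (force intro: image_eqI[of _ _ "[:0, 1:]"])
  qed
  ultimately have "inverse x \<in> R'" using maximal[of R'] assms by auto
  then obtain f where "f \<in> polys_over R" "inverse x = poly f z" unfolding R'_def by auto
  then show ?thesis using x by (intro bexI[of _ f]) (auto simp flip: \<open>inverse x = poly f z\<close>)
qed

text \<open>Multiply the equation for w = 1/z by z^s and collect z^s: its factor is 1 - x g_0, with
  g_0 the constant coefficient of \<open>g\<close>, a unit of \<open>R\<close>. So z^s is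
  \<open>x\<close> times a polynomial in \<open>z\<close> of degree below \<open>s\<close>, and
  inserting this into the leading term of \<open>f\<close> lowers the degree.\<close>

lemma reduce_degree:
  assumes f: "f \<in> polys_over R" "x * poly f z = 1"
    and g: "g \<in> polys_over R" "x * poly g w = 1"
    and zw: "z * w = 1" and deg: "Polynomial.degree g \<le> Polynomial.degree f"
  shows "\<exists>f'\<in>polys_over R. x * poly f' z = 1 \<and> Polynomial.degree f' < Polynomial.degree f"
proof -
  define r s where "r = Polynomial.degree f" and "s = Polynomial.degree g"
  \<comment> \<open>A constant \<open>g\<close> would make \<open>x\<close> invertible in
    \<open>R\<close>.\<close>
  have s: "s > 0"
  proof (rule ccontr)
    assume "\<not> s > 0"
    then obtain c where c: "g = [:c:]" using degree_eq_zeroE[of g] by (auto simp: s_def)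
    then have "c \<in> R" using g(1) by (auto simp: polys_over_def coeff_pCons dest: spec[of _ 0])
    moreover have "x * c = 1" using g(2) c by simp
    ultimately show False using x inverse_unique[of x c] by auto
  qed
  define u where "u = 1 - x * Polynomial.coeff g 0"
  have u: "u \<noteq> 0" "inverse u \<in> R"
    using unit_one_minus[of "Polynomial.coeff g 0"] g by (auto simp: u_def polys_over_def)
  define h where "h = (\<Sum>j\<in>{1..s}. Polynomial.monom (inverse u * Polynomial.coeff g j) (s - j))"
  have h: "h \<in> polys_over R" unfolding h_def
    using g u R by (intro polys_over_sum polys_over_monom subring_mult) (auto simp: polys_over_def)
  have deg_h: "Polynomial.degree h \<le> s - 1" unfolding h_def
    by (intro degree_sum_le) (auto intro: order_trans[OF degree_monom_le])
  have zs: "z ^ s = x * poly h z"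
  proof -
    have "z ^ s = z ^ s * (x * poly g w)" using g by simp
    also have "\<dots> = x * (\<Sum>j\<le>s. Polynomial.coeff g j * (z ^ s * w ^ j))"
      by (simp add: poly_altdef s_def sum_distrib_left mult_ac)
    also have "(\<Sum>j\<le>s. Polynomial.coeff g j * (z ^ s * w ^ j)) = (\<Sum>j\<le>s. Polynomial.coeff g j * z ^ (s - j))"
    proof (rule sum.cong)
      fix j assume "j \<in> {..s}"
      then have "z ^ s * w ^ j = z ^ (s - j) * (z * w) ^ j"
        by (simp add: power_mult_distrib mult.assoc[symmetric] flip: power_add)
      then show "Polynomial.coeff g j * (z ^ s * w ^ j) = Polynomial.coeff g j * z ^ (s - j)"
        using zw by simp
    qed simp
    also have "{..s} = insert 0 {1..s}" by auto
    also have "(\<Sum>j\<in>insert 0 {1..s}. Polynomial.coeff g j * z ^ (s - j)) =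
      Polynomial.coeff g 0 * z ^ s + (\<Sum>j\<in>{1..s}. Polynomial.coeff g j * z ^ (s - j))" by simp
    finally have "u * z ^ s = x * (\<Sum>j\<in>{1..s}. Polynomial.coeff g j * z ^ (s - j))"
      by (simp add: u_def algebra_simps)
    moreover have "u * poly h z = (\<Sum>j\<in>{1..s}. Polynomial.coeff g j * z ^ (s - j))"
      unfolding h_def poly_sum poly_monom sum_distrib_left using u
      by (intro sum.cong) (auto simp: mult.assoc[symmetric])
    ultimately have "u * z ^ s = u * (x * poly h z)" by (simp add: mult_ac)
    then show ?thesis using u by simp
  qed
  define c where "c = Polynomial.coeff f r"
  have c: "c \<in> R" using f by (auto simp: c_def polys_over_def)
  \<comment> \<open>The leading term c z^r is replaced by c z^(r - s) times x h(z), which equals it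
    at \<open>z\<close>.\<close>
  define f' where "f' = (f - Polynomial.monom c r) + Polynomial.smult (x * c) (Polynomial.monom 1 (r - s) * h)"
  have "f' \<in> polys_over R" unfolding f'_def
    using f c x R h by (intro polys_over_add polys_over_diff polys_over_smult polys_over_mult polys_over_monom subring_mult subring_one)
  moreover have "z ^ r = z ^ (r - s) * (x * poly h z)"
    using deg by (simp add: zs[symmetric] r_def s_def flip: power_add)
  then have "poly f' z = poly f z"
    by (simp add: f'_def poly_monom algebra_simps)
  then have "x * poly f' z = 1" using f by simp
  moreover have "Polynomial.degree f' < r"
  proof -
    have r: "r > 0" using s deg by (simp add: r_def s_def)
    have "Polynomial.degree (f - Polynomial.monom c r) < r"
    proof (rule degree_lessI)
      show "f - Polynomial.monom c r \<noteq> 0 \<or> 0 < r" using r by simp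
      show "\<forall>i\<ge>r. Polynomial.coeff (f - Polynomial.monom c r) i = 0"
        by (auto simp: c_def r_def coeff_eq_0)
    qed
    moreover have "Polynomial.degree (Polynomial.smult (x * c) (Polynomial.monom 1 (r - s) * h)) \<le> (r - s) + (s - 1)"
      using deg_h degree_monom_le[of "1::'k" "r - s"]
      by (intro order_trans[OF degree_smult_le] order_trans[OF degree_mult_le]) simp
    moreover have "(r - s) + (s - 1) < r" using s deg by (simp add: r_def s_def)
    ultimately show ?thesis unfolding f'_def by (intro degree_add_less) auto
  qed
  ultimately show ?thesis unfolding r_def by blast
qed

text \<open>If neither \<open>z\<close> nor its inverse were in \<open>R\<close>, both would satisfy
  equations as in \<open>adjoin_unit\<close>. Take both of minimal degree: the one whose degree is
  not the smaller can be shortened with the help of the other.\<close>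

lemma valuation_ring: "z \<in> R \<or> inverse z \<in> R"
proof (rule ccontr)
  assume *: "\<not> ?thesis"
  then have z: "z \<noteq> 0" using subring_zero[OF R] by auto
  define F where "F y = {f \<in> polys_over R. x * poly f y = 1}" for y
  have ne: "\<exists>f. f \<in> F z" "\<exists>f. f \<in> F (inverse z)" using * adjoin_unit by (auto simp: F_def)
  obtain f where f: "f \<in> F z" "\<And>f'. f' \<in> F z \<Longrightarrow> Polynomial.degree f \<le> Polynomial.degree f'"
    using ne(1) ex_has_least_nat[of "\<lambda>f. f \<in> F z" _ Polynomial.degree] by blast
  obtain g where g: "g \<in> F (inverse z)" "\<And>g'. g' \<in> F (inverse z) \<Longrightarrow> Polynomial.degree g \<le> Polynomial.degree g'"
    using ne(2) ex_has_least_nat[of "\<lambda>f. f \<in> F (inverse z)" _ Polynomial.degree] by blast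
  show False
  proof (cases "Polynomial.degree g \<le> Polynomial.degree f")
    case True
    then obtain f' where "f' \<in> F z" "Polynomial.degree f' < Polynomial.degree f"
      using reduce_degree[of f z g "inverse z"] f(1) g(1) z by (auto simp: F_def)
    then show False using f(2)[of f'] by simp
  next
    case False
    then obtain g' where "g' \<in> F (inverse z)" "Polynomial.degree g' < Polynomial.degree g"
      using reduce_degree[of g "inverse z" f z] f(1) g(1) z by (auto simp: F_def)
    then show False using g(2)[of g'] by simp
  qed
qed

end

text \<open>Finite indices replace a Noetherian hypothesis. The index of z R strictly grows when
  \<open>z\<close> is multiplied by a nonzero non-unit, so a non-unit \<open>p\<close> of least
  index divides every non-unit, and repeated division by \<open>p\<close> must stop.\<close>

lemma discrete_valuation_ring:
  fixes R :: "'k::field set"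
  assumes R: "is_subring R" and val: "\<And>z. z \<in> R \<or> inverse z \<in> R"
    and x: "x \<in> R" "x \<noteq> 0" "inverse x \<notin> R"
    and fin: "\<And>z. z \<in> R \<Longrightarrow> z \<noteq> 0 \<Longrightarrow> finite (quot R ((*) z ` R))"
  shows "\<exists>v. is_place v \<and> v x > 0"
proof -
  note sR = subring_group[OF R] add_subgroup_multiples[OF subring_group[OF R]]
  define m where "m = {z \<in> R. z \<noteq> 0 \<and> inverse z \<notin> R}"
  define i where "i z = idx R ((*) z ` R)" for z
  have sub: "(*) (a * b) ` R \<subseteq> (*) a ` R" if "b \<in> R" for a b
  proof
    fix y assume "y \<in> (*) (a * b) ` R"
    then obtain r where "r \<in> R" "y = a * (b * r)" by (auto simp: mult.assoc)
    then show "y \<in> (*) a ` R" using subring_mult[OF R that] by blast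
  qed
  have sub': "(*) a ` R \<subseteq> R" if "a \<in> R" for a using subring_mult[OF R that] by auto
  have i_mult: "i (a * b) = i a * idx ((*) a ` R) ((*) (a * b) ` R)" if "a \<in> R" "b \<in> R" for a b
    unfolding i_def by (rule quot_tower(1)[OF sR(1) sR(2) sR(2) sub[OF that(2)] sub'[OF that(1)]])
  have i_pos: "i a > 0" if "a \<in> R" "a \<noteq> 0" for a
    unfolding i_def by (rule idx_pos[OF fin[OF that] sR(1)])
  have i_less: "i a < i (a * b)" if "a \<in> R" "b \<in> m" "a \<noteq> 0" for a b
  proof -
    have b: "b \<in> R" "b \<noteq> 0" "inverse b \<notin> R" using that by (auto simp: m_def)
    let ?j = "idx ((*) a ` R) ((*) (a * b) ` R)"
    have "?j \<noteq> 1"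
    proof
      assume "?j = 1"
      then have "(*) a ` R \<subseteq> (*) (a * b) ` R" by (rule idx_1_imp_subset[OF sR(2) sR(2)])
      then have "a * 1 \<in> (*) (a * b) ` R" using subring_one[OF R] by blast
      then obtain r where "r \<in> R" "a = a * (b * r)" by (auto simp: mult.assoc)
      then have "b * r = 1" using that by simp
      then show False using b \<open>r \<in> R\<close> inverse_unique[of b r] by auto
    qed
    moreover have "?j \<noteq> 0"
      using i_mult[OF that(1) b(1)] i_pos[of "a * b"] that b subring_mult[OF R] by (metis mult_0_right less_numeral_extra(3) no_zero_divisors)
    ultimately show ?thesis using i_mult[OF that(1) b(1)] i_pos[OF that(1,3)] by simp
  qed
  have "x \<in> m" using x by (simp add: m_def)
  then obtain p where p: "p \<in> m" "\<And>z. z \<in> m \<Longrightarrow> i p \<le> i z"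
    using ex_has_least_nat[of "\<lambda>z. z \<in> m" x i] by blast
  then have pR: "p \<in> R" "p \<noteq> 0" "inverse p \<notin> R" by (auto simp: m_def)
  \<comment> \<open>Otherwise p / z is a non-unit of \<open>R\<close> by \<open>val\<close>, and
    \<open>z\<close> would be a non-unit of smaller index than \<open>p\<close>.\<close>
  have p_dvd: "z / p \<in> R" if "z \<in> m" for z
  proof (rule ccontr)
    assume no: "z / p \<notin> R"
    have z: "z \<in> R" "z \<noteq> 0" using that by (auto simp: m_def)
    have "p / z \<in> R" using val[of "z / p"] no by simp
    then have "p / z \<in> m" using no z pR by (simp add: m_def)
    then have "i z < i (z * (p / z))" using i_less z by blast
    then show False using p(2)[OF that] z by simp
  qed
  define U where "U u \<longleftrightarrow> u \<in> R \<and> u \<noteq> 0 \<and> inverse u \<in> R" for u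
  have U_mult: "U (a * b)" if "U a" "U b" for a b
    using that subring_mult[OF R] by (auto simp: U_def)
  have U_inv: "U (inverse a)" if "U a" for a using that by (auto simp: U_def)
  have factor: "\<exists>n. U (z / p ^ n)" if "z \<in> R" "z \<noteq> 0" for z
    using that
  proof (induction "i z" arbitrary: z rule: less_induct)
    case less
    show ?case
    proof (cases "inverse z \<in> R")
      case True
      then show ?thesis using less by (intro exI[of _ 0]) (auto simp: U_def)
    next
      case False
      then have zp: "z / p \<in> R" "z / p \<noteq> 0" using p_dvd less pR by (auto simp: m_def)
      then have "i (z / p) < i (z / p * p)" using p(1) i_less by blast
      then have "\<exists>n. U (z / p / p ^ n)" using less(1)[of "z / p"] zp pR by simp
      then obtain n where "U (z / p / p ^ n)" by auto
      then show ?thesis by (intro exI[of _ "Suc n"]) (simp add: field_simps)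
    qed
  qed
  have ex: "\<exists>n. U (z / p powi n)" if z: "z \<noteq> 0" for z
  proof (cases "z \<in> R")
    case True
    then obtain n where "U (z / p ^ n)" using factor[OF True z] by blast
    then show ?thesis by (intro exI[of _ "int n"]) simp
  next
    case False
    then have "\<exists>n. U (inverse z / p ^ n)" using factor[of "inverse z"] val[of z] that by auto
    then obtain n where "U (inverse z / p ^ n)" by blast
    then have "U (inverse (inverse z / p ^ n))" by (rule U_inv)
    then show ?thesis by (intro exI[of _ "- int n"]) (simp add: power_int_minus field_simps)
  qed
  have p_pow: "p powi n \<in> R \<longleftrightarrow> n \<ge> 0" for n
  proof
    show "p powi n \<in> R" if "n \<ge> 0" using that pR subring_power[OF R] by (simp add: power_int_def)
    show "n \<ge> 0" if n: "p powi n \<in> R"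
    proof (rule ccontr)
      assume "\<not> n \<ge> 0"
      then have "p powi n * p ^ nat (- n - 1) = inverse p"
        using pR by (simp add: power_int_def power_diff nat_diff_distrib field_simps)
      then show False using n pR subring_mult[OF R n subring_power[OF R pR(1)]] by metis
    qed
  qed
  \<comment> \<open>The exponent is unique because, by \<open>p_pow\<close>, a power of
    \<open>p\<close> and its inverse both lie in \<open>R\<close> only for exponent 0.\<close>
  define v where "v z = (if z = 0 then 0 else THE n. U (z / p powi n))" for z
  have v_eqI: "v z = n" if "U (z / p powi n)" for z n
  proof -
    have z: "z \<noteq> 0" using that by (auto simp: U_def)
    have "k = n" if "U (z / p powi k)" for k
    proof -
      have "U (z / p powi k * inverse (z / p powi n))" "U (z / p powi n * inverse (z / p powi k))"
        using that \<open>U (z / p powi n)\<close> U_mult U_inv by blast+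
      then have "U (p powi (n - k))" "U (p powi (k - n))"
        using z pR by (simp_all add: power_int_diff field_simps)
      then have "n - k \<ge> 0" "k - n \<ge> 0" using p_pow by (auto simp: U_def)
      then show ?thesis by simp
    qed
    then have "(THE n. U (z / p powi n)) = n" using that by (intro the_equality)
    then show ?thesis using z by (simp add: v_def)
  qed
  have vU: "U (z / p powi v z)" if z: "z \<noteq> 0" for z
  proof -
    obtain n where "U (z / p powi n)" using ex[OF z] by (elim exE)
    then show ?thesis using v_eqI[of z n] by simp
  qed
  have v_mult: "v (z * w) = v z + v w" if "z \<noteq> 0" "w \<noteq> 0" for z w
    using U_mult[OF vU[OF that(1)] vU[OF that(2)]] pR
    by (intro v_eqI) (simp add: power_int_add mult_ac)
  have v_nonneg: "z \<in> R \<longleftrightarrow> v z \<ge> 0" if "z \<noteq> 0" for z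
  proof
    assume "v z \<ge> 0"
    then have "z / p powi v z * p powi v z \<in> R"
      using vU[OF that] p_pow[of "v z"] subring_mult[OF R] unfolding U_def by blast
    then show "z \<in> R" using pR by simp
  next
    assume "z \<in> R"
    then have "z * inverse (z / p powi v z) \<in> R"
      using vU[OF that] subring_mult[OF R] unfolding U_def by blast
    then show "v z \<ge> 0" using that p_pow[of "v z"] by (simp add: field_simps)
  qed
  have "is_place v"
    unfolding is_place_def
  proof (intro conjI allI impI)
    show "v 0 = 0" by (simp add: v_def)
    have "v p = 1" using subring_one[OF R] pR by (intro v_eqI) (auto simp: U_def)
    then show "\<exists>z. z \<noteq> 0 \<and> v z = 1" using pR by blast
    fix z w assume zw: "z \<noteq> (0::'k)" "w \<noteq> (0::'k)"
    then show "v (z * w) = v z + v w" by (rule v_mult)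
    assume s: "z + w \<noteq> 0"
    have *: "v a \<le> v (a + b)" if "a \<noteq> 0" "b \<noteq> 0" "a + b \<noteq> 0" "v a \<le> v b" for a b
    proof -
      have "v b = v a + v (b / a)" using v_mult[of a "b / a"] that by simp
      then have "b / a \<in> R" using v_nonneg[of "b / a"] that by simp
      then have "1 + b / a \<in> R" using subring_one[OF R] by (intro subring_add[OF R])
      moreover have "1 + b / a \<noteq> 0" using that by (simp add: field_simps)
      ultimately have "v (1 + b / a) \<ge> 0" using v_nonneg by blast
      moreover have "a + b = a * (1 + b / a)" using that by (simp add: field_simps)
      ultimately show ?thesis using v_mult[OF that(1) \<open>1 + b / a \<noteq> 0\<close>] by simp
    qed
    show "min (v z) (v w) \<le> v (z + w)"
    proof (cases "v z \<le> v w")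
      case True
      then show ?thesis using *[OF zw s] by simp
    next
      case False
      have "w + z \<noteq> 0" using s by (subst add.commute)
      moreover have "v w \<le> v z" using False by linarith
      ultimately have "v w \<le> v (w + z)" by (rule *[OF zw(2,1)])
      then show ?thesis by (subst add.commute) (rule min.coboundedI2)
    qed
  qed
  moreover have "v x \<noteq> 0"
  proof
    assume "v x = 0"
    then have "U x" using vU[OF x(2)] by simp
    then show False using x(3) unfolding U_def by blast
  qed
  then have "v x > 0" using v_nonneg[OF x(2)] x(1) by linarith
  ultimately show ?thesis by (intro exI[of _ v] conjI)
qed

text \<open>Zorn's lemma for the subrings that contain \<open>x\<close> but not its inverse.
  \<open>R0\<close> shows that there is one; the maximal member need not contain it.\<close>

lemma exists_place:
  fixes R0 :: "'k::field set"
  assumes R0: "is_subring R0" "x \<in> R0" "x \<noteq> 0" "inverse x \<notin> R0"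
    and fin: "\<And>(R::'k set) z. is_subring R \<Longrightarrow> z \<in> R \<Longrightarrow> z \<noteq> 0 \<Longrightarrow> finite (quot R ((*) z ` R))"
  shows "\<exists>v. is_place v \<and> v x > 0"
proof -
  define A where "A = {R. is_subring R \<and> x \<in> R \<and> inverse x \<notin> R}"
  have "\<exists>M\<in>A. \<forall>N\<in>A. M \<subseteq> N \<longrightarrow> N = M"
  proof (rule subset_Zorn_nonempty)
    show "A \<noteq> {}" using R0 by (auto simp: A_def)
    fix C assume C: "C \<noteq> {}" "subset.chain A C"
    then have sub: "\<And>R. R \<in> C \<Longrightarrow> is_subring R \<and> x \<in> R \<and> inverse x \<notin> R"
      by (auto simp: subset.chain_def A_def)
    have common: "\<exists>R\<in>C. y \<in> R \<and> z \<in> R" if yz: "y \<in> \<Union>C" "z \<in> \<Union>C" for y z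
    proof -
      from yz obtain R S where RS: "R \<in> C" "y \<in> R" "S \<in> C" "z \<in> S" by blast
      then have "R \<subseteq> S \<or> S \<subseteq> R"
        using C(2) by (auto simp: subset_chain_def)
      then show ?thesis using RS by blast
    qed
    have "is_subring (\<Union>C)"
      unfolding is_subring_def add_subgroup_def
    proof (intro conjI ballI)
      obtain R where "R \<in> C" using C(1) by blast
      then show "0 \<in> \<Union>C" "1 \<in> \<Union>C" using sub[of R] subring_zero[of R] subring_one[of R] by blast+
      fix y z assume "y \<in> \<Union>C" "z \<in> \<Union>C"
      then obtain S where S: "S \<in> C" "y \<in> S" "z \<in> S" using common[of y z] by blast
      then have "y - z \<in> S" "y * z \<in> S" using sub[of S] by (auto intro: subring_diff subring_mult)
      with S show "y - z \<in> \<Union>C" "y * z \<in> \<Union>C" by blast+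
    qed
    moreover have "x \<in> \<Union>C" using sub C(1) by blast
    moreover have "inverse x \<notin> \<Union>C" using sub by blast
    ultimately show "\<Union>C \<in> A" by (simp add: A_def)
  qed
  then obtain M where M: "M \<in> A" and max: "\<forall>N\<in>A. M \<subseteq> N \<longrightarrow> N = M" by blast
  from M have M': "is_subring M" "x \<in> M" "inverse x \<notin> M" by (simp_all add: A_def)
  interpret maximal_subring M x
  proof
    show "N \<subseteq> M" if "is_subring N" "M \<subseteq> N" "inverse x \<notin> N" for N
    proof -
      have "N \<in> A" using that M'(2) by (auto simp: A_def)
      then show ?thesis using max that(2) by blast
    qed
  qed (use M' R0 in auto)
  show ?thesis
    by (rule discrete_valuation_ring[OF M'(1) valuation_ring M'(2) R0(3) M'(3) fin[OF M'(1)]])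
qed

section \<open>Counting in a finite extension of a rational function field\<close>

text \<open>Constants disappear under M-th roots: if a > b, the powers of a / b outgrow
  \<open>C\<close>.\<close>

lemma le_of_power_le:
  fixes a b C :: real
  assumes "\<And>M. a ^ M \<le> C * b ^ M" and "b > 0"
  shows "a \<le> b"
proof (rule ccontr)
  assume "\<not> a \<le> b"
  then have "a / b > 1" using assms(2) by simp
  then obtain M where "C < (a / b) ^ M" using real_arch_pow by blast
  then have "C * b ^ M < a ^ M"
    using assms(2) by (simp add: power_divide field_simps)
  with assms(1)[of M] show False by simp
qed

lemma nat_le_of_power_le:
  fixes a b C :: nat
  assumes "\<And>M. a ^ M \<le> C * b ^ M" and "b > 0"
  shows "a \<le> b"
proof -
  have "real a ^ M \<le> real C * real b ^ M" for M
    using assms(1)[of M] by (simp flip: of_nat_power of_nat_mult)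
  then show ?thesis using le_of_power_le[of "real a" "real C" "real b"] assms(2) by simp
qed

text \<open>A nonzero value would make the powers of \<open>x\<close> pairwise distinct. So nonzero
  constants are units at every place.\<close>

lemma finite_subring_place:
  assumes "is_subring R" "finite R" "x \<in> R" "x \<noteq> 0" and v: "is_place v"
  shows "v x = 0"
proof (rule ccontr)
  assume "v x \<noteq> 0"
  then have "inj (\<lambda>i::nat. x ^ i)"
    using place_power[OF v assms(4)] by (intro injI) (metis mult_cancel_right of_nat_eq_iff)
  moreover have "range (\<lambda>i::nat. x ^ i) \<subseteq> R" using assms by (auto intro: subring_power)
  ultimately show False using assms(2) finite_subset range_inj_infinite by blast
qed

text \<open>All is phrased over F[T], the ring of values at \<open>T\<close> of polynomials over
  \<open>F\<close>, with denominators cleared: its elements have a degree and can be counted. As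
  \<open>e\<close> is a basis over the fraction field of F[T], \<open>n\<close> is the degree of the
  extension.\<close>

locale function_field =
  fixes F :: "'k::field set" and T :: 'k and n :: nat and e :: "nat \<Rightarrow> 'k"
  assumes F: "is_subring F" "finite F"
    and T: "f \<in> polys_over F \<Longrightarrow> poly f T = 0 \<Longrightarrow> f = 0"
    and span: "\<exists>d a. d \<in> (\<lambda>f. poly f T) ` polys_over F \<and> d \<noteq> 0 \<and>
      (\<forall>i<n. a i \<in> (\<lambda>f. poly f T) ` polys_over F) \<and> d * x = (\<Sum>i<n. a i * e i)"
    and indep: "(\<And>i. i < n \<Longrightarrow> a i \<in> (\<lambda>f. poly f T) ` polys_over F) \<Longrightarrow>
      (\<Sum>i<n. a i * e i) = 0 \<Longrightarrow> j < n \<Longrightarrow> a j = 0"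
begin

section \<open>Polynomials in \<open>T\<close> of bounded degree\<close>

definition q :: nat where "q = card F"

definition polys_lt :: "nat \<Rightarrow> 'k poly set" where
  "polys_lt c = {f \<in> polys_over F. \<forall>i\<ge>c. Polynomial.coeff f i = 0}"

text \<open>The degree bound is strict, so that there are q^c elements and \<open>Ad 0\<close> is
  {0}. Degree at most \<open>D\<close> is written \<open>Ad (Suc D)\<close>, and multiplication by
  such an element raises the bound by \<open>D\<close>.\<close>

definition Ad :: "nat \<Rightarrow> 'k set" where
  "Ad c = (\<lambda>f. poly f T) ` polys_lt c"

lemma q_ge_2: "q \<ge> 2"
proof -
  have "{0, 1} \<subseteq> F" using subring_zero[OF F(1)] subring_one[OF F(1)] by auto
  from card_mono[OF F(2) this] show ?thesis by (simp add: q_def)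
qed

lemma card_polys_lt: "finite (polys_lt c) \<and> card (polys_lt c) = q ^ c"
proof (induction c)
  case 0
  have "polys_lt 0 = {0}"
    using polys_over_zero[OF F(1)] by (auto simp: polys_lt_def poly_eq_iff)
  then show ?case by simp
next
  case (Suc c)
  have inj: "inj_on (\<lambda>(a, f). pCons a f) (F \<times> polys_lt c)" by (auto simp: inj_on_def)
  have "polys_lt (Suc c) = (\<lambda>(a, f). pCons a f) ` (F \<times> polys_lt c)"
  proof
    show "(\<lambda>(a, f). pCons a f) ` (F \<times> polys_lt c) \<subseteq> polys_lt (Suc c)"
      by (auto simp: polys_lt_def polys_over_def coeff_pCons split: nat.splits)
    show "polys_lt (Suc c) \<subseteq> (\<lambda>(a, f). pCons a f) ` (F \<times> polys_lt c)"
    proof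
      fix f assume f: "f \<in> polys_lt (Suc c)"
      obtain a g where ag: "f = pCons a g" by (cases f)
      have "Polynomial.coeff f 0 \<in> F" "\<And>i. Polynomial.coeff f (Suc i) \<in> F"
        "\<And>i. i \<ge> c \<Longrightarrow> Polynomial.coeff f (Suc i) = 0"
        using f by (auto simp: polys_lt_def polys_over_def)
      then have "a \<in> F" "g \<in> polys_lt c" by (auto simp: ag polys_lt_def polys_over_def)
      then show "f \<in> (\<lambda>(a, f). pCons a f) ` (F \<times> polys_lt c)" using ag by force
    qed
  qed
  then show ?case using Suc inj F(2) by (simp add: card_image card_cartesian_product q_def)
qed

lemma inj_poly_T: "inj_on (\<lambda>f. poly f T) (polys_over F)"
proof (rule inj_onI)
  fix f g assume "f \<in> polys_over F" "g \<in> polys_over F" "poly f T = poly g T"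
  then have "f - g = 0" by (intro T polys_over_diff F) auto
  then show "f = g" by simp
qed

lemma finite_Ad: "finite (Ad c)" and card_Ad: "card (Ad c) = q ^ c"
proof -
  have "inj_on (\<lambda>f. poly f T) (polys_lt c)"
    by (rule inj_on_subset[OF inj_poly_T]) (auto simp: polys_lt_def)
  then show "finite (Ad c)" "card (Ad c) = q ^ c"
    using card_polys_lt by (auto simp: Ad_def card_image)
qed

lemma Ad_mono: "c \<le> d \<Longrightarrow> Ad c \<subseteq> Ad d"
  unfolding Ad_def by (intro image_mono) (auto simp: polys_lt_def)

lemma Ad_I: "f \<in> polys_lt c \<Longrightarrow> a = poly f T \<Longrightarrow> a \<in> Ad c"
  by (auto simp: Ad_def)

lemma Ad_E:
  assumes "a \<in> Ad c" obtains f where "f \<in> polys_lt c" "a = poly f T"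
  using assms by (auto simp: Ad_def)

lemma Ad_add: "a \<in> Ad c \<Longrightarrow> b \<in> Ad c \<Longrightarrow> a + b \<in> Ad c"
  by (elim Ad_E, rule_tac f = "f + fa" in Ad_I) (auto simp: polys_lt_def polys_over_add[OF F(1)])

lemma Ad_diff: "a \<in> Ad c \<Longrightarrow> b \<in> Ad c \<Longrightarrow> a - b \<in> Ad c"
  by (elim Ad_E, rule_tac f = "f - fa" in Ad_I) (auto simp: polys_lt_def polys_over_diff[OF F(1)])

lemma Ad_zero: "0 \<in> Ad c"
  by (rule Ad_I[of 0]) (auto simp: polys_lt_def polys_over_zero[OF F(1)])

lemma Ad_sum: "(\<And>i. i \<in> I \<Longrightarrow> f i \<in> Ad c) \<Longrightarrow> sum f I \<in> Ad c"
  by (induction I rule: infinite_finite_induct) (auto intro: Ad_zero Ad_add)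

lemma Ad_mult:
  assumes "a \<in> Ad c" "b \<in> Ad (Suc D)" shows "b * a \<in> Ad (c + D)"
proof -
  obtain f g where fg: "f \<in> polys_lt c" "g \<in> polys_lt (Suc D)" "a = poly f T" "b = poly g T"
    using assms by (auto simp: Ad_def)
  have "Polynomial.coeff (g * f) i = 0" if "i \<ge> c + D" for i
    unfolding Polynomial.coeff_mult
  proof (rule sum.neutral, rule ballI)
    fix j assume "j \<in> {..i}"
    then have "j \<ge> Suc D \<or> i - j \<ge> c" using that by auto
    then show "Polynomial.coeff g j * Polynomial.coeff f (i - j) = 0"
      using fg by (auto simp: polys_lt_def)
  qed
  then have "g * f \<in> polys_lt (c + D)"
    using fg polys_over_mult[OF F(1)] by (auto simp: polys_lt_def)
  then show ?thesis using fg by (auto simp: Ad_def intro!: image_eqI[of _ _ "g * f"])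
qed

lemma Ad_iff: "(\<exists>c. a \<in> Ad c) \<longleftrightarrow> a \<in> (\<lambda>f. poly f T) ` polys_over F"
proof
  assume "a \<in> (\<lambda>f. poly f T) ` polys_over F"
  then obtain f where "f \<in> polys_over F" "a = poly f T" by auto
  then have "a \<in> Ad (Suc (Polynomial.degree f))"
    unfolding Ad_def by (intro image_eqI[of _ _ f]) (auto simp: polys_lt_def coeff_eq_0)
  then show "\<exists>c. a \<in> Ad c" by blast
qed (auto simp: Ad_def polys_lt_def)

lemma Ad_const: "a \<in> F \<Longrightarrow> a \<in> Ad 1"
  using polys_over_pCons[OF F(1) _ polys_over_zero[OF F(1)]]
  by (intro Ad_I[of "[:a:]"]) (auto simp: polys_lt_def coeff_pCons split: nat.splits)

lemma Ad_one: "1 \<in> Ad (Suc D)"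
  using Ad_const[OF subring_one[OF F(1)]] Ad_mono[of 1 "Suc D"] by auto

lemma Ad_T_power: "T ^ i \<in> Ad (Suc i)"
  using polys_over_monom[OF F(1) subring_one[OF F(1)], of i]
  by (intro Ad_I[of "Polynomial.monom 1 i"]) (auto simp: polys_lt_def poly_monom)

lemma T_nonzero: "T \<noteq> 0"
proof
  assume "T = 0"
  then have "[:0, 1:] = (0 :: 'k poly)"
    by (intro T polys_over_pCons polys_over_zero subring_zero subring_one F) auto
  then show False by simp
qed

section \<open>Elements with bounded coordinates over a common denominator\<close>

definition W :: "'k \<Rightarrow> nat \<Rightarrow> 'k set" where
  "W d c = {x. \<exists>a. (\<forall>j<n. a j \<in> Ad c) \<and> d * x = (\<Sum>j<n. a j * e j)}"

lemma W_I: "(\<And>j. j < n \<Longrightarrow> a j \<in> Ad c) \<Longrightarrow> d * x = (\<Sum>j<n. a j * e j) \<Longrightarrow> x \<in> W d c"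
  unfolding W_def by blast

text \<open>The bound does not involve \<open>d\<close>: denominators are free, only degrees of
  numerators cost. So the denominators d s^M in \<open>quot_growth\<close> may grow with
  \<open>M\<close>.\<close>

lemma card_W:
  assumes "d \<noteq> 0"
  shows "finite (W d c)" "card (W d c) \<le> q ^ (n * c)"
proof -
  have fin: "finite (PiE {..<n} (\<lambda>_. Ad c))" by (intro finite_PiE finite_Ad) auto
  have sub: "W d c \<subseteq> (\<lambda>a. (\<Sum>j<n. a j * e j) / d) ` PiE {..<n} (\<lambda>_. Ad c)"
  proof
    fix x assume "x \<in> W d c"
    then obtain a where a: "\<And>j. j < n \<Longrightarrow> a j \<in> Ad c" "d * x = (\<Sum>j<n. a j * e j)"
      by (auto simp: W_def)
    have "x = (\<Sum>j<n. restrict a {..<n} j * e j) / d"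
      using a assms by (simp add: field_simps)
    moreover have "restrict a {..<n} \<in> PiE {..<n} (\<lambda>_. Ad c)" using a by auto
    ultimately show "x \<in> (\<lambda>a. (\<Sum>j<n. a j * e j) / d) ` PiE {..<n} (\<lambda>_. Ad c)" by blast
  qed
  then show "finite (W d c)" using fin finite_subset by blast
  have "card (W d c) \<le> card (PiE {..<n} (\<lambda>_. Ad c))"
    using card_mono[OF finite_imageI[OF fin] sub] card_image_le[OF fin] order_trans by blast
  also have "\<dots> = q ^ (n * c)" by (simp add: card_PiE card_Ad power_mult mult.commute)
  finally show "card (W d c) \<le> q ^ (n * c)" .
qed

lemma W_mono: "c \<le> c' \<Longrightarrow> W d c \<subseteq> W d c'"
  using Ad_mono[of c c'] unfolding W_def by blast

lemma W_zero: "0 \<in> W d c"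
  unfolding W_def using Ad_zero by (auto intro!: exI[of _ "\<lambda>_. 0"])

lemma W_add:
  assumes "x \<in> W d c" "y \<in> W d c" shows "x + y \<in> W d c"
proof -
  obtain a b where "\<forall>j<n. a j \<in> Ad c" "d * x = (\<Sum>j<n. a j * e j)"
    "\<forall>j<n. b j \<in> Ad c" "d * y = (\<Sum>j<n. b j * e j)" using assms by (auto simp: W_def)
  then show ?thesis unfolding W_def
    by (auto intro!: exI[of _ "\<lambda>j. a j + b j"] Ad_add simp: algebra_simps sum.distrib)
qed

lemma W_denom:
  assumes "x \<in> W d c" "s \<in> Ad (Suc D)"
  shows "x \<in> W (d * s) (c + D)" "s * x \<in> W d (c + D)"
proof -
  obtain a where a: "\<forall>j<n. a j \<in> Ad c" "d * x = (\<Sum>j<n. a j * e j)" using assms by (auto simp: W_def)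
  have "s * (d * x) = (\<Sum>j<n. (s * a j) * e j)" unfolding a(2) by (simp add: sum_distrib_left mult.assoc)
  then have "d * s * x = (\<Sum>j<n. (s * a j) * e j)" "d * (s * x) = (\<Sum>j<n. (s * a j) * e j)"
    by (simp_all only: mult_ac)
  moreover have "s * a j \<in> Ad (c + D)" if "j < n" for j using a(1) that Ad_mult[OF _ assms(2)] by blast
  ultimately show "x \<in> W (d * s) (c + D)" "s * x \<in> W d (c + D)"
    using W_I[of "\<lambda>j. s * a j"] by blast+
qed

text \<open>\<open>c\<close> also bounds the degree of \<open>d\<close>, so that \<open>d\<close>
  can act as a multiplier in \<open>W_denom\<close>.\<close>

lemma common_denominator:
  assumes "finite Z"
  shows "\<exists>d c. d \<noteq> 0 \<and> d \<in> Ad (Suc c) \<and> Z \<subseteq> W d c"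
  using assms
proof (induction Z)
  case empty
  show ?case using Ad_one[of 0] by (intro exI[of _ 1] exI[of _ 0]) auto
next
  case (insert x Z)
  then obtain d c where d: "d \<noteq> 0" "d \<in> Ad (Suc c)" "Z \<subseteq> W d c" by auto
  obtain d' a where a: "d' \<in> (\<lambda>f. poly f T) ` polys_over F" "d' \<noteq> 0"
    "\<And>i. i < n \<Longrightarrow> a i \<in> (\<lambda>f. poly f T) ` polys_over F" "d' * x = (\<Sum>i<n. a i * e i)"
    using span[of x] by metis
  obtain c0 where c0: "d' \<in> Ad c0" using a(1) Ad_iff[of d'] by blast
  have "\<forall>i. \<exists>c. i < n \<longrightarrow> a i \<in> Ad c" using a(3) Ad_iff by blast
  then obtain c1 where c1: "\<And>i. i < n \<Longrightarrow> a i \<in> Ad (c1 i)" by metis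
  define c2 where "c2 = c0 + (\<Sum>i<n. c1 i)"
  have "c1 i \<le> c2" if "i < n" for i
    using member_le_sum[of i "{..<n}" c1] that by (simp add: c2_def)
  then have "a i \<in> Ad c2" if "i < n" for i using c1 Ad_mono that by blast
  then have x: "x \<in> W d' c2" using a(4) by (auto simp: W_def)
  have d': "d' \<in> Ad (Suc c2)" using c0 Ad_mono[of c0 "Suc c2"] by (auto simp: c2_def)
  have "d' * d \<in> Ad (Suc c + c2)" using Ad_mult[OF d(2) d'] by simp
  moreover have "insert x Z \<subseteq> W (d * d') (c + c2)"
    using W_denom(1)[OF x d(2)] W_denom(1)[OF _ d'] d(3) by (auto simp: mult.commute[of d'] add.commute[of c2])
  ultimately show ?case using d(1) a(2)
    by (intro exI[of _ "d * d'"] exI[of _ "c + c2"]) (auto simp: mult.commute[of d'])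
qed

text \<open>\<open>growth y s D\<close>: multiplication by \<open>y\<close> costs a factor \<open>s\<close> in the denominator and raises the
  degrees of the coordinates by at most \<open>D\<close>.\<close>

definition growth :: "'k \<Rightarrow> 'k \<Rightarrow> nat \<Rightarrow> bool" where
  "growth y s D \<longleftrightarrow> s \<noteq> 0 \<and> (\<forall>d c x. x \<in> W d c \<longrightarrow> y * x \<in> W (d * s) (c + D) \<and> x \<in> W (d * s) (c + D))"

lemma growth_Ad: "y \<in> Ad (Suc D) \<Longrightarrow> growth y 1 D"
  unfolding growth_def using W_denom(2) subsetD[OF W_mono[OF le_add1]] by simp

text \<open>Dividing by \<open>T\<close> only puts \<open>T\<close> into the denominator, and
  rewriting an element over that denominator costs one degree. The constant 1 is what bounds the
  norm of the pole divisor of \<open>T\<close> by q^n.\<close>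

lemma growth_inverse_T: "growth (inverse T) T 1"
  unfolding growth_def
proof (intro conjI allI impI T_nonzero)
  fix d c x assume x: "x \<in> W d c"
  have T: "T \<in> Ad (Suc 1)" using Ad_T_power[of 1] by simp
  from W_denom(1)[OF x T] show "x \<in> W (d * T) (c + 1)" .
  have "d * T * (inverse T * x) = d * x" using T_nonzero by (metis mult.assoc mult.commute right_inverse mult_1_right)
  with x have "inverse T * x \<in> W (d * T) c" unfolding W_def mem_Collect_eq by (simp only:)
  then show "inverse T * x \<in> W (d * T) (c + 1)" using W_mono[of c "c + 1"] by auto
qed

text \<open>Write multiplication by \<open>y\<close> as a matrix in the basis \<open>e\<close> and
  clear denominators: \<open>s\<close> is the common denominator, and \<open>D\<close> bounds the
  degrees of the entries \<open>b\<close>.\<close>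

lemma growth_exists: "\<exists>s D. growth y s D"
proof -
  obtain s D where s: "s \<noteq> 0" "s \<in> Ad (Suc D)" "(\<lambda>j. y * e j) ` {..<n} \<subseteq> W s D"
    using common_denominator[of "(\<lambda>j. y * e j) ` {..<n}"] by auto
  have "\<forall>j. \<exists>b. j < n \<longrightarrow> (\<forall>l<n. b l \<in> Ad D) \<and> s * (y * e j) = (\<Sum>l<n. b l * e l)"
    using s(3) by (auto simp: W_def)
  then obtain b where b: "\<And>j l. j < n \<Longrightarrow> l < n \<Longrightarrow> b j l \<in> Ad D"
    "\<And>j. j < n \<Longrightarrow> s * (y * e j) = (\<Sum>l<n. b j l * e l)" by metis
  have "growth y s D"
    unfolding growth_def
  proof (intro conjI allI impI s)
    fix d c x assume x: "x \<in> W d c"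
    from W_denom(1)[OF x s(2)] show "x \<in> W (d * s) (c + D)" .
    obtain a where a: "\<And>j. j < n \<Longrightarrow> a j \<in> Ad c" "d * x = (\<Sum>j<n. a j * e j)" using x by (auto simp: W_def)
    have "d * s * (y * x) = s * y * (d * x)" by (simp add: mult_ac)
    also have "\<dots> = (\<Sum>j<n. a j * (s * (y * e j)))"
      unfolding a(2) by (simp add: sum_distrib_left mult_ac)
    also have "\<dots> = (\<Sum>j<n. \<Sum>l<n. b j l * a j * e l)"
      using b(2) by (intro sum.cong) (auto simp: sum_distrib_left mult_ac)
    also have "\<dots> = (\<Sum>l<n. (\<Sum>j<n. b j l * a j) * e l)"
      by (subst sum.swap) (simp add: sum_distrib_right)
    finally have eq: "d * s * (y * x) = (\<Sum>l<n. (\<Sum>j<n. b j l * a j) * e l)" .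
    have "(\<Sum>j<n. b j l * a j) \<in> Ad (c + D)" if "l < n" for l
    proof (rule Ad_sum)
      fix j assume "j \<in> {..<n}"
      then show "b j l * a j \<in> Ad (c + D)"
        using Ad_mult[OF a(1)[of j]] b(1)[of j l] that Ad_mono[of D "Suc D"] by auto
    qed
    with eq show "y * x \<in> W (d * s) (c + D)" by (rule W_I[rotated])
  qed
  then show ?thesis by blast
qed

text \<open>Expansions \<open>\<Sum>i<M. y\<^sup>i x\<^sub>i\<close> with digits incongruent modulo \<open>y\<close> are pairwise distinct; comparing
  their number with the number of elements of bounded degree bounds the number of digits.\<close>

lemma quot_growth:
  assumes gr: "growth y s D" and R: "is_subring R" and y: "y \<in> R" "y \<noteq> 0"
  shows "finite (quot R ((*) y ` R))" "idx R ((*) y ` R) \<le> q ^ (n * D)"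
proof -
  have bound: "card Z \<le> q ^ (n * D)"
    if Z: "finite Z" "Z \<subseteq> R" and sep: "\<And>x x'. x \<in> Z \<Longrightarrow> x' \<in> Z \<Longrightarrow> x \<noteq> x' \<Longrightarrow> x - x' \<notin> (*) y ` R" for Z
  proof -
    obtain d c where d: "d \<noteq> 0" "Z \<subseteq> W d c" using common_denominator[OF Z(1)] by blast
    \<comment> \<open>The expansions of length \<open>M\<close> with digits in \<open>Z\<close>,
      built by Horner's scheme.\<close>
    define S where "S = rec_nat {0} (\<lambda>_ S. (\<lambda>(x, t). x + y * t) ` (Z \<times> S))"
    have S0: "S 0 = {0}" and SS: "S (Suc M) = (\<lambda>(x, t). x + y * t) ` (Z \<times> S M)" for M
      by (simp_all add: S_def)
    have s: "s \<noteq> 0" using gr by (simp add: growth_def)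
    have gr': "y * x \<in> W (d * s) (c + D)" "x \<in> W (d * s) (c + D)" if "x \<in> W d c" for d c x
      using gr that by (auto simp: growth_def)
    have ZW: "x \<in> W (d * s ^ M) (c + M * D)" if "x \<in> Z" for x M
    proof (induction M)
      case 0
      then show ?case using d(2) that by auto
    next
      case (Suc M)
      from gr'(2)[OF Suc] show ?case by (simp add: ac_simps)
    qed
    have S: "S M \<subseteq> R \<and> S M \<subseteq> W (d * s ^ M) (c + M * D) \<and> card (S M) = card Z ^ M" for M
    proof (induction M)
      case 0
      then show ?case using subring_zero[OF R] W_zero by (auto simp: S0)
    next
      case (Suc M)
      have "inj_on (\<lambda>(x, t). x + y * t) (Z \<times> S M)"
      proof (rule inj_onI, clarify)
        fix x t x' t' assume *: "x \<in> Z" "t \<in> S M" "x' \<in> Z" "t' \<in> S M" "x + y * t = x' + y * t'"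
        then have "x - x' = y * (t' - t)" by (simp add: algebra_simps)
        moreover have "t' - t \<in> R" using * Suc R by (auto intro: subring_diff)
        ultimately have "x = x'" using sep[of x x'] * by blast
        then show "x = x' \<and> t = t'" using * y by simp
      qed
      then have "card (S (Suc M)) = card Z ^ Suc M"
        using Suc by (simp add: SS card_image card_cartesian_product)
      moreover have "S (Suc M) \<subseteq> R"
        using Suc Z(2) y(1) R by (auto simp: SS intro!: subring_add subring_mult)
      moreover have "x + y * t \<in> W (d * s ^ Suc M) (c + Suc M * D)" if "x \<in> Z" "t \<in> S M" for x t
      proof (rule W_add[OF ZW[OF that(1)]])
        have "t \<in> W (d * s ^ M) (c + M * D)" using Suc that by blast
        from gr'(1)[OF this] show "y * t \<in> W (d * s ^ Suc M) (c + Suc M * D)" by (simp add: ac_simps)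
      qed
      then have "S (Suc M) \<subseteq> W (d * s ^ Suc M) (c + Suc M * D)" by (auto simp: SS)
      ultimately show ?case by blast
    qed
    \<comment> \<open>The expansions have coordinates of degree below c + M D; the factor q^(n c),
      independent of \<open>M\<close>, is the constant that \<open>nat_le_of_power_le\<close>
      removes.\<close>
    have "card Z ^ M \<le> q ^ (n * c) * (q ^ (n * D)) ^ M" for M
    proof -
      have "d * s ^ M \<noteq> 0" using d s by simp
      from card_W[OF this] have "card (S M) \<le> q ^ (n * (c + M * D))"
        using S[of M] card_mono order_trans by blast
      also have "\<dots> = q ^ (n * c) * (q ^ (n * D)) ^ M"
        by (simp add: algebra_simps flip: power_add power_mult)
      finally show ?thesis using S[of M] by simp
    qed
    then show ?thesis by (rule nat_le_of_power_le) (use q_ge_2 in simp)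
  qed
  note group = add_subgroup_multiples[OF subring_group[OF R], of y]
  show "finite (quot R ((*) y ` R))" by (rule quot_bounded(1)[OF group bound])
  show "idx R ((*) y ` R) \<le> q ^ (n * D)" by (rule quot_bounded(2)[OF group bound])
qed

lemma finite_quot_multiples:
  fixes z :: 'k
  assumes "is_subring R" "z \<in> R" "z \<noteq> 0" shows "finite (quot R ((*) z ` R))"
  using growth_exists[of z] quot_growth(1) assms by blast

section \<open>Residue fields and zeros of elements\<close>

lemma is_subring_vset:
  assumes "\<And>v. v \<in> Q \<Longrightarrow> is_place v" shows "is_subring (vset Q (\<lambda>_. 0))"
proof -
  have "vge v 0 (x * y)" if "v \<in> Q" "vge v 0 x" "vge v 0 y" for v x y
    using vge_mult[OF assms[OF that(1)] that(2,3)] by simp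
  moreover have "vge v 0 1" if "v \<in> Q" for v
    using place_one[OF assms[OF that]] by (simp add: vge_def)
  ultimately show ?thesis
    using add_subgroup_vset[of Q "\<lambda>_. 0"] assms by (simp add: is_subring_def vset_def)
qed

text \<open>The residue field is the valuation ring modulo the multiples of a uniformizer, finite by
  \<open>finite_quot_multiples\<close>.\<close>

lemma fin_place:
  fixes v :: "'k \<Rightarrow> int"
  assumes v: "is_place v" shows "fin_place v"
proof -
  obtain p where p: "p \<noteq> 0" "v p = 1" using place_uniformizer[OF v] by auto
  have "vset {v} (\<lambda>_. 0) = vball v 0" "(*) p ` vset {v} (\<lambda>_. 0) = vball v 1"
    using vset_scale[of "{v}" p "\<lambda>_. 0"] v p by (auto simp: vset_def vball_def)
  then show ?thesis
    using finite_quot_multiples[OF is_subring_vset, of "{v}" p] v p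
    by (auto simp: fin_place_def vset_def vge_def)
qed

text \<open>In the semilocal ring of \<open>G\<close> the multiples of \<open>y\<close> form an
  ideal whose index is this product by weak approximation; \<open>quot_growth\<close> bounds it. For
  \<open>T\<close> or 1/T, where D = 1, this is the fundamental inequality that the sum of e f is at
  most n, in multiplicative form.\<close>

lemma prod_res_card_le:
  fixes y :: 'k
  assumes G: "finite G" "\<And>v. v \<in> G \<Longrightarrow> is_place v" and y: "y \<noteq> 0" "\<And>v. v \<in> G \<Longrightarrow> v y \<ge> 0"
    and gr: "growth y s D"
  shows "(\<Prod>v\<in>G. res_card v ^ nat (v y)) \<le> q ^ (n * D)"
proof -
  define m where "m v = (if v \<in> G then nat (v y) else 0)" for v
  have "(*) y ` vset G (\<lambda>_. 0) = vset G (\<lambda>v. 0 + v y)"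
    using vset_scale[of G y "\<lambda>_. 0"] G y by simp
  also have "\<dots> = vset G (\<lambda>v. 0 + int (m v))"
    using y by (intro vset_cong) (auto simp: m_def)
  finally have "idx (vset G (\<lambda>_. 0)) ((*) y ` vset G (\<lambda>_. 0)) = (\<Prod>v\<in>G. res_card v ^ m v)"
    using weak_approximation_index[of G m "\<lambda>_. 0"] G fin_place by (auto simp: m_def)
  also have "\<dots> = (\<Prod>v\<in>G. res_card v ^ nat (v y))" by (intro prod.cong) (auto simp: m_def)
  finally have "idx (vset G (\<lambda>_. 0)) ((*) y ` vset G (\<lambda>_. 0)) = (\<Prod>v\<in>G. res_card v ^ nat (v y))" .
  moreover have "y \<in> vset G (\<lambda>_. 0)" using y by (simp add: vset_def vge_def)
  ultimately show ?thesis
    using quot_growth(2)[OF gr is_subring_vset _ y(1), of G] G(2) by simp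
qed

lemma finite_zeros: "(y::'k) \<noteq> 0 \<Longrightarrow> finite {v. is_place v \<and> v y > 0}"
proof (rule ccontr)
  assume y: "y \<noteq> 0" and inf: "infinite {v. is_place v \<and> v y > 0}"
  obtain s D where gr: "growth y s D" using growth_exists by blast
  \<comment> \<open>As many zeros as the bound N = q^(n D) on the product: each contributes a factor
    at least 2, and 2^N exceeds N.\<close>
  obtain G where G: "finite G" "card G = q ^ (n * D)" "G \<subseteq> {v. is_place v \<and> v y > 0}"
    using infinite_arbitrarily_large[OF inf] by blast
  have "2 ^ card G = (\<Prod>v\<in>G. 2 :: nat)" by simp
  also have "\<dots> \<le> (\<Prod>v\<in>G. res_card v ^ nat (v y))"
  proof (rule prod_mono)
    fix v assume "v \<in> G"
    then have v: "is_place v" "v y > 0" using G by auto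
    have "(2::nat) ^ 1 \<le> 2 ^ nat (v y)" using v by (intro power_increasing) auto
    also have "\<dots> \<le> res_card v ^ nat (v y)"
      using res_card_ge_2[OF fin_place[OF v(1)]] by (intro power_mono) auto
    finally show "0 \<le> (2::nat) \<and> 2 \<le> res_card v ^ nat (v y)" by simp
  qed
  also have "\<dots> \<le> card G"
    using prod_res_card_le[OF G(1) _ y _ gr] G by fastforce
  finally show False using less_exp[of "card G"] by simp
qed

lemma finite_support:
  fixes y :: 'k
  assumes "y \<noteq> 0" shows "finite {v. is_place v \<and> v y \<noteq> 0}"
proof (rule finite_subset)
  show "{v. is_place v \<and> v y \<noteq> 0} \<subseteq>
    {v. is_place v \<and> v y > 0} \<union> {v. is_place v \<and> v (inverse y) > 0}"
    by (auto simp: place_inverse)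
  show "finite ({v. is_place v \<and> v y > 0} \<union> {v. is_place v \<and> v (inverse y) > 0})"
    using finite_zeros[OF assms] finite_zeros[of "inverse y"] assms by auto
qed

end

section \<open>Riemann's inequality and strong approximation\<close>

context function_field
begin

section \<open>Divisors and their norms\<close>

abbreviation Places :: "('k \<Rightarrow> int) set" where "Places \<equiv> Collect is_place"

definition fin_supp :: "(('k \<Rightarrow> int) \<Rightarrow> int) \<Rightarrow> bool" where
  "fin_supp E \<longleftrightarrow> finite {v. is_place v \<and> E v \<noteq> 0}"

definition div_norm :: "(('k \<Rightarrow> int) \<Rightarrow> int) \<Rightarrow> real" where
  "div_norm E = (\<Prod>v | is_place v \<and> E v \<noteq> 0. real (res_card v) powi E v)"

text \<open>With D = -E and degrees taken over \<open>F\<close>, this is q to the power l(D) - deg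
  D.\<close>

definition rho :: "(('k \<Rightarrow> int) \<Rightarrow> int) \<Rightarrow> real" where
  "rho E = real (card (vset Places E)) * div_norm E"

lemma res_card_pos: "is_place (v :: 'k \<Rightarrow> int) \<Longrightarrow> real (res_card v) > 0"
  using res_card_ge_2[OF fin_place, of v] by simp

lemma div_norm_eq:
  assumes "finite G" "G \<subseteq> Places" "\<And>v. is_place v \<Longrightarrow> v \<notin> G \<Longrightarrow> E v = 0"
  shows "div_norm E = (\<Prod>v\<in>G. real (res_card v) powi E v)"
  unfolding div_norm_def by (rule prod.mono_neutral_left) (use assms in auto)

lemma div_norm_cong: "(\<And>v. is_place v \<Longrightarrow> E v = E' v) \<Longrightarrow> div_norm E = div_norm E'"
  unfolding div_norm_def by (rule prod.cong) auto

lemma div_norm_pos: "div_norm E > 0"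
  unfolding div_norm_def by (intro prod_pos zero_less_power_int) (use res_card_pos in auto)

lemma fin_supp_add:
  assumes "fin_supp E" "fin_supp E'" shows "fin_supp (\<lambda>v. E v + E' v)"
proof -
  have "{v. is_place v \<and> E v + E' v \<noteq> 0} \<subseteq> {v. is_place v \<and> E v \<noteq> 0} \<union> {v. is_place v \<and> E' v \<noteq> 0}"
  proof
    fix v assume "v \<in> {v. is_place v \<and> E v + E' v \<noteq> 0}"
    then show "v \<in> {v. is_place v \<and> E v \<noteq> 0} \<union> {v. is_place v \<and> E' v \<noteq> 0}"
      by (cases "E v = 0") simp_all
  qed
  then show ?thesis using assms unfolding fin_supp_def by (meson finite_UnI finite_subset)
qed

lemma fin_supp_scale: "fin_supp E \<Longrightarrow> fin_supp (\<lambda>v. c * E v)"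
  unfolding fin_supp_def by (rule finite_subset[of _ "{v. is_place v \<and> E v \<noteq> 0}"]) auto

lemma fin_supp_upd: "fin_supp E \<Longrightarrow> fin_supp (E(v := m))"
  unfolding fin_supp_def by (rule finite_subset[of _ "insert v {v. is_place v \<and> E v \<noteq> 0}"]) auto

lemma fin_supp_zero: "fin_supp (\<lambda>_. 0)"
  by (simp add: fin_supp_def)

lemma fin_supp_principal: "x \<noteq> 0 \<Longrightarrow> fin_supp (\<lambda>v. v x)"
  using finite_support[of x] by (simp add: fin_supp_def)

lemma div_norm_zero: "div_norm (\<lambda>_. 0) = 1"
  by (simp add: div_norm_def)

lemma div_norm_add:
  assumes "fin_supp E" "fin_supp E'" shows "div_norm (\<lambda>v. E v + E' v) = div_norm E * div_norm E'"
proof -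
  define G where "G = {v. is_place v \<and> E v \<noteq> 0} \<union> {v. is_place v \<and> E' v \<noteq> 0}"
  have G: "finite G" "G \<subseteq> Places" using assms by (auto simp: G_def fin_supp_def)
  have "div_norm (\<lambda>v. E v + E' v) = (\<Prod>v\<in>G. real (res_card v) powi (E v + E' v))"
    by (rule div_norm_eq[OF G]) (auto simp: G_def)
  also have "\<dots> = (\<Prod>v\<in>G. real (res_card v) powi E v * real (res_card v) powi E' v)"
    using G(2) res_card_pos by (intro prod.cong refl power_int_add) fastforce
  also have "\<dots> = div_norm E * div_norm E'"
    unfolding prod.distrib by (intro arg_cong2[of _ _ _ _ "(*)"] div_norm_eq[symmetric, OF G]) (auto simp: G_def)
  finally show ?thesis .
qed

lemma div_norm_upd:
  assumes "fin_supp E" "is_place v"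
  shows "div_norm (E(v := E v + m)) = div_norm E * real (res_card v) powi m"
proof -
  have "div_norm (E(v := E v + m)) = div_norm (\<lambda>w. E w + (if w = v then m else 0))"
    by (rule div_norm_cong) auto
  also have "\<dots> = div_norm E * div_norm (\<lambda>w. if w = v then m else 0)"
    by (rule div_norm_add[OF assms(1)]) (simp add: fin_supp_def)
  also have "div_norm (\<lambda>w. if w = v then m else 0) = real (res_card v) powi m"
    by (subst div_norm_eq[of "{v}"]) (use assms in auto)
  finally show ?thesis .
qed

lemma div_norm_scale:
  assumes "fin_supp E" shows "div_norm (\<lambda>v. int m * E v) = div_norm E ^ m"
proof (induction m)
  case (Suc m)
  have "div_norm (\<lambda>v. int (Suc m) * E v) = div_norm (\<lambda>v. E v + int m * E v)"
    by (rule div_norm_cong) (simp add: algebra_simps)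
  also have "\<dots> = div_norm E * div_norm E ^ m" using Suc div_norm_add[OF assms fin_supp_scale[OF assms]] by simp
  finally show ?case by simp
qed (simp add: div_norm_zero)

lemma div_norm_uminus:
  assumes "fin_supp E" shows "div_norm (\<lambda>v. - E v) = inverse (div_norm E)"
proof -
  have "div_norm (\<lambda>v. E v + - E v) = div_norm E * div_norm (\<lambda>v. - E v)"
    using fin_supp_scale[OF assms, of "- 1"] by (intro div_norm_add assms) simp
  then show ?thesis using div_norm_pos[of E] by (simp add: div_norm_zero field_simps)
qed

lemma vset_Places_step:
  assumes v: "is_place v" and fin: "finite (vset Places (E(v := E v + 1)))"
  defines "i \<equiv> idx (vset Places E) (vset Places (E(v := E v + 1)))"
  shows "finite (vset Places E)" "card (vset Places E) = i * card (vset Places (E(v := E v + 1)))"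
    "i \<le> res_card v" "i dvd res_card v"
proof -
  note step = vset_step[of Places v E, OF _ fin_place[OF v]]
  have groups: "add_subgroup (vset Places E)" for E by (rule add_subgroup_vset) simp
  have sub: "vset Places (E(v := E v + 1)) \<subseteq> vset Places E" by (rule vset_mono) auto
  note tower = quot_tower[OF groups groups add_subgroup_zero_set _ sub]
  have z: "{0} \<subseteq> vset Places (E(v := E v + 1))" by (simp add: vset_def)
  show "finite (vset Places E)" using tower(2)[OF z] step(1) v fin quot_zero(2) by auto
  show "card (vset Places E) = i * card (vset Places (E(v := E v + 1)))"
    using tower(1)[OF z] by (simp add: quot_zero(1) i_def)
  show dvd: "i dvd res_card v" unfolding i_def using step(2) v by simp
  show "i \<le> res_card v"
    using dvd res_card_ge_2[OF fin_place[OF v]] by (intro dvd_imp_le) auto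
qed

lemma rho_step:
  assumes "is_place v" "finite (vset Places (E(v := E v + 1)))" "fin_supp E"
  shows "rho E * real (res_card v) =
    real (idx (vset Places E) (vset Places (E(v := E v + 1)))) * rho (E(v := E v + 1))"
  using vset_Places_step(2)[OF assms(1,2)] div_norm_upd[OF assms(3,1), of 1] by (simp add: rho_def)

text \<open>Raising \<open>E\<close> by one at \<open>v\<close> multiplies the norm by
  \<open>res_card v\<close> and divides the cardinality by an index of at most
  \<open>res_card v\<close>. The induction is on the total difference; finiteness travels from the
  smaller set of \<open>E'\<close> to the larger set of \<open>E\<close>.\<close>

lemma rho_mono:
  assumes "fin_supp E" "fin_supp E'" "\<And>v. is_place v \<Longrightarrow> E v \<le> E' v" "finite (vset Places E')"
  shows "finite (vset Places E) \<and> rho E \<le> rho E'"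
proof -
  define G where "G = {v. is_place v \<and> E' v \<noteq> 0} \<union> {v. is_place v \<and> E v \<noteq> 0}"
  have G: "finite G" "G \<subseteq> Places" using assms(1,2) by (auto simp: G_def fin_supp_def)
  have "\<And>v. is_place v \<Longrightarrow> v \<notin> G \<Longrightarrow> E v = E' v" by (auto simp: G_def)
  then show ?thesis using assms(1,3)
  proof (induction "\<Sum>v\<in>G. nat (E' v - E v)" arbitrary: E)
    case 0
    have "E v = E' v" if "is_place v" for v
    proof (cases "v \<in> G")
      case True
      have "nat (E' v - E v) = 0"
        using 0(1)[symmetric] sum_nonneg_eq_0_iff[OF G(1), of "\<lambda>v. nat (E' v - E v)"] True by simp
      then show ?thesis using 0(4)[OF that] by simp
    next
      case False
      then show ?thesis by (rule 0(2)[OF that])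
    qed
    then have "vset Places E = vset Places E'" "div_norm E = div_norm E'" by (intro vset_cong div_norm_cong; simp)+
    then show ?case using assms(4) by (simp add: rho_def)
  next
    case (Suc N)
    then have "(\<Sum>v\<in>G. nat (E' v - E v)) \<noteq> 0" by simp
    then obtain v where v: "v \<in> G" "E v < E' v" using G(1) by (auto simp: sum_eq_0_iff)
    then have pv: "is_place v" using G by auto
    define E1 where "E1 = E(v := E v + 1)"
    have "(\<Sum>v\<in>G. nat (E' v - E v)) = nat (E' v - E v) + (\<Sum>w\<in>G - {v}. nat (E' w - E w))"
      "(\<Sum>v\<in>G. nat (E' v - E1 v)) = nat (E' v - E1 v) + (\<Sum>w\<in>G - {v}. nat (E' w - E1 w))"
      using v(1) G(1) by (auto intro: sum.remove)
    moreover have "(\<Sum>w\<in>G - {v}. nat (E' w - E1 w)) = (\<Sum>w\<in>G - {v}. nat (E' w - E w))"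
      by (intro sum.cong) (auto simp: E1_def)
    ultimately have "N = (\<Sum>v\<in>G. nat (E' v - E1 v))" using Suc(2) v by (simp add: E1_def)
    moreover have "E1 w = E' w" if "is_place w" "w \<notin> G" for w
      using Suc.prems(1)[OF that] that v by (auto simp: E1_def)
    moreover have "fin_supp E1" unfolding E1_def by (rule fin_supp_upd[OF Suc.prems(2)])
    moreover have "E1 w \<le> E' w" if "is_place w" for w
      using Suc.prems(3)[OF that] v by (auto simp: E1_def)
    ultimately have IH: "finite (vset Places E1)" "rho E1 \<le> rho E'"
      using Suc.hyps(1)[of E1] by blast+
    note step = vset_Places_step[OF pv, of E, folded E1_def, OF IH(1)]
    have "rho E * real (res_card v) \<le> real (res_card v) * rho E1"
      using rho_step[OF pv, of E, folded E1_def, OF IH(1) Suc.prems(2)] step(3) div_norm_pos[of E1]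
      by (auto simp: rho_def intro!: mult_right_mono)
    then have "rho E \<le> rho E1" using res_card_pos[OF pv] by simp
    then show ?case using step(1) IH(2) by simp
  qed
qed

text \<open>Nonzero coefficients have value 0, so at a pole of \<open>x\<close> the leading term
  decides. In Horner form: x g(x) has negative value, and adding the constant \<open>a\<close> does
  not change it.\<close>

lemma place_poly_neg:
  assumes v: "is_place v" "v x < 0" and f: "f \<in> polys_over F" "f \<noteq> 0"
  shows "poly f x \<noteq> 0" "v (poly f x) = int (Polynomial.degree f) * v x"
proof -
  have x: "x \<noteq> 0" using v by (auto simp: is_place_def)
  have "poly f x \<noteq> 0 \<and> v (poly f x) = int (Polynomial.degree f) * v x"
    using f
  proof (induction f rule: pCons_induct)
    case (pCons a g)
    have "Polynomial.coeff (pCons a g) 0 \<in> F" "\<And>i. Polynomial.coeff (pCons a g) (Suc i) \<in> F"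
      using pCons.prems(1) unfolding polys_over_def by blast+
    then have ag: "a \<in> F" "g \<in> polys_over F" by (auto simp: polys_over_def)
    have a: "vge v 0 a"
      using finite_subring_place[OF F ag(1) _ v(1)] unfolding vge_def by (cases "a = 0") simp_all
    show ?case
    proof (cases "g = 0")
      case True
      then show ?thesis using pCons finite_subring_place[OF F ag(1) _ v(1)] by auto
    next
      case False
      then have IH: "poly g x \<noteq> 0" "v (poly g x) = int (Polynomial.degree g) * v x"
        using pCons.IH ag by auto
      then have c: "x * poly g x \<noteq> 0" "v (x * poly g x) = (1 + int (Polynomial.degree g)) * v x"
        using x place_mult[OF v(1)] by (auto simp: algebra_simps)
      have "v (x * poly g x) < 0" unfolding c(2) using v(2) by (simp add: mult_less_0_iff)
      then have "vge v (v (x * poly g x) + 1) a" using a by (auto elim: vge_mono)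
      then have "vge v (v (x * poly g x) + 1) (poly (pCons a g) x - x * poly g x)" by simp
      from place_eqI[OF v(1) c(1) this] c(2) False show ?thesis by simp
    qed
  qed simp
  then show "poly f x \<noteq> 0" "v (poly f x) = int (Polynomial.degree f) * v x" by auto
qed

lemma Ad_place_nonneg:
  assumes v: "is_place v" "v T \<ge> 0" and a: "a \<in> Ad c"
  shows "vge v 0 a"
proof -
  obtain f where f: "f \<in> polys_lt c" "a = poly f T" using a by (rule Ad_E)
  have "vge v 0 (Polynomial.coeff f i * T ^ i)" for i
  proof -
    have "Polynomial.coeff f i \<in> F" using f by (auto simp: polys_lt_def polys_over_def)
    then have "vge v 0 (Polynomial.coeff f i)"
      using finite_subring_place[OF F _ _ v(1)] by (auto simp: vge_def)
    moreover have "vge v 0 (T ^ i)" using vge_power[OF v(1), of 0 T i] v by (auto simp: vge_def)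
    ultimately show ?thesis using vge_mult[OF v(1), of 0 _ 0] by fastforce
  qed
  then show ?thesis unfolding f(2) poly_altdef by (intro vge_sum v)
qed

lemma Ad_place_neg:
  assumes v: "is_place v" "v T < 0" and a: "a \<in> Ad c"
  shows "vge v (int c * v T) a"
proof (cases "a = 0")
  case False
  obtain f where f: "f \<in> polys_lt c" "a = poly f T" using a by (rule Ad_E)
  then have "f \<noteq> 0" using False by auto
  then have "Polynomial.coeff f (Polynomial.degree f) \<noteq> 0" by simp
  then have "\<not> c \<le> Polynomial.degree f" using f by (auto simp: polys_lt_def)
  then have "Polynomial.degree f \<le> c" by simp
  moreover have "v a = int (Polynomial.degree f) * v T"
    using place_poly_neg(2)[OF v _ \<open>f \<noteq> 0\<close>] f by (auto simp: polys_lt_def)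
  ultimately show ?thesis using v(2) by (auto simp: vge_def intro: mult_right_mono_neg)
qed simp

text \<open>Otherwise the inverse of \<open>z\<close> would be transcendental and hence vanish at some place.\<close>

lemma no_poles_imp_unit:
  assumes z: "z \<in> vset Places (\<lambda>_. 0)" "z \<noteq> 0" and v: "is_place v"
  shows "v z = 0"
proof (rule ccontr)
  assume "v z \<noteq> 0"
  then have vz: "v z > 0" using z v by (auto simp: vset_def vge_def)
  define x where "x = inverse z"
  define R0 where "R0 = (\<lambda>f. poly f x) ` polys_over F"
  have "z \<in> R0"
  proof (rule ccontr)
    assume "z \<notin> R0"
    moreover have "x \<in> R0"
    proof -
      have "[:0, 1:] \<in> polys_over F"
        by (intro polys_over_pCons polys_over_zero subring_zero subring_one F)
      then show ?thesis unfolding R0_def by (force intro: image_eqI[of _ _ "[:0, 1:]"])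
    qed
    ultimately have "\<exists>w. is_place w \<and> w x > 0"
      using z(2) is_subring_adjoin[OF F(1), of x]
      by (intro exists_place[of R0 x] finite_quot_multiples) (auto simp: R0_def x_def)
    then obtain w where w: "is_place w" "w x > 0" by (elim exE conjE)
    then have "is_place w" "w z < 0" using place_inverse[of w z] by (simp_all add: x_def)
    then show False using z by (auto simp: vset_def vge_def)
  qed
  then obtain f where f: "f \<in> polys_over F" "z = poly f x" by (auto simp: R0_def)
  \<comment> \<open>A polynomial in \<open>x\<close> has nonpositive value at a pole of
    \<open>x\<close>, whereas \<open>z\<close> vanishes there.\<close>
  have "v x < 0" using vz by (simp add: x_def place_inverse[OF v])
  moreover have "f \<noteq> 0" using f z by auto
  ultimately have "v z = int (Polynomial.degree f) * v x" using place_poly_neg(2) v f by blast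
  then show False using vz \<open>v x < 0\<close> by (simp add: zero_less_mult_iff)
qed

text \<open>Pigeonhole: \<open>Ad c\<close> has more elements than the residue field at
  \<open>v\<close>, so two polynomials agree there, and their difference vanishes at
  \<open>v\<close>.\<close>

lemma zero_of_polynomial:
  assumes v: "is_place v" "v T \<ge> 0" and c: "res_card v < q ^ c"
  shows "\<exists>y\<in>Ad c. y \<noteq> 0 \<and> v y > 0"
proof -
  have "\<exists>x\<in>Ad c. \<exists>y\<in>Ad c. x \<noteq> y \<and> x - y \<in> vball v 1"
  proof (rule ccontr)
    assume *: "\<not> ?thesis"
    have "card (Ad c) \<le> res_card v"
      unfolding res_card_def
    proof (rule card_le_idx[OF add_subgroup_vball[OF v(1)]])
      show "finite (quot (vball v 0) (vball v 1))" using fin_place[OF v(1)] by (simp add: fin_place_def)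
      show "Ad c \<subseteq> vball v 0" using Ad_place_nonneg[OF v] by (auto simp: vball_def)
    qed (use * in blast)
    then show False using c by (simp add: card_Ad)
  qed
  then obtain x y where "x \<in> Ad c" "y \<in> Ad c" "x \<noteq> y" "x - y \<in> vball v 1" by blast
  then show ?thesis by (intro bexI[of _ "x - y"] Ad_diff) (auto simp: vball_def vge_def)
qed

end

locale function_field_place = function_field F T n e
  for F :: "'k::field set" and T :: 'k and n :: nat and e :: "nat \<Rightarrow> 'k" +
  fixes pinf :: "'k \<Rightarrow> int"
  assumes pinf: "is_place pinf"
begin

text \<open>Nonzero elements without poles have value 0 everywhere by
  \<open>no_poles_imp_unit\<close>, so these elements inject into the residue field at
  \<open>pinf\<close>.\<close>

lemma finite_vset_zero: "finite (vset Places (\<lambda>_. 0))"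
proof -
  have g: "add_subgroup (vset Places (\<lambda>_. 0))" by (rule add_subgroup_vset) simp
  have "finite (quot (vset Places (\<lambda>_. 0)) {0})"
  proof (rule quot_inj_transfer(1)[OF add_subgroup_zero_set add_subgroup_vball[OF pinf, of 1], where f = "\<lambda>x. x"])
    show "x \<in> vball pinf 0" if "x \<in> vset Places (\<lambda>_. 0)" for x
      using that pinf by (auto simp: vset_def vball_def)
    show "x - y \<in> {0}" if "x \<in> vset Places (\<lambda>_. 0)" "y \<in> vset Places (\<lambda>_. 0)" "x - y \<in> vball pinf 1" for x y
    proof (rule ccontr)
      assume "x - y \<notin> {0}"
      then have "pinf (x - y) = 0" "x - y \<noteq> 0"
        using no_poles_imp_unit[OF add_subgroup_diff[OF g that(1,2)] _ pinf] by simp_all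
      then show False using that(3) by (simp add: vball_def vge_def)
    qed
    show "finite (quot (vball pinf 0) (vball pinf 1))" using fin_place[OF pinf] by (simp add: fin_place_def)
  qed
  then show ?thesis by (simp add: quot_zero)
qed

text \<open>Raising \<open>E\<close> to max E 0 shrinks the set into the finite set of elements
  without poles; \<open>rho_mono\<close> carries finiteness back to \<open>E\<close>.\<close>

lemma finite_vset:
  assumes "fin_supp E" shows "finite (vset Places E)"
proof -
  have "fin_supp (\<lambda>v. max (E v) 0)"
    using assms unfolding fin_supp_def by (rule rev_finite_subset) auto
  moreover have "vset Places (\<lambda>v. max (E v) 0) \<subseteq> vset Places (\<lambda>_. 0)" by (rule vset_mono) auto
  ultimately show ?thesis
    using rho_mono[OF assms, of "\<lambda>v. max (E v) 0"] finite_subset[OF _ finite_vset_zero] by auto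
qed

lemma card_vset_pos: "fin_supp E \<Longrightarrow> card (vset Places E) > 0"
  using finite_vset[of E] by (auto simp: card_gt_0_iff vset_def intro: exI[of _ 0])

lemma n_pos: "n > 0"
proof (rule ccontr)
  assume "\<not> n > 0"
  then show False using span[of 1] by auto
qed

lemma e_nonzero: "j < n \<Longrightarrow> e j \<noteq> 0"
proof
  assume j: "j < n" "e j = 0"
  have one: "1 \<in> (\<lambda>f. poly f T) ` polys_over F" "0 \<in> (\<lambda>f. poly f T) ` polys_over F"
    using Ad_iff Ad_one Ad_zero by blast+
  have "(\<Sum>i<n. (if i = j then 1 else 0) * e i) = (\<Sum>i<n. if i = j then e i else 0)"
    by (intro sum.cong) auto
  then have "(\<Sum>i<n. (if i = j then 1 else 0) * e i) = 0" using j by simp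
  then have "(if j = j then 1 else (0::'k)) = 0"
    by (rule indep[rotated]) (use one j in auto)
  then show False by simp
qed

text \<open>Let \<open>s\<close> be a denominator for the products of \<open>x\<close> with the
  basis. Where \<open>T\<close> is integral choose \<open>j\<close> with \<open>v (e j)\<close>
  minimal: s x e_j is a combination of the \<open>e l\<close> with integral coefficients, so its
  value is at least \<open>v (e j)\<close>. Here \<open>j\<close> depends on the place, but
  \<open>s\<close> does not.\<close>

lemma integral_multiple:
  "\<exists>s c. s \<noteq> 0 \<and> s \<in> Ad c \<and> (\<forall>v. is_place v \<longrightarrow> v T \<ge> 0 \<longrightarrow> vge v 0 (s * x))"
proof -
  obtain s D where s: "s \<noteq> 0" "s \<in> Ad (Suc D)" "(\<lambda>j. x * e j) ` {..<n} \<subseteq> W s D"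
    using common_denominator[of "(\<lambda>j. x * e j) ` {..<n}"] by auto
  have "vge v 0 (s * x)" if v: "is_place v" "v T \<ge> 0" for v
  proof -
    have "\<exists>j<n. \<forall>l<n. v (e j) \<le> v (e l)"
      using ex_is_arg_min_if_finite[of "{..<n}" "\<lambda>j. v (e j)"] n_pos
      by (auto simp: is_arg_min_linorder)
    then obtain j where j: "j < n" "\<And>l. l < n \<Longrightarrow> v (e j) \<le> v (e l)" by blast
    obtain b where b: "\<And>l. l < n \<Longrightarrow> b l \<in> Ad D" "s * (x * e j) = (\<Sum>l<n. b l * e l)"
      using s(3) j(1) by (auto simp: W_def)
    have "vge v (0 + v (e j)) (b l * e l)" if "l < n" for l
      using Ad_place_nonneg[OF v b(1)[OF that]] j(2)[OF that]
      by (intro vge_mult[OF v(1)]) (auto simp: vge_def)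
    then have "vge v (0 + v (e j)) (s * (x * e j))" unfolding b(2) by (intro vge_sum v) auto
    then have "vge v (0 + v (e j)) (e j * (s * x))" by (simp only: mult_ac)
    then show ?thesis using vge_scale[OF v(1) e_nonzero[OF j(1)]] by blast
  qed
  then show ?thesis using s by blast
qed

section \<open>The pole divisor of \<open>T\<close>\<close>

definition Dinf :: "('k \<Rightarrow> int) \<Rightarrow> int" where
  "Dinf v = max 0 (- v T)"

lemma fin_supp_Dinf: "fin_supp Dinf"
  using fin_supp_principal[OF T_nonzero] unfolding fin_supp_def
  by (rule rev_finite_subset) (auto simp: Dinf_def max_def)

lemma finite_poles_T: "finite {v. is_place v \<and> v T < 0}"
  by (rule finite_subset[OF _ finite_support[OF T_nonzero]]) auto

lemma div_norm_Dinf_eq_prod: "div_norm Dinf = (\<Prod>v | is_place v \<and> v T < 0. real (res_card v) powi (- v T))"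
proof -
  have "div_norm Dinf = (\<Prod>v | is_place v \<and> v T < 0. real (res_card v) powi Dinf v)"
    by (rule div_norm_eq[OF finite_poles_T]) (auto simp: Dinf_def)
  then show ?thesis by (simp add: Dinf_def)
qed

lemma div_norm_Dinf_le: "div_norm Dinf \<le> real q ^ n"
proof -
  have "div_norm Dinf = (\<Prod>v | is_place v \<and> v T < 0. real (res_card v ^ nat (v (inverse T))))"
    unfolding div_norm_Dinf_eq_prod by (intro prod.cong) (auto simp: power_int_def place_inverse)
  also have "\<dots> \<le> real (q ^ (n * 1))"
    unfolding of_nat_prod[symmetric] of_nat_le_iff using T_nonzero
    by (intro prod_res_card_le[OF finite_poles_T _ _ _ growth_inverse_T]) (auto simp: place_inverse)
  finally show ?thesis by simp
qed

text \<open>The combinations of the multiples s_j e_j, integral wherever \<open>T\<close> is, with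
  coefficients of degree below m - C are distinct, and their poles are at most m times those of
  \<open>T\<close>. The constant \<open>C\<close> reserves room for the poles of the s_j e_j
  themselves.\<close>

lemma card_vset_Dinf_ge:
  "\<exists>C. \<forall>m\<ge>C. q ^ (n * (m - C)) \<le> card (vset Places (\<lambda>v. - int m * Dinf v))"
proof -
  have "\<forall>j. \<exists>s c. s \<noteq> 0 \<and> s \<in> Ad c \<and> (\<forall>v. is_place v \<longrightarrow> v T \<ge> 0 \<longrightarrow> vge v 0 (s * e j))"
    using integral_multiple by blast
  then obtain s c where s: "\<And>j. s j \<noteq> 0" "\<And>j. s j \<in> Ad (c j)"
    "\<And>j v. is_place v \<Longrightarrow> v T \<ge> 0 \<Longrightarrow> vge v 0 (s j * e j)" by metis
  define f where "f j = s j * e j" for j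
  define P where "P = {v. is_place v \<and> v T < 0}"
  define C where "C = (\<Sum>v\<in>P. \<Sum>j<n. nat \<bar>v (f j)\<bar>)"
  have fC: "vge v (int C * v T) (f j)" if "v \<in> P" "j < n" for v j
  proof -
    have "nat \<bar>v (f j)\<bar> \<le> (\<Sum>j<n. nat \<bar>v (f j)\<bar>)"
      using that(2) by (intro member_le_sum) auto
    moreover have "(\<Sum>j<n. nat \<bar>v (f j)\<bar>) \<le> C"
      unfolding C_def using that(1) finite_poles_T
      by (intro member_le_sum[where f = "\<lambda>v. \<Sum>j<n. nat \<bar>v (f j)\<bar>"]) (auto simp: P_def)
    ultimately have "- int C \<le> v (f j)" by linarith
    moreover have "int C * v T \<le> int C * (- 1)" using that(1) by (intro mult_left_mono) (auto simp: P_def)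
    ultimately show ?thesis by (auto simp: vge_def)
  qed
  have "q ^ (n * (m - C)) \<le> card (vset Places (\<lambda>v. - int m * Dinf v))" if m: "m \<ge> C" for m
  proof -
    define S where "S = PiE {..<n} (\<lambda>_. Ad (m - C))"
    have cS: "card S = q ^ (n * (m - C))"
      by (simp add: S_def card_PiE card_Ad mult.commute flip: power_mult)
    have inj: "inj_on (\<lambda>a. \<Sum>j<n. a j * f j) S"
    proof (rule inj_onI)
      fix a b assume ab: "a \<in> S" "b \<in> S" "(\<Sum>j<n. a j * f j) = (\<Sum>j<n. b j * f j)"
      have "(\<Sum>j<n. ((a j - b j) * s j) * e j) = (\<Sum>j<n. a j * f j) - (\<Sum>j<n. b j * f j)"
        by (simp add: f_def sum_subtractf algebra_simps)
      then have eq: "(\<Sum>j<n. ((a j - b j) * s j) * e j) = 0" using ab by simp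
      have A: "(a j - b j) * s j \<in> (\<lambda>f. poly f T) ` polys_over F" if "j < n" for j
      proof -
        have "a j - b j \<in> Ad (m - C)" using ab that by (intro Ad_diff) (auto simp: S_def PiE_iff)
        then have "s j * (a j - b j) \<in> Ad (m - C + c j)"
          using Ad_mult[of _ _ "s j"] s(2)[of j] Ad_mono[of "c j" "Suc (c j)"] by auto
        then show ?thesis using Ad_iff by (metis mult.commute)
      qed
      have "(a j - b j) * s j = 0" if "j < n" for j
        by (rule indep[OF A eq that])
      then have "a j = b j" if "j < n" for j using s(1) that by auto
      then show "a = b" using ab by (intro PiE_ext[of a "{..<n}" "\<lambda>_. Ad (m - C)" b]) (auto simp: S_def)
    qed
    have sub: "(\<lambda>a. \<Sum>j<n. a j * f j) ` S \<subseteq> vset Places (\<lambda>v. - int m * Dinf v)"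
    proof clarify
      fix a assume a: "a \<in> S"
      have "vge v (- int m * Dinf v) (\<Sum>j<n. a j * f j)" if v: "is_place v" for v
      proof (rule vge_sum[OF v])
        fix j assume "j \<in> {..<n}"
        then have j: "j < n" "a j \<in> Ad (m - C)" using a by (auto simp: S_def PiE_iff)
        show "vge v (- int m * Dinf v) (a j * f j)"
        proof (cases "v T \<ge> 0")
          case True
          then have "vge v (0 + 0) (a j * f j)"
            using Ad_place_nonneg[OF v True j(2)] s(3)[OF v True] by (intro vge_mult v) (auto simp: f_def)
          then show ?thesis using True by (simp add: Dinf_def)
        next
          case False
          then have "vge v (int (m - C) * v T + int C * v T) (a j * f j)"
            using Ad_place_neg[OF v _ j(2)] fC[of v j] v j by (intro vge_mult v) (auto simp: P_def)
          moreover have "int (m - C) * v T + int C * v T = - int m * Dinf v"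
            using m False by (simp add: Dinf_def of_nat_diff algebra_simps)
          ultimately show ?thesis by simp
        qed
      qed
      then show "(\<Sum>j<n. a j * f j) \<in> vset Places (\<lambda>v. - int m * Dinf v)" by (simp add: vset_def)
    qed
    show ?thesis
      using card_inj_on_le[OF inj sub] finite_vset[OF fin_supp_scale[OF fin_supp_Dinf, of "- int m"]] cS by simp
  qed
  then show ?thesis by blast
qed

lemma rho_Dinf_bounds:
  "rho (\<lambda>v. - int m * Dinf v) * div_norm Dinf ^ m = real (card (vset Places (\<lambda>v. - int m * Dinf v)))"
proof -
  have "div_norm (\<lambda>v. - int m * Dinf v) = div_norm (\<lambda>v. - (int m * Dinf v))" by simp
  also have "\<dots> = inverse (div_norm Dinf ^ m)"
    using div_norm_uminus[OF fin_supp_scale[OF fin_supp_Dinf, of "int m"]] div_norm_scale[OF fin_supp_Dinf, of m] by simp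
  finally show ?thesis using div_norm_pos[of Dinf] by (simp add: rho_def)
qed

text \<open>For the lower bound, q^(n (m - C)) is at most the size of L(m Dinf), which is
  \<open>rho\<close> times the m-th power of the norm, and there \<open>rho\<close> is at most
  \<open>K\<close>, its value at the zero divisor. Taking m-th roots removes the factor q^(n C)
  K.\<close>

lemma div_norm_Dinf: "div_norm Dinf = real q ^ n"
proof (rule antisym[OF div_norm_Dinf_le])
  obtain C where C: "\<And>m. m \<ge> C \<Longrightarrow> q ^ (n * (m - C)) \<le> card (vset Places (\<lambda>v. - int m * Dinf v))"
    using card_vset_Dinf_ge by blast
  define K where "K = real (card (vset Places (\<lambda>_. 0)))"
  have D0: "rho (\<lambda>v. - int m * Dinf v) \<le> K" for m
    using rho_mono[OF fin_supp_scale[OF fin_supp_Dinf, of "- int m"] fin_supp_zero _ finite_vset_zero]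
    by (auto simp: rho_def div_norm_zero K_def Dinf_def)
  have nD: "div_norm Dinf \<ge> 1"
    unfolding div_norm_Dinf_eq_prod
  proof (rule prod_ge_1)
    fix v assume "v \<in> {v. is_place v \<and> v T < 0}"
    then have "is_place v" "- v T \<ge> 0" by simp_all
    then show "real (res_card v) powi (- v T) \<ge> 1"
      using res_card_ge_2[OF fin_place, of v] by (intro one_le_power_int) simp_all
  qed
  have q1: "real q \<ge> 1" using q_ge_2 by simp
  have "(real q ^ n) ^ m \<le> (real q ^ (n * C) * K) * div_norm Dinf ^ m" for m
  proof (cases "m \<ge> C")
    case True
    have "(real q ^ n) ^ m = real q ^ (n * C) * real (q ^ (n * (m - C)))"
      using True by (simp flip: power_mult power_add add: algebra_simps)
    also have "\<dots> \<le> real q ^ (n * C) * (rho (\<lambda>v. - int m * Dinf v) * div_norm Dinf ^ m)"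
      unfolding rho_Dinf_bounds using C[OF True] by (intro mult_left_mono) auto
    also have "\<dots> \<le> real q ^ (n * C) * (K * div_norm Dinf ^ m)"
      using D0[of m] div_norm_pos[of Dinf] by (intro mult_left_mono mult_right_mono) auto
    finally show ?thesis by (simp add: mult_ac)
  next
    \<comment> \<open>Below \<open>C\<close> the factor q^(n C) alone suffices, as \<open>K\<close>
      and the norm are at least 1.\<close>
    case False
    have "(real q ^ n) ^ m = real q ^ (n * m)" by (simp add: power_mult)
    also have "\<dots> \<le> real q ^ (n * C)" using False q1 by (intro power_increasing) auto
    also have "\<dots> \<le> real q ^ (n * C) * (K * div_norm Dinf ^ m)"
    proof -
      have "K \<ge> 1" using card_vset_pos[OF fin_supp_zero] by (simp add: K_def)
      moreover have "div_norm Dinf ^ m \<ge> 1" using nD by (rule one_le_power)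
      ultimately have "K * div_norm Dinf ^ m \<ge> 1" by (metis mult_mono' mult_1 order_refl zero_le_one)
      then show ?thesis using q1 by (simp add: mult_le_cancel_left1)
    qed
    finally show ?thesis by (simp add: mult_ac)
  qed
  then show "real q ^ n \<le> div_norm Dinf" by (rule le_of_power_le) (rule div_norm_pos)
qed


text \<open>Dividing the count q^(n (m - C)) by the m-th power of the norm q^n leaves q^(-n C),
  which no longer depends on \<open>m\<close>.\<close>

lemma rho_Dinf_ge:
  "\<exists>C c. c > 0 \<and> (\<forall>m\<ge>C. c \<le> rho (\<lambda>v. - int m * Dinf v))"
proof -
  obtain C where C: "\<And>m. m \<ge> C \<Longrightarrow> q ^ (n * (m - C)) \<le> card (vset Places (\<lambda>v. - int m * Dinf v))"
    using card_vset_Dinf_ge by blast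
  have q: "real q > 0" using q_ge_2 by simp
  have "inverse (real q ^ (n * C)) \<le> rho (\<lambda>v. - int m * Dinf v)" if m: "m \<ge> C" for m
  proof -
    have "real q ^ (n * (m - C)) \<le> rho (\<lambda>v. - int m * Dinf v) * real q ^ (n * m)"
      using C[OF m] rho_Dinf_bounds[of m] by (simp add: div_norm_Dinf flip: power_mult of_nat_power)
    moreover have "real q ^ (n * m) = real q ^ (n * (m - C)) * real q ^ (n * C)"
      using m by (simp flip: power_add add: algebra_simps)
    ultimately have "real q ^ (n * (m - C)) * 1 \<le>
      real q ^ (n * (m - C)) * (rho (\<lambda>v. - int m * Dinf v) * real q ^ (n * C))" by (simp add: mult_ac)
    then have "1 \<le> rho (\<lambda>v. - int m * Dinf v) * real q ^ (n * C)"
      using q by (simp only: mult_le_cancel_left_pos zero_less_power)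
    then show ?thesis using q by (simp add: field_simps)
  qed
  then show ?thesis using q by (intro exI[of _ C] exI[of _ "inverse (real q ^ (n * C))"]) simp
qed

lemma card_vset_principal:
  assumes "x \<noteq> 0" shows "card (vset Places (\<lambda>v. E v + v x)) = card (vset Places E)"
proof -
  have "vset Places (\<lambda>v. E v + v x) = (*) x ` vset Places E"
    using vset_scale[of Places x E] assms by simp
  then show ?thesis using assms by (simp add: card_image inj_on_def)
qed

text \<open>Half of a product formula. The poles contribute the inverse D-th power of the norm of
  \<open>Dinf\<close>, that is q^(-n D), and counting with \<open>growth_Ad\<close> bounds the
  contribution of the zeros by q^(n D). Here it is the lower bound in \<open>div_norm_Dinf\<close>
  that counts.\<close>

lemma div_norm_polynomial_le_1:
  assumes y: "y \<noteq> 0" "y \<in> Ad (Suc D)" and deg: "\<And>v. is_place v \<Longrightarrow> v T < 0 \<Longrightarrow> v y = int D * v T"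
  shows "div_norm (\<lambda>v. v y) \<le> 1"
proof -
  define P Z where "P = {v. is_place v \<and> v T < 0}" and "Z = {v. is_place v \<and> v T \<ge> 0 \<and> v y > 0}"
  have fin: "finite P" "finite Z"
    unfolding P_def Z_def
    by (rule finite_poles_T, rule finite_subset[OF _ finite_support[OF y(1)]]) auto
  have disj: "P \<inter> Z = {}" by (auto simp: P_def Z_def)
  have "div_norm (\<lambda>v. v y) = (\<Prod>v\<in>P \<union> Z. real (res_card v) powi v y)"
  proof (rule div_norm_eq)
    show "finite (P \<union> Z)" using fin by simp
    show "P \<union> Z \<subseteq> Places" by (auto simp: P_def Z_def)
    fix v assume "is_place v" "v \<notin> P \<union> Z"
    then show "v y = 0" using Ad_place_nonneg[of v y "Suc D"] y by (auto simp: P_def Z_def vge_def)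
  qed
  also have "\<dots> = (\<Prod>v\<in>P. real (res_card v) powi v y) * (\<Prod>v\<in>Z. real (res_card v) powi v y)"
    by (rule prod.union_disjoint[OF fin disj])
  also have "(\<Prod>v\<in>P. real (res_card v) powi v y) = (\<Prod>v\<in>P. inverse ((real (res_card v) powi (- v T)) ^ D))"
  proof (rule prod.cong)
    fix v assume "v \<in> P"
    then have "v y = - (- v T * int D)" using deg[of v] by (simp add: P_def mult.commute)
    then show "real (res_card v) powi v y = inverse ((real (res_card v) powi (- v T)) ^ D)"
      by (simp only: power_int_minus power_int_mult power_int_of_nat)
  qed simp
  also have "\<dots> = inverse ((real q ^ n) ^ D)"
  proof -
    have "real q ^ n = (\<Prod>v\<in>P. real (res_card v) powi (- v T))"
      using div_norm_Dinf div_norm_Dinf_eq_prod by (simp add: P_def)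
    then show ?thesis
      using prod_inversef[of "\<lambda>v. (real (res_card v) powi (- v T)) ^ D" P]
      by (simp add: comp_def prod_power_distrib)
  qed
  also have "(\<Prod>v\<in>Z. real (res_card v) powi v y) = real (\<Prod>v\<in>Z. res_card v ^ nat (v y))"
    unfolding of_nat_prod by (intro prod.cong) (auto simp: Z_def power_int_def)
  also have "inverse ((real q ^ n) ^ D) * real (\<Prod>v\<in>Z. res_card v ^ nat (v y)) \<le> inverse ((real q ^ n) ^ D) * real (q ^ (n * D))"
    using prod_res_card_le[OF fin(2) _ y(1) _ growth_Ad[OF y(2)]]
    by (intro mult_left_mono of_nat_mono) (auto simp: Z_def)
  also have "\<dots> = 1" using q_ge_2 by (simp flip: power_mult)
  finally show ?thesis .
qed

text \<open>At each of the finitely many places where \<open>T\<close> is integral and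
  \<open>E\<close> negative, \<open>zero_of_polynomial\<close> gives a polynomial vanishing there;
  \<open>y\<close> is the product of their powers with exponents -E v.\<close>

lemma polynomial_vanishing:
  assumes "fin_supp E"
  shows "\<exists>y D. y \<noteq> 0 \<and> y \<in> Ad (Suc D) \<and> (\<forall>v. is_place v \<longrightarrow> v T < 0 \<longrightarrow> v y = int D * v T) \<and>
    (\<forall>v. is_place v \<longrightarrow> v T \<ge> 0 \<longrightarrow> E v + v y \<ge> 0)"
proof -
  define G where "G = {v. is_place v \<and> v T \<ge> 0 \<and> E v < 0}"
  have G: "finite G" using assms unfolding fin_supp_def G_def by (rule rev_finite_subset) auto
  have "\<exists>c. \<exists>y\<in>Ad c. y \<noteq> 0 \<and> v y > 0" if "v \<in> G" for v
  \<comment> \<open>Any \<open>c\<close> with q^c above \<open>res_card v\<close> would do; r < 2^r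
    provides one.\<close>
  proof (rule exI[of _ "res_card v"], rule zero_of_polynomial)
    show "is_place v" "v T \<ge> 0" using that by (auto simp: G_def)
    have "res_card v < 2 ^ res_card v" by (rule less_exp)
    also have "\<dots> \<le> q ^ res_card v" using q_ge_2 by (intro power_mono) auto
    finally show "res_card v < q ^ res_card v" .
  qed
  then obtain c z where z: "\<And>v. v \<in> G \<Longrightarrow> z v \<in> Ad (c v)" "\<And>v. v \<in> G \<Longrightarrow> z v \<noteq> 0"
    "\<And>v. v \<in> G \<Longrightarrow> v (z v) > 0" by metis
  have "\<forall>v\<in>G. \<exists>f. f \<in> polys_over F \<and> z v = poly f T"
    using z(1) Ad_iff by blast
  then obtain f where f: "\<And>v. v \<in> G \<Longrightarrow> f v \<in> polys_over F" "\<And>v. v \<in> G \<Longrightarrow> z v = poly (f v) T"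
    by metis
  define g where "g = (\<Prod>v\<in>G. f v ^ nat (- E v))"
  define y where "y = poly g T"
  have pow: "h ^ i \<in> polys_over F" if "h \<in> polys_over F" for h i
    using that by (induction i) (auto intro: polys_over_one polys_over_mult F)
  have g: "g \<in> polys_over F"
  proof -
    have "(\<Prod>v\<in>H. f v ^ nat (- E v)) \<in> polys_over F" if "H \<subseteq> G" for H
      using finite_subset[OF that G] that
      by (induction H) (auto intro!: polys_over_one polys_over_mult F pow f(1))
    then show ?thesis by (simp add: g_def)
  qed
  have y: "y = (\<Prod>v\<in>G. z v ^ nat (- E v))" using f(2) by (simp add: y_def g_def poly_prod)
  then have y0: "y \<noteq> 0" using z(2) G by simp
  then have g0: "g \<noteq> 0" by (auto simp: y_def)
  have "y \<in> Ad (Suc (Polynomial.degree g))"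
    using g by (intro Ad_I[of g]) (auto simp: polys_lt_def y_def coeff_eq_0)
  moreover have "v y = int (Polynomial.degree g) * v T" if "is_place v" "v T < 0" for v
    unfolding y_def by (rule place_poly_neg(2)[OF that g g0])
  moreover have "E v + v y \<ge> 0" if v: "is_place v" "v T \<ge> 0" for v
  proof -
    have vy: "v y = (\<Sum>w\<in>G. int (nat (- E w)) * v (z w))"
      unfolding y using z(2) by (subst place_prod[OF v(1)]) (auto simp: place_power[OF v(1)])
    have nn: "int (nat (- E w)) * v (z w) \<ge> 0" if "w \<in> G" for w
      using Ad_place_nonneg[OF v z(1)[OF that]] z(2)[OF that] by (auto simp: vge_def)
    show ?thesis
    proof (cases "v \<in> G")
      case True
      have "int (nat (- E v)) * 1 \<le> int (nat (- E v)) * v (z v)"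
        using z(3)[OF True] by (intro mult_left_mono) auto
      moreover have "int (nat (- E v)) * v (z v) \<le> v y" unfolding vy
        by (rule member_le_sum[OF True nn G]) simp
      ultimately show ?thesis by linarith
    next
      case False
      then have "E v \<ge> 0" using v by (auto simp: G_def)
      moreover have "v y \<ge> 0" unfolding vy by (rule sum_nonneg[OF nn])
      ultimately show ?thesis by simp
    qed
  qed
  ultimately show ?thesis using y0 by blast
qed

text \<open>Multiplication by a polynomial \<open>y\<close> preserves the cardinality and multiplies
  the norm by at most 1, so \<open>rho\<close> does not grow. It moves \<open>E\<close> to a divisor
  that is nonnegative away from the poles of \<open>T\<close>, hence lies above -m Dinf for large
  \<open>m\<close>, where \<open>rho_Dinf_ge\<close> and \<open>rho_mono\<close> apply.\<close>

lemma riemann_inequality: "\<exists>c>0. \<forall>E. fin_supp E \<longrightarrow> c \<le> rho E"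
proof -
  obtain C c where c: "c > 0" "\<And>m. m \<ge> C \<Longrightarrow> c \<le> rho (\<lambda>v. - int m * Dinf v)"
    using rho_Dinf_ge by blast
  have "c \<le> rho E" if E: "fin_supp E" for E
  proof -
    obtain y D where y: "y \<noteq> 0" "y \<in> Ad (Suc D)"
      "\<And>v. is_place v \<Longrightarrow> v T < 0 \<Longrightarrow> v y = int D * v T"
      "\<And>v. is_place v \<Longrightarrow> v T \<ge> 0 \<Longrightarrow> E v + v y \<ge> 0"
      using polynomial_vanishing[OF E] by blast
    define P where "P = {v. is_place v \<and> v T < 0}"
    \<comment> \<open>Large enough for \<open>rho_Dinf_ge\<close> and to absorb, at the poles of
      \<open>T\<close>, both the pole of \<open>y\<close> and the size of \<open>E\<close>.\<close>
    define m where "m = C + D + (\<Sum>v\<in>P. nat \<bar>E v\<bar>)"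
    define E2 where "E2 = (\<lambda>v. E v + v y)"
    have E2: "fin_supp E2" unfolding E2_def by (rule fin_supp_add[OF E fin_supp_principal[OF y(1)]])
    have "c \<le> rho (\<lambda>v. - int m * Dinf v)" by (rule c(2)) (simp add: m_def)
    also have "\<dots> \<le> rho E2"
    proof -
      have "- int m * Dinf v \<le> E2 v" if v: "is_place v" for v
      proof (cases "v T \<ge> 0")
        case True
        then show ?thesis using y(4)[OF v] by (simp add: Dinf_def E2_def)
      next
        case False
        have "nat \<bar>E v\<bar> \<le> (\<Sum>v\<in>P. nat \<bar>E v\<bar>)"
          using v False finite_poles_T by (intro member_le_sum) (auto simp: P_def)
        then have "D + nat \<bar>E v\<bar> \<le> m" by (simp add: m_def)
        then have "int (D + nat \<bar>E v\<bar>) * v T \<ge> int m * v T"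
          using False by (intro mult_right_mono_neg of_nat_mono) auto
        moreover have "int (nat \<bar>E v\<bar>) * v T \<le> int (nat \<bar>E v\<bar>) * (- 1)"
          using False by (intro mult_left_mono) auto
        ultimately show ?thesis using False y(3)[OF v] by (simp add: Dinf_def E2_def algebra_simps)
      qed
      then show ?thesis
        using rho_mono[OF fin_supp_scale[OF fin_supp_Dinf, of "- int m"] E2 _ finite_vset[OF E2]] by blast
    qed
    also have "rho E2 = rho E * div_norm (\<lambda>v. v y)"
      unfolding rho_def E2_def
      using card_vset_principal[OF y(1)] div_norm_add[OF E fin_supp_principal[OF y(1)]] by simp
    also have "\<dots> \<le> rho E * 1"
      using div_norm_polynomial_le_1[OF y(1-3)] div_norm_pos[of E] by (intro mult_left_mono) (auto simp: rho_def)
    finally show ?thesis by simp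
  qed
  then show ?thesis using c(1) by blast
qed

section \<open>Strong approximation\<close>

definition S :: "('k \<Rightarrow> int) set" where
  "S = Places - {pinf}"

text \<open>Fix \<open>E\<^sub>0\<close> whose \<open>rho\<close> is less than twice the infimum. Below \<open>E\<^sub>0\<close> every step of \<open>rho\<close>, being a
  quotient of integers dividing \<open>res_card v\<close>, is trivial, so residues are attained; every \<open>E\<close> is moved
  below \<open>E\<^sub>0\<close> by lowering it at \<open>pinf\<close> and multiplying by an element given by Riemann's inequality.\<close>

lemma strong_approximation_step:
  assumes E: "fin_supp E" and v: "v \<in> S" and a: "vge v (E v) a"
  shows "\<exists>x\<in>vset S E. vge v (E v + 1) (x - a)"
proof -
  have pv: "is_place v" "v \<noteq> pinf" using v by (auto simp: S_def)
  obtain c where c: "c > 0" "\<And>E. fin_supp E \<Longrightarrow> c \<le> rho E" using riemann_inequality by blast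
  define \<mu> where "\<mu> = Inf (rho ` {E. fin_supp E})"
  have bdd: "bdd_below (rho ` {E. fin_supp E})" using c(2) by (intro bdd_belowI2[of _ c]) simp
  have ne: "rho ` {E. fin_supp E} \<noteq> {}" using fin_supp_zero by blast
  have "c \<le> \<mu>" unfolding \<mu>_def using c(2) by (intro cInf_greatest[OF ne]) auto
  then have "\<mu> < 2 * \<mu>" using c(1) by simp
  then obtain E0 where E0: "fin_supp E0" "rho E0 < 2 * \<mu>"
    using cInf_lessD[OF ne, of "2 * \<mu>"] unfolding \<mu>_def by auto
  have E0': "rho E0 < 2 * rho E" if "fin_supp E" for E
    using cInf_lower[OF _ bdd, of "rho E"] that E0(2) unfolding \<mu>_def by auto
  \<comment> \<open>Lowering at \<open>pinf\<close> is free, since the claim concerns only places in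
    \<open>S\<close>.\<close>
  define Er where "Er r = E(pinf := E pinf + - int r)" for r
  \<comment> \<open>A nonzero \<open>z\<close> in the space of \<open>G r\<close> is one for which
    subtracting its divisor from \<open>Er r\<close>, raised by one at \<open>v\<close>, leads below
    \<open>E0\<close>.\<close>
  define G where "G r = (\<lambda>w. ((Er r)(v := Er r v + 1)) w + - 1 * E0 w)" for r
  have fsEr: "fin_supp (Er r)" for r unfolding Er_def by (rule fin_supp_upd[OF E])
  have fsG: "fin_supp (G r)" for r
    unfolding G_def by (rule fin_supp_add[OF fin_supp_upd[OF fsEr] fin_supp_scale[OF E0(1)]])
  have nrmG: "div_norm (G r) = div_norm (G 0) * inverse (real (res_card pinf) ^ r)" for r
  proof -
    have "G r = (G 0)(pinf := G 0 pinf + - int r)"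
    proof
      fix w show "G r w = ((G 0)(pinf := G 0 pinf + - int r)) w"
        using pv(2) by (cases "w = pinf") (simp_all add: G_def Er_def)
    qed
    then show ?thesis using div_norm_upd[OF fsG pinf, of 0 "- int r"] by (simp add: power_int_minus)
  qed
  have "real (res_card pinf) > 1" using res_card_ge_2[OF fin_place[OF pinf]] by simp
  then obtain r where r: "div_norm (G 0) / c < real (res_card pinf) ^ r" using real_arch_pow by blast
  \<comment> \<open>The norm has been pushed below \<open>c\<close>, so Riemann's inequality leaves
    room for a nonzero element.\<close>
  have "card (vset Places (G r)) > 1"
  proof -
    have "div_norm (G 0) < c * real (res_card pinf) ^ r" using r c(1) by (simp add: field_simps)
    then have "div_norm (G r) < c"
      unfolding nrmG[of r] using res_card_pos[OF pinf] by (simp add: field_simps)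
    also have "c \<le> real (card (vset Places (G r))) * div_norm (G r)" using c(2)[OF fsG] by (simp add: rho_def)
    finally show ?thesis using div_norm_pos[of "G r"] by simp
  qed
  then obtain z where z: "z \<in> vset Places (G r)" "z \<noteq> 0"
    by (metis card_1_singleton_iff card_mono empty_iff finite.emptyI finite.insertI insert_iff is_singletonI is_singleton_altdef not_less subsetI)
  define E' where "E' = (\<lambda>w. Er r w + w (inverse z))"
  have fsE': "fin_supp E'" unfolding E'_def using z(2) by (intro fin_supp_add fsEr fin_supp_principal) simp
  define E'' where "E'' = E'(v := E' v + 1)"
  have fsE'': "fin_supp E''" unfolding E''_def by (rule fin_supp_upd[OF fsE'])
  have "E'' w \<le> E0 w" if "is_place w" for w
    using z that by (auto simp: vset_def vge_def G_def E''_def E'_def place_inverse)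
  then have "rho E'' \<le> rho E0" using rho_mono[OF fsE'' E0(1) _ finite_vset[OF E0(1)]] by blast
  also have "\<dots> < 2 * rho E'" by (rule E0'[OF fsE'])
  finally have lt: "rho E'' < 2 * rho E'" .
  define i where "i = idx (vset Places E') (vset Places E'')"
  note step = vset_Places_step[OF pv(1), of E', folded E''_def, OF finite_vset[OF fsE''], folded i_def]
  have "rho E' * real (res_card v) = real i * rho E''"
    using rho_step[OF pv(1), of E', folded E''_def, OF finite_vset[OF fsE''] fsE'] by (simp add: i_def)
  also have "\<dots> \<le> real i * (2 * rho E')" using lt by (intro mult_left_mono) auto
  finally have "rho E' * real (res_card v) \<le> rho E' * (2 * real i)" by (simp add: mult_ac)
  moreover have "rho E' > 0" using c(1) c(2)[OF fsE'] by simp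
  ultimately have le: "res_card v \<le> 2 * i" by simp
  \<comment> \<open>A proper divisor of \<open>res_card v\<close> is at most half of it, so by
    \<open>le\<close> it would be exactly half; then \<open>rho_step\<close> would contradict the
    strictness of \<open>lt\<close>.\<close>
  have "i = res_card v"
  proof (rule ccontr)
    assume ne: "i \<noteq> res_card v"
    obtain j where j: "res_card v = i * j" using step(4) by (rule dvdE)
    have "i > 0" using j res_card_pos[OF pv(1)] by (cases "i = 0") auto
    then have "j = 2" using j le ne by (cases "j = 0"; cases "j = 1") (use res_card_pos[OF pv(1)] in auto)
    then have "rho E' * real (res_card v) = rho E' * (2 * real i)" using j by simp
    moreover have "real i * rho E'' < real i * (2 * rho E')" using lt \<open>i > 0\<close> by simp
    moreover have "real i * (2 * rho E') = rho E' * (2 * real i)" by simp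
    ultimately show False
      using \<open>rho E' * real (res_card v) = real i * rho E''\<close> by linarith
  qed
  then have full: "\<forall>a. vge v (E' v) a \<longrightarrow> (\<exists>x\<in>vset Places E'. vge v (E' v + 1) (x - a))"
    using vset_step(3)[of Places v E', OF _ fin_place[OF pv(1)]] pv(1) by (simp add: i_def E''_def)
  \<comment> \<open>Multiplication by \<open>z\<close> undoes the shift by its divisor, and away
    from \<open>pinf\<close> the exponents \<open>Er r\<close> and \<open>E\<close> agree.\<close>
  have E'v: "E' v = E v + v (inverse z)" using pv by (simp add: E'_def Er_def)
  have iz: "inverse z \<noteq> 0" using z by simp
  have "vge v (E' v) (inverse z * a)" using vge_scale[OF pv(1) iz, of "E v" a] a E'v by simp
  then obtain x where x: "x \<in> vset Places E'" "vge v (E' v + 1) (x - inverse z * a)" using full by blast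
  have zx: "inverse z * (z * x) = x" using z(2) by (simp add: mult.assoc[symmetric])
  have "x - inverse z * a = inverse z * (z * x - a)" by (simp only: right_diff_distrib zx)
  moreover have "E' v + 1 = (E v + 1) + v (inverse z)" by (simp add: E'v)
  ultimately have "vge v ((E v + 1) + v (inverse z)) (inverse z * (z * x - a))" using x(2) by (simp only:)
  then have "vge v (E v + 1) (z * x - a)" by (rule vge_scale[OF pv(1) iz, THEN iffD1])
  moreover have "z * x \<in> vset S E"
  proof -
    have "vge w (E w) (z * x)" if "w \<in> S" for w
    proof -
      have w: "is_place w" "w \<noteq> pinf" using that by (auto simp: S_def)
      have "vge w (E' w) x" using x(1) w(1) unfolding vset_def by blast
      moreover have "E' w = E w + w (inverse z)" using w(2) by (simp add: E'_def Er_def)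
      ultimately have "vge w (E w + w (inverse z)) x" by simp
      then have "vge w (E w + w (inverse z)) (inverse z * (z * x))" by (simp only: zx)
      then show ?thesis by (rule vge_scale[OF w(1) iz, THEN iffD1])
    qed
    then show ?thesis by (simp add: vset_def)
  qed
  ultimately show ?thesis by blast
qed

text \<open>Successive approximation: the error, of value at least E v + m, is approximated from the
  set with exponent raised to E v + m at \<open>v\<close>. This gains one without leaving
  \<open>vset S E\<close>.\<close>

lemma strong_approximation:
  assumes E: "fin_supp E" and v: "v \<in> S" and a: "vge v (E v) a"
  shows "\<exists>x\<in>vset S E. vge v (E v + int m) (x - a)"
proof (induction m)
  case 0
  have "0 \<in> vset S E" by (simp add: vset_def)
  moreover have "vge v (E v) (0 - a)" using a v by (simp add: vge_uminus S_def)
  ultimately show ?case by (intro bexI[of _ 0]) simp_all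
next
  case (Suc m)
  then obtain x where x: "x \<in> vset S E" "vge v (E v + int m) (x - a)" by blast
  define E' where "E' = E(v := E v + int m)"
  have pv: "is_place v" using v by (simp add: S_def)
  have "vge v (E' v) (a - x)" using x(2) vge_uminus[OF pv, of _ "x - a"] by (simp add: E'_def)
  then obtain y where y: "y \<in> vset S E'" "vge v (E' v + 1) (y - (a - x))"
    using strong_approximation_step[OF fin_supp_upd[OF E] v] unfolding E'_def by blast
  have "vset S E' \<subseteq> vset S E" by (rule vset_mono) (simp add: E'_def)
  then have "x + y \<in> vset S E"
    using x(1) y(1) by (intro add_subgroup_add[OF add_subgroup_vset]) (auto simp: S_def)
  moreover have "vge v (E v + int (Suc m)) (x + y - a)"
    using y(2) by (simp add: E'_def algebra_simps)
  ultimately show ?case by blast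
qed

end

section \<open>Euler products\<close>

text \<open>Exponent vectors of formal factorisations; with \<open>A\<close> the places other than
  \<open>pinf\<close> they will label the nonzero ideals.\<close>

definition fin_fun :: "'i set \<Rightarrow> ('i \<Rightarrow> nat) set" where
  "fin_fun A = {m. finite {v. m v \<noteq> 0} \<and> (\<forall>v. v \<notin> A \<longrightarrow> m v = 0)}"

definition monomial :: "('i \<Rightarrow> real) \<Rightarrow> ('i \<Rightarrow> nat) \<Rightarrow> real" where
  "monomial x m = (\<Prod>v | m v \<noteq> 0. x v ^ m v)"

lemma fin_funD: "m \<in> fin_fun A \<Longrightarrow> finite {v. m v \<noteq> 0}" "m \<in> fin_fun A \<Longrightarrow> m v \<noteq> 0 \<Longrightarrow> v \<in> A"
  unfolding fin_fun_def by (simp, cases "v \<in> A", simp_all)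

lemma monomial_eq:
  assumes "finite G" "\<And>v. v \<notin> G \<Longrightarrow> m v = 0"
  shows "monomial x m = (\<Prod>v\<in>G. x v ^ m v)"
  unfolding monomial_def
proof (rule prod.mono_neutral_left)
  show "{v. m v \<noteq> 0} \<subseteq> G"
  proof
    fix v assume "v \<in> {v. m v \<noteq> 0}"
    then show "v \<in> G" using assms(2)[of v] by (cases "v \<in> G") simp_all
  qed
qed (use assms(1) in simp_all)

text \<open>A new place \<open>v\<close> multiplies the sum by a geometric series: a vector on
  \<open>insert v G\<close> amounts to its exponent at \<open>v\<close> together with a vector on
  \<open>G\<close>.\<close>

lemma has_sum_monomial_finite:
  assumes "finite G" "\<And>v. v \<in> G \<Longrightarrow> 0 \<le> x v" "\<And>v. v \<in> G \<Longrightarrow> x v < (1::real)"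
  shows "(monomial x has_sum (\<Prod>v\<in>G. 1 / (1 - x v))) (fin_fun G)"
  using assms
proof (induction G)
  case empty
  have "fin_fun {} = {\<lambda>_::'a. 0}" by (auto simp: fin_fun_def)
  moreover have "monomial x (\<lambda>_. 0) = 1" by (simp add: monomial_def)
  ultimately show ?case using has_sum_finite[of "{\<lambda>_::'a. 0}" "monomial x"] by simp
next
  case (insert v G)
  define P where "P = (\<Prod>v\<in>G. 1 / (1 - x v))"
  have IH: "(monomial x has_sum P) (fin_fun G)" using insert by (simp add: P_def)
  have mem: "m w = 0" if "m \<in> fin_fun G" "w \<notin> G" for m w using that by (simp add: fin_fun_def)
  define f where "f = (\<lambda>(i :: nat, m). x v ^ i * monomial x m)"
  have row: "((\<lambda>m. f (i, m)) has_sum (x v ^ i * P)) (fin_fun G)" for i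
    unfolding f_def using has_sum_cmult_right[OF IH, of "x v ^ i"] by simp
  have "(\<lambda>i. x v ^ i) sums (1 / (1 - x v))" using insert.prems by (intro geometric_sums) auto
  then have "((\<lambda>i. x v ^ i) has_sum (1 / (1 - x v))) UNIV"
    using insert.prems by (intro sums_nonneg_imp_has_sum) auto
  from has_sum_cmult_left[OF this, of P]
  have col: "((\<lambda>i. x v ^ i * P) has_sum (1 / (1 - x v) * P)) UNIV" .
  have nonneg: "f (i, m) \<ge> 0" if "m \<in> fin_fun G" for i m
    unfolding f_def using insert.prems monomial_eq[of G m x, OF insert.hyps(1) mem[OF that]]
    by (auto intro!: mult_nonneg_nonneg prod_nonneg)
  have "(f has_sum (1 / (1 - x v) * P)) (UNIV \<times> fin_fun G)"
    by (rule has_sum_SigmaI[OF row col], rule summable_on_SigmaI[OF row])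
      (use col nonneg in \<open>auto simp: summable_on_def\<close>)
  also have "?this \<longleftrightarrow> (monomial x has_sum (1 / (1 - x v) * P)) (fin_fun (insert v G))"
  proof (rule has_sum_reindex_bij_witness[where i = "\<lambda>m. (m v, m(v := 0))" and j = "\<lambda>(i, m). m(v := i)"])
    fix a :: "nat \<times> ('a \<Rightarrow> nat)" assume "a \<in> UNIV \<times> fin_fun G"
    then obtain i m where a: "a = (i, m)" "m \<in> fin_fun G" by auto
    have mv: "m v = 0" using mem[OF a(2)] insert.hyps by simp
    then have m0: "m(v := 0) = m" by auto
    show "(\<lambda>m. (m v, m(v := 0))) (case a of (i, m) \<Rightarrow> m(v := i)) = a"
      using a m0 by simp
    have "{w. (m(v := i)) w \<noteq> 0} \<subseteq> insert v {w. m w \<noteq> 0}" by auto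
    moreover have "finite {w. m w \<noteq> 0}" using a(2) by (simp add: fin_fun_def)
    ultimately have "finite {w. (m(v := i)) w \<noteq> 0}" by (meson finite_insert finite_subset)
    then show "(case a of (i, m) \<Rightarrow> m(v := i)) \<in> fin_fun (insert v G)"
      using a mem[OF a(2)] by (auto simp: fin_fun_def)
    have "monomial x (m(v := i)) = (\<Prod>w\<in>insert v G. x w ^ (m(v := i)) w)"
      using insert.hyps mem[OF a(2)] by (intro monomial_eq) auto
    also have "\<dots> = x v ^ i * (\<Prod>w\<in>G. x w ^ m w)"
      using insert.hyps by (simp, intro disjI2 prod.cong) auto
    also have "(\<Prod>w\<in>G. x w ^ m w) = monomial x m"
      by (rule monomial_eq[symmetric, OF insert.hyps(1) mem[OF a(2)]])
    finally show "monomial x (case a of (i, m) \<Rightarrow> m(v := i)) = f a"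
      unfolding a(1) f_def prod.case .
  next
    fix m assume m: "m \<in> fin_fun (insert v G)"
    show "(case (m v, m(v := 0)) of (i, m) \<Rightarrow> m(v := i)) = m" by simp
    have "{w. (m(v := 0)) w \<noteq> 0} \<subseteq> {w. m w \<noteq> 0}" by auto
    then have "finite {w. (m(v := 0)) w \<noteq> 0}" using m by (auto simp: fin_fun_def elim: finite_subset[rotated])
    then show "(m v, m(v := 0)) \<in> UNIV \<times> fin_fun G" using m by (auto simp: fin_fun_def)
  qed simp
  finally show ?case using insert.hyps by (simp add: P_def)
qed

text \<open>For x between 0 and 1/2 the factor 1 / (1 - x) is at most 1 + 2 x, hence at most exp (2
  x), so the finite products are bounded. A finite partial sum is below each product over a finite
  set containing the supports, and every finite product is below the full sum; this squeezes the
  limit.\<close>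

lemma euler_product:
  fixes x :: "'i \<Rightarrow> real"
  assumes x: "\<And>v. v \<in> A \<Longrightarrow> 0 \<le> x v" "\<And>v. v \<in> A \<Longrightarrow> x v \<le> 1 / 2" and sum: "x summable_on A"
  shows "monomial x summable_on fin_fun A"
    and "((\<lambda>G. \<Prod>v\<in>G. 1 / (1 - x v)) \<longlongrightarrow> infsum (monomial x) (fin_fun A)) (finite_subsets_at_top A)"
proof -
  define p where "p G = (\<Prod>v\<in>G. 1 / (1 - x v))" for G
  have x1: "x v < 1" if "v \<in> A" for v using x(2)[OF that] by simp
  have fin_sum: "(monomial x has_sum p G) (fin_fun G)" if "finite G" "G \<subseteq> A" for G
    unfolding p_def using that x(1) x1 by (intro has_sum_monomial_finite) auto
  have nonneg: "monomial x m \<ge> 0" if "m \<in> fin_fun A" for m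
    unfolding monomial_def
  proof (intro prod_nonneg zero_le_power)
    fix v assume "v \<in> {v. m v \<noteq> 0}"
    then have "v \<in> A" using fin_funD(2)[OF that] by simp
    then show "0 \<le> x v" by (rule x(1))
  qed
  have sub: "fin_fun G \<subseteq> fin_fun H" if "G \<subseteq> H" for G H :: "'i set" using that by (auto simp: fin_fun_def)
  have p_le: "p G \<le> exp (2 * infsum x A)" if G: "finite G" "G \<subseteq> A" for G
  proof -
    have "1 / (1 - x v) \<le> exp (2 * x v)" if "v \<in> G" for v
    proof -
      have v: "0 \<le> x v" "x v \<le> 1 / 2" using that G x by auto
      have "x v * (2 * x v) \<le> x v * 1" using v by (intro mult_left_mono) auto
      then have "1 \<le> (1 + 2 * x v) * (1 - x v)" by (simp add: algebra_simps)
      then have "1 / (1 - x v) \<le> 1 + 2 * x v" using v by (simp add: field_simps)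
      also have "\<dots> \<le> exp (2 * x v)" by (rule exp_ge_add_one_self)
      finally show ?thesis .
    qed
    then have "p G \<le> (\<Prod>v\<in>G. exp (2 * x v))"
      unfolding p_def using x1 G by (intro prod_mono) (auto simp: less_imp_le subset_iff)
    also have "\<dots> = exp (2 * sum x G)" using G(1) by (simp add: exp_sum sum_distrib_left)
    also have "sum x G \<le> infsum x A" using G sum x(1) by (intro finite_sum_le_infsum) auto
    finally show ?thesis by simp
  qed
  have le_p: "sum (monomial x) B \<le> p H" if "finite B" "B \<subseteq> fin_fun G" "G \<subseteq> H" "finite H" "H \<subseteq> A" for B G H
    using that sub[OF that(3)] sub[OF that(5)] nonneg
    by (intro finite_sum_le_has_sum[OF fin_sum[OF that(4,5)]]) auto
  have cover: "B \<subseteq> fin_fun (\<Union>m\<in>B. {v. m v \<noteq> 0}) \<and> finite (\<Union>m\<in>B. {v. m v \<noteq> 0}) \<and> (\<Union>m\<in>B. {v. m v \<noteq> 0}) \<subseteq> A"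
    if "finite B" "B \<subseteq> fin_fun A" for B
  proof (intro conjI)
    have mem: "finite {v. m v \<noteq> 0}" "{v. m v \<noteq> 0} \<subseteq> A" if "m \<in> B" for m
      using fin_funD[of m A] subsetD[OF \<open>B \<subseteq> fin_fun A\<close> that] by auto
    show "finite (\<Union>m\<in>B. {v. m v \<noteq> 0})" using that(1) mem(1) by (rule finite_UN_I)
    show "(\<Union>m\<in>B. {v. m v \<noteq> 0}) \<subseteq> A" using mem(2) by (rule UN_least)
    show "B \<subseteq> fin_fun (\<Union>m\<in>B. {v. m v \<noteq> 0})"
    proof
      fix m assume "m \<in> B"
      then show "m \<in> fin_fun (\<Union>m\<in>B. {v. m v \<noteq> 0})"
        using mem(1) by (auto simp: fin_fun_def)
    qed
  qed
  show summable: "monomial x summable_on fin_fun A"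
  proof (rule nonneg_bounded_partial_sums_imp_summable_on)
    show "monomial x m \<ge> 0" if "m \<in> fin_fun A" for m using nonneg[OF that] .
    have "sum (monomial x) B \<le> exp (2 * infsum x A)" if "finite B" "B \<subseteq> fin_fun A" for B
      using le_p[OF that(1) _ order_refl, of "\<Union>m\<in>B. {v. m v \<noteq> 0}"] cover[OF that] p_le[of "\<Union>m\<in>B. {v. m v \<noteq> 0}"]
      by linarith
    then show "\<forall>\<^sub>F B in finite_subsets_at_top (fin_fun A). sum (monomial x) B \<le> exp (2 * infsum x A)"
      by (intro eventually_finite_subsets_at_top_weakI)
  qed
  have le: "p G \<le> infsum (monomial x) (fin_fun A)" if "finite G" "G \<subseteq> A" for G
    using fin_sum[OF that] has_sum_infsum[OF summable] sub[OF that(2)] nonneg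
    by (intro has_sum_mono_neutral[OF fin_sum[OF that] has_sum_infsum[OF summable]]) auto
  show "((\<lambda>G. \<Prod>v\<in>G. 1 / (1 - x v)) \<longlongrightarrow> infsum (monomial x) (fin_fun A)) (finite_subsets_at_top A)"
    unfolding p_def[symmetric]
  proof (rule order_tendstoI)
    fix a assume a: "a < infsum (monomial x) (fin_fun A)"
    have "(sum (monomial x) \<longlongrightarrow> infsum (monomial x) (fin_fun A)) (finite_subsets_at_top (fin_fun A))"
      using has_sum_infsum[OF summable] by (simp add: has_sum_def)
    from order_tendstoD(1)[OF this a] obtain B where B: "finite B" "B \<subseteq> fin_fun A" "a < sum (monomial x) B"
      by (auto simp: eventually_finite_subsets_at_top)
    show "\<forall>\<^sub>F G in finite_subsets_at_top A. a < p G"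
      unfolding eventually_finite_subsets_at_top
    proof (intro exI[of _ "\<Union>m\<in>B. {v. m v \<noteq> 0}"] conjI allI impI)
      fix H assume H: "finite H \<and> (\<Union>m\<in>B. {v. m v \<noteq> 0}) \<subseteq> H \<and> H \<subseteq> A"
      then show "a < p H" using le_p[OF B(1), of "\<Union>m\<in>B. {v. m v \<noteq> 0}" H] cover[OF B(1,2)] B(3) by linarith
    qed (use cover[OF B(1,2)] in auto)
  next
    fix a assume a: "infsum (monomial x) (fin_fun A) < a"
    show "\<forall>\<^sub>F G in finite_subsets_at_top A. p G < a"
      by (rule eventually_finite_subsets_at_top_weakI) (use le a in \<open>fastforce intro: le_less_trans\<close>)
  qed
qed

section \<open>Ideals of the ring of functions regular away from a place\<close>

context function_field_place
begin

definition \<O> :: "'k set" where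
  "\<O> = vset S (\<lambda>_. 0)"

definition ideal_of :: "(('k \<Rightarrow> int) \<Rightarrow> nat) \<Rightarrow> 'k set" where
  "ideal_of m = vset S (\<lambda>v. int (m v))"

definition is_ideal :: "'k set \<Rightarrow> bool" where
  "is_ideal I \<longleftrightarrow> add_subgroup I \<and> I \<subseteq> \<O> \<and> (\<forall>a\<in>\<O>. \<forall>x\<in>I. a * x \<in> I) \<and> I \<noteq> {0}"

lemma S_place: "v \<in> S \<Longrightarrow> is_place v"
  by (simp add: S_def)

lemma fin_supp_fin_fun: "m \<in> fin_fun S \<Longrightarrow> fin_supp (\<lambda>v. int (m v))"
  unfolding fin_fun_def fin_supp_def by (auto elim: rev_finite_subset)

text \<open>Approximating an element of value exactly \<open>m v\<close> to precision
  \<open>m v + 1\<close> keeps that value.\<close>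

lemma ideal_of_attains:
  assumes m: "m \<in> fin_fun S" and v: "v \<in> S"
  shows "\<exists>x\<in>ideal_of m. x \<noteq> 0 \<and> v x = int (m v)"
proof -
  obtain a where a: "a \<noteq> 0" "v a = int (m v)" using place_value[OF S_place[OF v]] by blast
  obtain x where x: "x \<in> vset S (\<lambda>v. int (m v))" "vge v (int (m v) + 1) (x - a)"
    using strong_approximation_step[OF fin_supp_fin_fun[OF m] v, of a] a by (auto simp: vge_def)
  then show ?thesis
    using place_eqI[OF S_place[OF v] a(1), of x] a(2) by (auto simp: ideal_of_def)
qed

lemma is_ideal_ideal_of:
  assumes m: "m \<in> fin_fun S" shows "is_ideal (ideal_of m)"
  unfolding is_ideal_def
proof (intro conjI ballI)
  show "add_subgroup (ideal_of m)" unfolding ideal_of_def by (rule add_subgroup_vset[OF S_place])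
  show "ideal_of m \<subseteq> \<O>" unfolding ideal_of_def \<O>_def by (rule vset_mono) simp
  show "ideal_of m \<noteq> {0}"
  proof (cases "S = {}")
    \<comment> \<open>Without places in \<open>S\<close> the set is the whole field.\<close>
    case True
    then have "1 \<in> ideal_of m" by (simp add: ideal_of_def vset_def)
    then show ?thesis by force
  next
    case False
    then obtain v where "v \<in> S" by blast
    from ideal_of_attains[OF m this] show ?thesis by blast
  qed
  fix a x assume a: "a \<in> \<O>" and x: "x \<in> ideal_of m"
  have "vge v (int (m v)) (a * x)" if v: "v \<in> S" for v
  proof -
    have "vge v 0 a" "vge v (int (m v)) x" using a x v unfolding \<O>_def ideal_of_def vset_def by blast+
    then show ?thesis using vge_mult[OF S_place[OF v], of 0 a "int (m v)" x] by simp
  qed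
  then show "a * x \<in> ideal_of m" by (simp add: ideal_of_def vset_def)
qed

text \<open>This is \<open>vset_index\<close> over Q = S, with the residues supplied by strong
  approximation.\<close>

lemma ideal_of_index:
  assumes m: "m \<in> fin_fun S"
  shows "idx \<O> (ideal_of m) = (\<Prod>v | m v \<noteq> 0. res_card v ^ m v)"
proof -
  define G where "G = {v. m v \<noteq> 0}"
  have G: "finite G" "G \<subseteq> S" using m unfolding fin_fun_def G_def by auto
  have approx: "\<exists>x\<in>vset S (\<lambda>w. 0 + int (l w)). vge v (0 + int (l v) + 1) (x - a)"
    if "v \<in> G" "\<And>w. w \<notin> G \<Longrightarrow> l w = 0" "vge v (0 + int (l v)) a" for l v a
  proof (rule strong_approximation_step)
    have "{v. is_place v \<and> 0 + int (l v) \<noteq> 0} \<subseteq> G"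
    proof
      fix w assume "w \<in> {v. is_place v \<and> 0 + int (l v) \<noteq> 0}"
      then have "l w \<noteq> 0" by simp
      then show "w \<in> G" using that(2)[of w] by (cases "w \<in> G") simp_all
    qed
    then show "fin_supp (\<lambda>w. 0 + int (l w))" unfolding fin_supp_def by (rule finite_subset[OF _ G(1)])
    show "v \<in> S" using that(1) G by auto
    show "vge v (0 + int (l v)) a" by (rule that(3))
  qed
  have "idx (vset S (\<lambda>_. 0)) (vset S (\<lambda>v. 0 + int (m v))) = (\<Prod>v\<in>G. res_card v ^ m v)"
  proof (rule conjunct2[OF vset_index[of S G m "\<lambda>_. 0"]])
    show "fin_place v" if "v \<in> G" for v using that G S_place fin_place by blast
  qed (use S_place G approx in \<open>auto simp: G_def\<close>)
  then show ?thesis by (simp add: \<O>_def ideal_of_def G_def)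
qed

lemma inj_on_ideal_of: "inj_on ideal_of (fin_fun S)"
proof (rule inj_onI)
  have *: "l v \<le> m v" if "m \<in> fin_fun S" "l \<in> fin_fun S" "ideal_of m = ideal_of l" "v \<in> S" for m l v
  proof -
    from ideal_of_attains[OF that(1,4)] obtain x where x: "x \<in> ideal_of m" "x \<noteq> 0" "v x = int (m v)" by blast
    then have "vge v (int (l v)) x" using that(3,4) unfolding ideal_of_def vset_def by blast
    then show ?thesis using x by (simp add: vge_def)
  qed
  fix m l assume ml: "m \<in> fin_fun S" "l \<in> fin_fun S" "ideal_of m = ideal_of l"
  show "m = l"
  proof
    fix v show "m v = l v"
    proof (cases "v \<in> S")
      case True
      then show ?thesis using *[OF ml True] *[OF ml(2,1) ml(3)[symmetric] True] by simp
    next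
      case False
      then show ?thesis using ml by (simp add: fin_fun_def)
    qed
  qed
qed

text \<open>\<open>m v\<close> is the least value at \<open>v\<close> on \<open>I\<close>. For
  \<open>z\<close> in \<open>ideal_of m\<close> fix a nonzero \<open>b\<close> in \<open>I\<close>.
  At each zero \<open>v\<close> of \<open>b\<close> in \<open>S\<close> take x_v in \<open>I\<close>
  of least value and, by strong approximation, a_v in \<open>\<O>\<close> close to z / x_v at
  \<open>v\<close> and small at the other zeros. Then \<open>z\<close> minus the sum of the a_v x_v
  is divisible by \<open>b\<close>, so \<open>z\<close> lies in \<open>I\<close>.\<close>

lemma ideal_eq_ideal_of:
  assumes I: "is_ideal I"
  shows "\<exists>m\<in>(fin_fun S). I = ideal_of m"
proof -
  have grp: "add_subgroup I" and sub: "I \<subseteq> \<O>" and "I \<noteq> {0}"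
    and abs: "\<And>a x. a \<in> \<O> \<Longrightarrow> x \<in> I \<Longrightarrow> a * x \<in> I" using I by (auto simp: is_ideal_def)
  then obtain b where b: "b \<in> I" "b \<noteq> 0" using add_subgroup_zero by blast
  have nonneg: "v x \<ge> 0" if "x \<in> I" "x \<noteq> 0" "v \<in> S" for x v
    using that sub unfolding \<O>_def vset_def vge_def by blast
  define m where "m v = (if v \<in> S then LEAST i. \<exists>x\<in>I. x \<noteq> 0 \<and> nat (v x) = i else 0)" for v
  have m_le: "m v \<le> nat (v x)" if "x \<in> I" "x \<noteq> 0" "v \<in> S" for x v
    using that unfolding m_def by (auto intro: Least_le)
  have m_ex: "\<exists>x\<in>I. x \<noteq> 0 \<and> nat (v x) = m v" if "v \<in> S" for v
  proof -
    have "\<exists>i. \<exists>x\<in>I. x \<noteq> 0 \<and> nat (v x) = i" using b by blast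
    from LeastI_ex[OF this] show ?thesis using that by (simp add: m_def)
  qed
  have m: "m \<in> fin_fun S"
    unfolding fin_fun_def
  proof (intro CollectI conjI allI impI)
    show "m v = 0" if "v \<notin> S" for v using that by (simp add: m_def)
    have "{v. m v \<noteq> 0} \<subseteq> {v. is_place v \<and> v b \<noteq> 0}"
    proof
      fix v assume v: "v \<in> {v. m v \<noteq> 0}"
      then have "v \<in> S" by (cases "v \<in> S") (auto simp: m_def)
      then show "v \<in> {v. is_place v \<and> v b \<noteq> 0}" using m_le[OF b, of v] v S_place[of v] by auto
    qed
    then show "finite {v. m v \<noteq> 0}" by (rule finite_subset[OF _ finite_support[OF b(2)]])
  qed
  have "I \<subseteq> ideal_of m"
  proof
    fix x assume x: "x \<in> I"
    have "vge v (int (m v)) x" if "v \<in> S" for v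
      using m_le[OF x _ that] nonneg[OF x _ that] by (cases "x = 0") (auto simp: vge_def)
    then show "x \<in> ideal_of m" by (simp add: ideal_of_def vset_def)
  qed
  moreover have "ideal_of m \<subseteq> I"
  proof
    fix z assume z: "z \<in> ideal_of m"
    define G where "G = {v \<in> S. v b > 0}"
    have "G \<subseteq> {v. is_place v \<and> v b \<noteq> 0}" by (auto simp: G_def S_def)
    then have G: "finite G" "G \<subseteq> S"
      by (rule finite_subset[OF _ finite_support[OF b(2)]]) (auto simp: G_def)
    \<comment> \<open>A common precision: value at least \<open>M\<close> at the zeros of
      \<open>b\<close> implies divisibility by \<open>b\<close> there.\<close>
    define M where "M = (\<Sum>v\<in>G. nat (v b))"
    have M: "v b \<le> int M" if "v \<in> G" for v
    proof -
      have "nat (v b) \<le> M" unfolding M_def by (rule member_le_sum[OF that _ G(1)]) simp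
      then show ?thesis by linarith
    qed
    obtain x where x: "\<And>v. v \<in> S \<Longrightarrow> x v \<in> I" "\<And>v. v \<in> S \<Longrightarrow> x v \<noteq> 0" "\<And>v. v \<in> S \<Longrightarrow> nat (v (x v)) = m v"
      using m_ex by metis
    have "\<exists>a\<in>\<O>. (\<forall>w\<in>G. w \<noteq> v \<longrightarrow> vge w (int M) a) \<and> vge v (int M) (a - z / x v)" if v: "v \<in> G" for v
    proof -
      have vS: "v \<in> S" and pv: "is_place v" using v G S_place by auto
      \<comment> \<open>Smallness at the other zeros is built into the set approximated from, so
        \<open>strong_approximation\<close>, which treats one place, is enough.\<close>
      define E where "E w = (if w \<in> G \<and> w \<noteq> v then int M else 0)" for w
      have "{w. is_place w \<and> E w \<noteq> 0} \<subseteq> G" by (auto simp: E_def)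
      then have "fin_supp E" unfolding fin_supp_def by (rule finite_subset[OF _ G(1)])
      moreover have "vge v (E v) (z / x v)"
      proof -
        have "vge v (int (m v)) z" using z vS unfolding ideal_of_def vset_def by blast
        moreover have "v (x v) = int (m v)" using x(3)[OF vS] nonneg[OF x(1,2) vS, OF vS vS] by simp
        ultimately show ?thesis
          using x(2)[OF vS] by (cases "z = 0") (auto simp: vge_def E_def place_divide[OF pv])
      qed
      ultimately obtain a where a: "a \<in> vset S E" "vge v (E v + int M) (a - z / x v)"
        using strong_approximation[OF _ vS] by blast
      have "vset S E \<subseteq> \<O>" unfolding \<O>_def by (rule vset_mono) (simp add: E_def)
      moreover have "vge w (int M) a" if "w \<in> G" "w \<noteq> v" for w
      proof -
        have "vge w (E w) a" using a(1) that(1) G(2) unfolding vset_def by blast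
        then show ?thesis using that by (simp add: E_def)
      qed
      ultimately show ?thesis using a by (intro bexI[of _ a]) (auto simp: E_def)
    qed
    then obtain a where a: "\<And>v. v \<in> G \<Longrightarrow> a v \<in> \<O>"
      "\<And>v w. v \<in> G \<Longrightarrow> w \<in> G \<Longrightarrow> w \<noteq> v \<Longrightarrow> vge w (int M) (a v)"
      "\<And>v. v \<in> G \<Longrightarrow> vge v (int M) (a v - z / x v)" by metis
    define s where "s = (\<Sum>v\<in>G. a v * x v)"
    have sI: "s \<in> I" unfolding s_def
      using a(1) x(1) G(2) by (intro add_subgroup_sum[OF grp] abs) auto
    define d where "d = z - s"
    have "vge w 0 (d / b)" if w: "w \<in> S" for w
    proof -
      have pw: "is_place w" by (rule S_place[OF w])
      have xw: "vge w 0 (x v)" if "v \<in> S" for v using nonneg[OF x(1,2) w, OF that that] by (simp add: vge_def)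
      have "vge w (w b) d"
      proof (cases "w \<in> G")
        case True
        have "z - a w * x w = - ((a w - z / x w) * x w)" using x(2)[OF w] by (simp add: field_simps)
        moreover have "vge w (int M + 0) ((a w - z / x w) * x w)"
          by (rule vge_mult[OF pw a(3)[OF True] xw[OF w]])
        ultimately have 1: "vge w (int M) (z - a w * x w)" using vge_uminus[OF pw] by simp
        have 2: "vge w (int M) (\<Sum>v\<in>G - {w}. a v * x v)"
        proof (rule vge_sum[OF pw])
          fix v assume "v \<in> G - {w}"
          then have "vge w (int M + 0) (a v * x v)"
            using G(2) by (intro vge_mult[OF pw a(2)[OF _ True] xw]) auto
          then show "vge w (int M) (a v * x v)" by simp
        qed
        have "d = (z - a w * x w) - (\<Sum>v\<in>G - {w}. a v * x v)"
          using G(1) True by (simp add: d_def s_def sum.remove)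
        then have "vge w (int M) d" using vge_diff[OF pw 1 2] by simp
        then show ?thesis using M[OF True] by (rule vge_mono)
      next
        \<comment> \<open>Where \<open>b\<close> is a unit only integrality of \<open>d\<close> is
          needed, and both \<open>z\<close> and \<open>s\<close> lie in
          \<open>ideal_of m\<close>.\<close>
        case False
        then have "w b = 0" using nonneg[OF b w] w by (simp add: G_def)
        moreover have "d \<in> ideal_of m"
          using add_subgroup_diff[of "ideal_of m"] is_ideal_ideal_of[OF m] z sI \<open>I \<subseteq> ideal_of m\<close>
          unfolding d_def is_ideal_def by blast
        then have "vge w (int (m w)) d" using w unfolding ideal_of_def vset_def by blast
        then have "vge w 0 d" by (rule vge_mono) simp
        ultimately show ?thesis by simp
      qed
      then show ?thesis using vge_scale[OF pw b(2), of 0 "d / b"] b(2) by simp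
    qed
    then have "d / b \<in> \<O>" by (simp add: \<O>_def vset_def)
    then have "d / b * b \<in> I" by (rule abs[OF _ b(1)])
    then have "s + d \<in> I" using b(2) sI by (intro add_subgroup_add[OF grp]) auto
    then show "z \<in> I" by (simp add: d_def)
  qed
  ultimately show ?thesis using m by blast
qed

lemma bij_betw_ideal_of: "bij_betw ideal_of (fin_fun S) {I. is_ideal I}"
  using inj_on_ideal_of is_ideal_ideal_of ideal_eq_ideal_of unfolding bij_betw_def by blast

section \<open>Counting places\<close>

definition places_between :: "nat \<Rightarrow> ('k \<Rightarrow> int) set" where
  "places_between f = {v. is_place v \<and> v T \<ge> 0 \<and> q ^ f \<le> res_card v \<and> res_card v < q ^ Suc f}"

text \<open>A place with residue field of size less than \<open>q\<^sup>f\<^sup>+\<^sup>1\<close> divides some nonzero polynomial in \<open>T\<close> of degree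
  at most \<open>f\<close>, hence the product of all of them.\<close>

lemma card_places_between:
  assumes G: "finite G" "G \<subseteq> places_between f"
  shows "card G \<le> n * q ^ Suc f"
proof -
  define A where "A = Ad (Suc f) - {0}"
  define y where "y = (\<Prod>a\<in>A. a)"
  have A: "finite A" "card A \<le> q ^ Suc f"
    using finite_Ad[of "Suc f"] card_Ad[of "Suc f"] card_mono[of "Ad (Suc f)" A] by (auto simp: A_def)
  have "(\<Prod>a\<in>B. a) \<in> Ad (Suc (f * card B))" if "B \<subseteq> A" for B
    using finite_subset[OF that A(1)] that
  proof (induction B)
    case empty
    then show ?case using Ad_one[of 0] by simp
  next
    case (insert a B)
    then have "a * (\<Prod>a\<in>B. a) \<in> Ad (Suc (f * card B) + f)"
      by (intro Ad_mult) (auto simp: A_def)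
    then show ?case using insert by (simp add: add.commute)
  qed
  from this[OF order_refl] have y: "y \<in> Ad (Suc (f * card A))" by (simp add: y_def)
  have y0: "y \<noteq> 0" using A(1) by (auto simp: y_def A_def)
  have vy: "v y > 0" if "v \<in> G" for v
  proof -
    have v: "is_place v" "v T \<ge> 0" "res_card v < q ^ Suc f"
      using that G(2) by (auto simp: places_between_def)
    obtain a where a: "a \<in> A" "v a > 0" using zero_of_polynomial[OF v] by (auto simp: A_def)
    have nn: "v b \<ge> 0" if "b \<in> A" for b
      using Ad_place_nonneg[OF v(1,2), of b "Suc f"] that by (auto simp: A_def vge_def)
    have "v y = (\<Sum>b\<in>A. v b)" unfolding y_def by (rule place_prod[OF v(1)]) (auto simp: A_def)
    moreover have "v a \<le> (\<Sum>b\<in>A. v b)" by (rule member_le_sum[OF a(1) nn A(1)]) simp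
    ultimately show ?thesis using a(2) by simp
  qed
  have pl: "is_place v" "q ^ f \<le> res_card v" if "v \<in> G" for v
    using that G(2) by (auto simp: places_between_def)
  have le: "(\<Prod>v\<in>G. res_card v ^ nat (v y)) \<le> q ^ (n * (f * card A))"
    using vy pl(1) by (intro prod_res_card_le[OF G(1) _ y0 _ growth_Ad[OF y]]) (auto simp: less_imp_le)
  have ge: "res_card v \<le> res_card v ^ nat (v y)" if "v \<in> G" for v
    using vy[OF that] res_card_ge_2[OF fin_place[OF pl(1)[OF that]]] self_le_power[of "res_card v" "nat (v y)"] by simp
  show ?thesis
  \<comment> \<open>For f > 0 the exponents of \<open>q\<close> are compared and \<open>f\<close>
    cancels. For f = 0 the polynomials are constants, the product is at most 1, and \<open>G\<close>
    is empty.\<close>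
  proof (cases "f = 0")
    case True
    have "2 ^ card G = (\<Prod>v\<in>G. 2 :: nat)" by simp
    also have "\<dots> \<le> (\<Prod>v\<in>G. res_card v ^ nat (v y))"
      using ge res_card_ge_2[OF fin_place[OF pl(1)]] by (intro prod_mono) (meson order_trans zero_le)
    also have "\<dots> \<le> 1" using le True by simp
    finally have "card G = 0" using less_exp[of "card G"] by linarith
    then show ?thesis by simp
  next
    case False
    have "q ^ (f * card G) = (\<Prod>v\<in>G. q ^ f)" by (simp add: power_mult)
    also have "\<dots> \<le> (\<Prod>v\<in>G. res_card v ^ nat (v y))"
      using ge pl(2) by (intro prod_mono) (meson order_trans zero_le)
    also note le
    finally have "f * card G \<le> n * (f * card A)" using q_ge_2 by (simp add: power_increasing_iff)
    then have "f * card G \<le> f * (n * card A)" by (simp only: mult.left_commute)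
    then have "card G \<le> n * card A" using False by simp
    also have "\<dots> \<le> n * q ^ Suc f" using A(2) by (rule mult_le_mono2)
    finally show ?thesis .
  qed
qed

text \<open>At most n q^(f+1) places have norm between q^f and q^(f+1), so they contribute at most n
  q x^f with x = q^(1 - \<beta>) < 1. The finitely many poles of \<open>T\<close> are added
  separately, because the count covers only places where \<open>T\<close> is integral.\<close>

lemma summable_places:
  assumes b: "\<beta> > (1::real)"
  shows "(\<lambda>v. real (res_card v) powr (- \<beta>)) summable_on S"
proof -
  define g where "g v = real (res_card v) powr (- \<beta>)" for v :: "'k \<Rightarrow> int"
  define A where "A = {v. is_place v \<and> v T \<ge> 0}"
  define x where "x = real q powr (1 - \<beta>)"
  have q: "real q > 1" using q_ge_2 by simp
  have x: "0 < x" "x < 1" unfolding x_def using q b by (auto intro: powr_less_one)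
  have "g summable_on A"
  proof (rule nonneg_bounded_partial_sums_imp_summable_on)
    show "g v \<ge> 0" for v by (simp add: g_def)
    have "sum g G \<le> real n * real q / (1 - x)" if G: "finite G" "G \<subseteq> A" for G
    proof -
      \<comment> \<open>The layer of \<open>v\<close>: the integer part of the logarithm of its norm
        to base \<open>q\<close>.\<close>
      define h where "h v = (LEAST f. res_card v < q ^ Suc f)" for v :: "'k \<Rightarrow> int"
      have h: "v \<in> places_between (h v)" if "v \<in> A" for v
      proof -
        have v: "is_place v" "v T \<ge> 0" using that by (auto simp: A_def)
        have "res_card v < 2 ^ res_card v" by (rule less_exp)
        also have "\<dots> \<le> q ^ Suc (res_card v)"
          using q_ge_2 power_mono[of 2 q "res_card v"] by simp (metis le_trans mult_le_mono1 nat_mult_1 one_le_numeral)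
        finally have "res_card v < q ^ Suc (h v)" unfolding h_def by (rule LeastI)
        moreover have "q ^ h v \<le> res_card v"
        proof (cases "h v")
          case 0
          then show ?thesis using res_card_ge_2[OF fin_place[OF v(1)]] by simp
        next
          case (Suc j)
          then have "j < (LEAST f. res_card v < q ^ Suc f)" by (simp add: h_def)
          from not_less_Least[OF this] show ?thesis using Suc by simp
        qed
        ultimately show ?thesis using v by (simp add: places_between_def)
      qed
      define K where "K = Max (insert 0 (h ` G))"
      have K: "h ` G \<subseteq> {..K}" using G(1) by (auto simp: K_def)
      have "sum g G = (\<Sum>f\<le>K. \<Sum>v | v \<in> G \<and> h v = f. g v)"
        by (rule sum.group[symmetric, OF G(1) _ K]) simp
      also have "\<dots> \<le> (\<Sum>f\<le>K. real n * real q * x ^ f)"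
      proof (rule sum_mono)
        fix f
        define H where "H = {v. v \<in> G \<and> h v = f}"
        have H: "finite H" "H \<subseteq> places_between f" using G h by (auto simp: H_def)
        have "g v \<le> real (q ^ f) powr (- \<beta>)" if "v \<in> H" for v
        proof -
          have "real (q ^ f) \<le> real (res_card v)" using H(2) that by (auto simp: places_between_def)
          then show ?thesis unfolding g_def using b q by (intro powr_mono2') auto
        qed
        then have "sum g H \<le> real (card H) * real (q ^ f) powr (- \<beta>)" by (rule sum_bounded_above)
        also have "\<dots> \<le> real (n * q ^ Suc f) * real (q ^ f) powr (- \<beta>)"
          using card_places_between[OF H] by (intro mult_right_mono of_nat_mono) auto
        also have "\<dots> = real n * real q * (real (q ^ f) * real (q ^ f) powr (- \<beta>))" by simp
        also have "real (q ^ f) * real (q ^ f) powr (- \<beta>) = x ^ f"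
        proof -
          have "real (q ^ f) * real (q ^ f) powr (- \<beta>) = real (q ^ f) powr (1 - \<beta>)"
            using q by (simp add: powr_diff powr_minus divide_inverse)
          also have "\<dots> = x ^ f"
            using q by (simp add: x_def powr_powr mult.commute flip: powr_realpow)
          finally show ?thesis .
        qed
        finally show "sum g H \<le> real n * real q * x ^ f" .
      qed
      also have "\<dots> = real n * real q * (\<Sum>f\<le>K. x ^ f)" by (simp add: sum_distrib_left)
      also have "\<dots> \<le> real n * real q * (1 / (1 - x))"
      proof (rule mult_left_mono)
        have "(\<Sum>f\<le>K. x ^ f) \<le> suminf (\<lambda>f. x ^ f)"
          using x by (intro sum_le_suminf summable_geometric) auto
        then show "(\<Sum>f\<le>K. x ^ f) \<le> 1 / (1 - x)" using x by (simp add: suminf_geometric)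
      qed simp
      finally show ?thesis by simp
    qed
    then show "\<forall>\<^sub>F G in finite_subsets_at_top A. sum g G \<le> real n * real q / (1 - x)"
      by (intro eventually_finite_subsets_at_top_weakI)
  qed
  moreover have "g summable_on {v. is_place v \<and> v T < 0}" using finite_poles_T by simp
  moreover have "A \<inter> {v. is_place v \<and> v T < 0} = {}" by (auto simp: A_def)
  ultimately have "g summable_on (A \<union> {v. is_place v \<and> v T < 0})"
    by (rule summable_on_Un_disjoint)
  moreover have "S \<subseteq> A \<union> {v. is_place v \<and> v T < 0}"
  proof
    fix v assume "v \<in> S"
    then show "v \<in> A \<union> {v. is_place v \<and> v T < 0}"
      by (cases "v T \<ge> 0") (simp_all add: A_def S_def)
  qed
  ultimately have "g summable_on S" by (rule summable_on_subset_banach)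
  moreover have "g = (\<lambda>v. real (res_card v) powr (- \<beta>))" by (simp add: g_def fun_eq_iff)
  ultimately show ?thesis by (simp only:)
qed

end

section \<open>Diagonal operators on \<open>\<ell>\<^sup>2\<close>\<close>

lemma ell2_outside: "f \<in> ell2 I \<Longrightarrow> i \<notin> I \<Longrightarrow> f i = 0"
  and ell2_summable: "f \<in> ell2 I \<Longrightarrow> (\<lambda>i. (cmod (f i))\<^sup>2) summable_on I"
  by (auto simp: ell2_def)

lemma ell2_norm_nonneg: "ell2_norm I f \<ge> 0"
  unfolding ell2_norm_def by (intro real_sqrt_ge_zero infsum_nonneg) auto

lemma L2_set_le_ell2_norm:
  assumes "f \<in> ell2 I" "finite K" "K \<subseteq> I"
  shows "L2_set (\<lambda>i. cmod (f i)) K \<le> ell2_norm I f"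
  unfolding L2_set_def ell2_norm_def
  by (intro real_sqrt_le_mono finite_sum_le_infsum ell2_summable assms) auto

lemma cmod_le_ell2_norm:
  assumes "f \<in> ell2 I" shows "cmod (f i) \<le> ell2_norm I f"
proof (cases "i \<in> I")
  case True
  then show ?thesis using L2_set_le_ell2_norm[OF assms, of "{i}"] by (simp add: L2_set_def)
next
  case False
  then show ?thesis using ell2_outside[OF assms False] ell2_norm_nonneg[of I f] by simp
qed

text \<open>Membership and norm are read off from finite coordinate sets, where
  \<open>L2_set\<close> supplies Minkowski's inequality.\<close>

lemma ell2I:
  assumes "\<And>i. i \<notin> I \<Longrightarrow> f i = 0" and "M \<ge> 0"
    and bound: "\<And>K. finite K \<Longrightarrow> K \<subseteq> I \<Longrightarrow> L2_set (\<lambda>i. cmod (f i)) K \<le> M"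
  shows "f \<in> ell2 I" "ell2_norm I f \<le> M"
proof -
  have b: "(\<Sum>i\<in>K. (cmod (f i))\<^sup>2) \<le> M\<^sup>2" if "finite K" "K \<subseteq> I" for K
    using bound[OF that] assms(2) unfolding L2_set_def by (simp add: sqrt_le_D)
  have s: "(\<lambda>i. (cmod (f i))\<^sup>2) summable_on I"
    by (rule nonneg_bounded_partial_sums_imp_summable_on[OF _ eventually_finite_subsets_at_top_weakI[OF b]]) auto
  then show "f \<in> ell2 I" using assms(1) by (simp add: ell2_def)
  have "(\<Sum>\<^sub>\<infinity>i\<in>I. (cmod (f i))\<^sup>2) \<le> M\<^sup>2" using infsum_le_finite_sums[OF s b] .
  then show "ell2_norm I f \<le> M" unfolding ell2_norm_def using assms(2) by (rule real_le_lsqrt[rotated])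
qed

lemma ell2_add:
  assumes "f \<in> ell2 I" "g \<in> ell2 I" shows "(\<lambda>i. f i + g i) \<in> ell2 I"
proof (rule ell2I(1)[where M = "ell2_norm I f + ell2_norm I g"])
  fix K assume K: "finite K" "K \<subseteq> I"
  have "L2_set (\<lambda>i. cmod (f i + g i)) K \<le> L2_set (\<lambda>i. cmod (f i) + cmod (g i)) K"
    by (intro L2_set_mono norm_triangle_ineq) auto
  also have "\<dots> \<le> L2_set (\<lambda>i. cmod (f i)) K + L2_set (\<lambda>i. cmod (g i)) K" by (rule L2_set_triangle_ineq)
  also have "\<dots> \<le> ell2_norm I f + ell2_norm I g"
    using assms K by (intro add_mono L2_set_le_ell2_norm)
  finally show "L2_set (\<lambda>i. cmod (f i + g i)) K \<le> ell2_norm I f + ell2_norm I g" .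
qed (use assms ell2_norm_nonneg in \<open>auto simp: ell2_outside intro: add_nonneg_nonneg\<close>)

lemma ell2_mult:
  assumes f: "f \<in> ell2 I" and b: "\<And>i. i \<in> I \<Longrightarrow> cmod (a i) \<le> C" "C \<ge> 0"
  shows "(\<lambda>i. a i * f i) \<in> ell2 I" "ell2_norm I (\<lambda>i. a i * f i) \<le> C * ell2_norm I f"
proof -
  have *: "L2_set (\<lambda>i. cmod (a i * f i)) K \<le> C * ell2_norm I f" if K: "finite K" "K \<subseteq> I" for K
  proof -
    have "L2_set (\<lambda>i. cmod (a i * f i)) K \<le> L2_set (\<lambda>i. C * cmod (f i)) K"
      using b K by (intro L2_set_mono) (auto simp: norm_mult intro!: mult_right_mono)
    also have "\<dots> = C * L2_set (\<lambda>i. cmod (f i)) K" using b(2) by (simp add: L2_set_right_distrib)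
    also have "\<dots> \<le> C * ell2_norm I f" using b(2) f K by (intro mult_left_mono L2_set_le_ell2_norm)
    finally show ?thesis .
  qed
  have 0: "a i * f i = 0" if "i \<notin> I" for i using ell2_outside[OF f that] by simp
  have C: "0 \<le> C * ell2_norm I f" using b(2) ell2_norm_nonneg[of I f] by simp
  show "(\<lambda>i. a i * f i) \<in> ell2 I" by (rule ell2I(1)[OF 0 C *])
  show "ell2_norm I (\<lambda>i. a i * f i) \<le> C * ell2_norm I f" by (rule ell2I(2)[OF 0 C *])
qed

lemma ell2_scale: "f \<in> ell2 I \<Longrightarrow> (\<lambda>i. c * f i) \<in> ell2 I"
  using ell2_mult(1)[of f I "\<lambda>_. c" "cmod c"] by simp

lemma ell2_sum: "(\<And>n. n \<in> N \<Longrightarrow> g n \<in> ell2 I) \<Longrightarrow> (\<lambda>i. \<Sum>n\<in>N. g n i) \<in> ell2 I"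
proof (induction N rule: infinite_finite_induct)
  case (insert n N)
  then show ?case using ell2_add[of "g n" I "\<lambda>i. \<Sum>n\<in>N. g n i"] by simp
qed (simp_all add: ell2_def)

lemma ell2_diff: "f \<in> ell2 I \<Longrightarrow> g \<in> ell2 I \<Longrightarrow> (\<lambda>i. f i - g i) \<in> ell2 I"
  using ell2_add[of f I "\<lambda>i. - 1 * g i"] ell2_scale[of g I "- 1"] by simp

lemma ell2_basis_in_ell2: "i \<in> I \<Longrightarrow> ell2_basis i \<in> ell2 I"
  using ell2_basis_scaled_in_ell2[of i I 1] by simp

lemma ell2_norm_basis:
  assumes "i \<in> I" shows "ell2_norm I (\<lambda>j. c * ell2_basis i j) = cmod c"
proof -
  have "(\<Sum>\<^sub>\<infinity>j\<in>I. (cmod (c * ell2_basis i j))\<^sup>2) = (\<Sum>\<^sub>\<infinity>j\<in>{i}. (cmod (c * ell2_basis i j))\<^sup>2)"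
    by (rule infsum_cong_neutral) (use assms in \<open>auto simp: ell2_basis_def\<close>)
  then show ?thesis by (simp add: ell2_norm_def ell2_basis_def)
qed

lemma L2_set_sum_le:
  "finite N \<Longrightarrow> L2_set (\<lambda>i. cmod (\<Sum>n\<in>N. g n i)) K \<le> (\<Sum>n\<in>N. L2_set (\<lambda>i. cmod (g n i)) K)"
proof (induction N rule: finite_induct)
  case (insert n N)
  have "L2_set (\<lambda>i. cmod (\<Sum>n\<in>insert n N. g n i)) K \<le> L2_set (\<lambda>i. cmod (g n i) + cmod (\<Sum>n\<in>N. g n i)) K"
    using insert by (intro L2_set_mono) (auto intro: norm_triangle_ineq)
  also have "\<dots> \<le> L2_set (\<lambda>i. cmod (g n i)) K + L2_set (\<lambda>i. cmod (\<Sum>n\<in>N. g n i)) K"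
    by (rule L2_set_triangle_ineq)
  finally show ?case using insert by simp
qed (simp add: L2_set_def)

lemma bounded_op_into: "bounded_op I B \<Longrightarrow> f \<in> ell2 I \<Longrightarrow> B f \<in> ell2 I"
  by (auto simp: bounded_op_def)

lemma bounded_op_add:
  "bounded_op I B \<Longrightarrow> f \<in> ell2 I \<Longrightarrow> g \<in> ell2 I \<Longrightarrow> B (\<lambda>i. f i + g i) = (\<lambda>i. B f i + B g i)"
  by (simp add: bounded_op_def)

lemma bounded_op_scale: "bounded_op I B \<Longrightarrow> f \<in> ell2 I \<Longrightarrow> B (\<lambda>i. c * f i) = (\<lambda>i. c * B f i)"
  by (simp add: bounded_op_def)

text \<open>The restriction to \<open>ell2 I\<close> matches the extensionality in
  \<open>bounded_op\<close>, on which the uniqueness behind \<open>THE\<close> in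
  \<open>exp_op\<close> rests.\<close>

definition diag_op :: "'i set \<Rightarrow> ('i \<Rightarrow> real) \<Rightarrow> ('i \<Rightarrow> complex) \<Rightarrow> ('i \<Rightarrow> complex)" where
  "diag_op I w = (\<lambda>f\<in>ell2 I. \<lambda>i. of_real (w i) * f i)"

lemma bounded_diag_op:
  assumes w: "\<And>i. i \<in> I \<Longrightarrow> 0 \<le> w i" "\<And>i. i \<in> I \<Longrightarrow> w i \<le> 1"
  shows "bounded_op I (diag_op I w)"
proof -
  have mult: "(\<lambda>i. of_real (w i) * f i) \<in> ell2 I" "ell2_norm I (\<lambda>i. of_real (w i) * f i) \<le> 1 * ell2_norm I f"
    if "f \<in> ell2 I" for f
    using ell2_mult[OF that, of "\<lambda>i. of_real (w i)" 1] w by auto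
  show ?thesis
    unfolding bounded_op_def
  proof (intro conjI ballI allI exI[of _ 1])
    show "diag_op I w \<in> ell2 I \<rightarrow>\<^sub>E ell2 I"
      using mult(1) by (auto simp: diag_op_def)
    show "diag_op I w (\<lambda>i. f i + g i) = (\<lambda>i. diag_op I w f i + diag_op I w g i)"
      if "f \<in> ell2 I" "g \<in> ell2 I" for f g
      using that ell2_add[OF that] by (simp add: diag_op_def algebra_simps)
    show "diag_op I w (\<lambda>i. c * f i) = (\<lambda>i. c * diag_op I w f i)" if "f \<in> ell2 I" for c f
      using that ell2_scale[OF that, of c] by (simp add: diag_op_def algebra_simps)
    show "ell2_norm I (diag_op I w f) \<le> 1 * ell2_norm I f" if "f \<in> ell2 I" for f
      using that mult(2)[OF that] by (simp add: diag_op_def)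
  qed
qed

text \<open>Finitely supported vectors are dense: linearity settles the truncations
  \<open>tr K\<close>, and boundedness makes the effect of the remainder \<open>h\<close>
  arbitrarily small in each coordinate.\<close>

lemma bounded_op_eqI:
  assumes B: "bounded_op I B" and D: "bounded_op I D"
    and basis: "\<And>i. i \<in> I \<Longrightarrow> B (ell2_basis i) = D (ell2_basis i)"
  shows "B = D"
proof (rule extensionalityI[of _ "ell2 I"])
  show "B \<in> extensional (ell2 I)" "D \<in> extensional (ell2 I)"
    using B D by (auto simp: bounded_op_def PiE_def)
  fix f assume f: "f \<in> ell2 I"
  have "\<exists>C. \<forall>f\<in>ell2 I. ell2_norm I (B f) \<le> C * ell2_norm I f"
    "\<exists>C. \<forall>f\<in>ell2 I. ell2_norm I (D f) \<le> C * ell2_norm I f"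
    using B D by (simp_all add: bounded_op_def)
  then obtain CB CD where CB: "\<forall>f\<in>ell2 I. ell2_norm I (B f) \<le> CB * ell2_norm I f"
    and CD: "\<forall>f\<in>ell2 I. ell2_norm I (D f) \<le> CD * ell2_norm I f" by (elim exE)
  note into = bounded_op_into[OF B] bounded_op_into[OF D]
  define tr where "tr K = (\<lambda>i. if i \<in> K then f i else 0)" for K
  have tr: "tr K \<in> ell2 I \<and> B (tr K) = D (tr K)" if "finite K" "K \<subseteq> I" for K
    using that
  proof (induction K)
    case empty
    have z: "(\<lambda>_::'a. 0::complex) \<in> ell2 I" by (simp add: ell2_def)
    have "B (\<lambda>_. 0) = D (\<lambda>_. 0)"
      using bounded_op_scale[OF B z, of 0] bounded_op_scale[OF D z, of 0] by simp
    then show ?case using z by (simp add: tr_def)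
  next
    case (insert k K)
    have eq: "tr (insert k K) = (\<lambda>i. tr K i + f k * ell2_basis k i)"
      using insert.hyps by (auto simp: tr_def ell2_basis_def)
    have k: "ell2_basis k \<in> ell2 I" "k \<in> I" using insert.prems by (auto intro: ell2_basis_in_ell2)
    have IH: "tr K \<in> ell2 I" "B (tr K) = D (tr K)" using insert by auto
    have fk: "(\<lambda>i. f k * ell2_basis k i) \<in> ell2 I" by (rule ell2_scale[OF k(1)])
    have "B (tr (insert k K)) = (\<lambda>i. B (tr K) i + f k * B (ell2_basis k) i)"
      unfolding eq bounded_op_add[OF B IH(1) fk] bounded_op_scale[OF B k(1)] ..
    moreover have "D (tr (insert k K)) = (\<lambda>i. D (tr K) i + f k * D (ell2_basis k) i)"
      unfolding eq bounded_op_add[OF D IH(1) fk] bounded_op_scale[OF D k(1)] ..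
    ultimately show ?case using IH basis[OF k(2)] ell2_add[OF IH(1) fk] by (simp add: eq)
  qed
  \<comment> \<open>The summand 1 keeps \<open>C\<close> positive, so that \<epsilon> can be divided
    by it.\<close>
  define C where "C = \<bar>CB\<bar> + \<bar>CD\<bar> + 1"
  show "B f = D f"
  proof
    fix j
    have "cmod (B f j - D f j) \<le> \<epsilon>" if \<epsilon>: "\<epsilon> > 0" for \<epsilon> :: real
    proof -
      define \<delta> where "\<delta> = \<epsilon> / C"
      have C: "C > 0" by (simp add: C_def)
      then have \<delta>: "\<delta> > 0" using \<epsilon> by (simp add: \<delta>_def)
      let ?s = "\<lambda>i. (cmod (f i))\<^sup>2"
      note sm = ell2_summable[OF f]
      have "(sum ?s \<longlongrightarrow> infsum ?s I) (finite_subsets_at_top I)"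
        using has_sum_infsum[OF sm] by (simp add: has_sum_def)
      from order_tendstoD(1)[OF this, of "infsum ?s I - \<delta>\<^sup>2"] \<delta>
      obtain K where K: "finite K" "K \<subseteq> I" "infsum ?s I - \<delta>\<^sup>2 < sum ?s K"
        by (auto simp: eventually_finite_subsets_at_top)
      define h where "h = (\<lambda>i. f i - tr K i)"
      have h: "h \<in> ell2 I" unfolding h_def using f tr[OF K(1,2)] by (intro ell2_diff) auto
      have "infsum (\<lambda>i. (cmod (h i))\<^sup>2) I = infsum ?s (I - K)"
        by (rule infsum_cong_neutral) (use K(2) in \<open>auto simp: h_def tr_def\<close>)
      also have "\<dots> = infsum ?s I - sum ?s K"
        using infsum_Diff[OF sm _ K(2)] K(1) by simp
      also have "\<dots> \<le> \<delta>\<^sup>2" using K(3) by simp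
      finally have nh: "ell2_norm I h \<le> \<delta>"
        unfolding ell2_norm_def using \<delta> by (simp add: real_le_lsqrt)
      have f_eq: "f = (\<lambda>i. h i + tr K i)" by (simp add: h_def)
      have trK: "tr K \<in> ell2 I" using tr[OF K(1,2)] by blast
      have "B f = (\<lambda>i. B h i + B (tr K) i)" "D f = (\<lambda>i. D h i + D (tr K) i)"
        using bounded_op_add[OF B h trK] bounded_op_add[OF D h trK] by (simp_all only: f_eq[symmetric])
      then have "B f j - D f j = B h j - D h j" using tr[OF K(1,2)] by simp
      also have "cmod \<dots> \<le> cmod (B h j) + cmod (D h j)" by (rule norm_triangle_ineq4)
      also have "\<dots> \<le> CB * ell2_norm I h + CD * ell2_norm I h"
        using cmod_le_ell2_norm[OF into(1)[OF h], of j] cmod_le_ell2_norm[OF into(2)[OF h], of j] bspec[OF CB h] bspec[OF CD h]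
        by linarith
      also have "\<dots> = (CB + CD) * ell2_norm I h" by (simp add: algebra_simps)
      also have "\<dots> \<le> C * \<delta>"
        using nh C ell2_norm_nonneg[of I h] by (intro mult_mono) (auto simp: C_def)
      also have "\<dots> = \<epsilon>" using C by (simp add: \<delta>_def)
      finally show ?thesis .
    qed
    then have "cmod (B f j - D f j) \<le> 0" by (rule field_le_epsilon[where y = 0, simplified])
    then show "B f j = D f j" by simp
  qed
qed

text \<open>Existence: on an entire vector the series is the scalar exponential series in each
  coordinate, and its tails are dominated in norm by those of the summable majorant
  \<open>t\<close>. Uniqueness: basis vectors are entire, as A^n multiplies them by (- c i)^n, and
  they determine a bounded operator.\<close>

lemma exp_op_diagonal:
  fixes c :: "'i \<Rightarrow> real"
  assumes c: "\<And>i. i \<in> I \<Longrightarrow> c i \<ge> 0"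
    and A: "\<And>f g i. (f, g) \<in> A \<Longrightarrow> i \<in> I \<Longrightarrow> g i = - of_real (c i) * f i"
      "\<And>f g. (f, g) \<in> A \<Longrightarrow> f \<in> ell2 I"
      "\<And>i z. i \<in> I \<Longrightarrow> (\<lambda>j. z * ell2_basis i j, \<lambda>j. - of_real (c i) * (z * ell2_basis i j)) \<in> A"
  shows "exp_op I A = diag_op I (\<lambda>i. exp (- c i))"
proof -
  define D where "D = diag_op I (\<lambda>i. exp (- c i))"
  have bD: "bounded_op I D" unfolding D_def using c by (intro bounded_diag_op) auto
  have expD: "is_exp_op I A D"
    unfolding is_exp_op_def
  proof (intro conjI allI impI bD)
    fix g :: "nat \<Rightarrow> 'i \<Rightarrow> complex"
    assume g: "(\<forall>n. (g n, g (Suc n)) \<in> A) \<and> (\<forall>r>0. summable (\<lambda>n. ell2_norm I (g n) * r ^ n / fact n))"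
    then have gA: "\<And>n. (g n, g (Suc n)) \<in> A" by blast
    have gn: "g n \<in> ell2 I" for n by (rule A(2)[OF gA])
    define t where "t n = ell2_norm I (g n) / fact n" for n
    have "summable (\<lambda>n. ell2_norm I (g n) * 1 ^ n / fact n)" using g zero_less_one by blast
    then have t: "summable t" by (simp add: t_def[abs_def])
    have t0: "t n \<ge> 0" for n by (simp add: t_def ell2_norm_nonneg)
    have pow: "g n i = (- of_real (c i)) ^ n * g 0 i" if "i \<in> I" for n i
      using A(1)[OF gA that] by (induction n) auto
    have lim: "(\<lambda>M. \<Sum>n<M. g n i / fact n) \<longlonglongrightarrow> D (g 0) i" for i
    proof (cases "i \<in> I")
      case True
      have "(\<lambda>n. (- complex_of_real (c i)) ^ n /\<^sub>R fact n) sums exp (- complex_of_real (c i))"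
        by (rule exp_converges)
      from sums_mult2[OF this, of "g 0 i"]
      moreover have "(- complex_of_real (c i)) ^ n /\<^sub>R fact n * g 0 i = g n i / fact n" for n
        unfolding pow[OF True, of n] by (simp add: scaleR_conv_of_real field_simps)
      ultimately have "(\<lambda>n. g n i / fact n) sums (exp (- complex_of_real (c i)) * g 0 i)" by simp
      moreover have "D (g 0) i = exp (- complex_of_real (c i)) * g 0 i"
        using gn[of 0] by (simp add: D_def diag_op_def exp_of_real[symmetric])
      ultimately show ?thesis by (simp add: sums_def)
    next
      case False
      then have "g n i = 0" for n by (rule ell2_outside[OF gn])
      then show ?thesis using gn by (simp add: D_def diag_op_def)
    qed
    define h where "h N = (\<lambda>i. D (g 0) i - (\<Sum>n<N. g n i / fact n))" for N
    have bound: "ell2_norm I (h N) \<le> suminf t - sum t {..<N}" for N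
    proof (rule ell2I(2))
      show "h N i = 0" if "i \<notin> I" for i
      proof -
        have "g n i = 0" for n by (rule ell2_outside[OF gn that])
        then show ?thesis using gn by (simp add: h_def D_def diag_op_def)
      qed
      show "0 \<le> suminf t - sum t {..<N}" using sum_le_suminf[OF t, of "{..<N}"] t0 by simp
      fix K assume K: "finite K" "K \<subseteq> I"
      \<comment> \<open>On finite \<open>K\<close> the triangle inequality bounds the block of the
        series from \<open>N\<close> to \<open>M\<close>; letting \<open>M\<close> tend to infinity
        bounds the remainder \<open>h N\<close>.\<close>
      let ?u = "\<lambda>M. L2_set (\<lambda>i. cmod (\<Sum>n\<in>{N..<M}. g n i / fact n)) K"
      have "(\<lambda>M. \<Sum>n\<in>{N..<M}. g n i / fact n) \<longlonglongrightarrow> h N i" for i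
      proof (rule Lim_transform_eventually)
        show "(\<lambda>M. (\<Sum>n<M. g n i / fact n) - (\<Sum>n<N. g n i / fact n)) \<longlonglongrightarrow> h N i"
          unfolding h_def by (intro tendsto_diff lim tendsto_const)
        show "\<forall>\<^sub>F M in sequentially. (\<Sum>n<M. g n i / fact n) - (\<Sum>n<N. g n i / fact n) = (\<Sum>n\<in>{N..<M}. g n i / fact n)"
          using eventually_ge_at_top[of N]
          by eventually_elim (simp add: sum_diff_nat_ivl[of 0 N _ "\<lambda>n. g n i / fact n", symmetric] atLeast0LessThan)
      qed
      then have "?u \<longlonglongrightarrow> L2_set (\<lambda>i. cmod (h N i)) K"
        unfolding L2_set_def by (intro tendsto_intros)
      then show "L2_set (\<lambda>i. cmod (h N i)) K \<le> suminf t - sum t {..<N}"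
      proof (rule LIMSEQ_le_const2, intro exI[of _ N] allI impI)
        fix M assume M: "M \<ge> N"
        have "?u M \<le> (\<Sum>n\<in>{N..<M}. L2_set (\<lambda>i. cmod (g n i / fact n)) K)"
          by (rule L2_set_sum_le) simp
        also have "\<dots> \<le> (\<Sum>n\<in>{N..<M}. t n)"
        proof (rule sum_mono)
          fix n
          have "L2_set (\<lambda>i. cmod (g n i / fact n)) K = L2_set (\<lambda>i. cmod (g n i) * inverse (fact n)) K"
            by (simp add: norm_mult norm_inverse divide_inverse)
          also have "\<dots> = L2_set (\<lambda>i. cmod (g n i)) K / fact n"
            by (simp add: L2_set_left_distrib divide_inverse)
          finally have "L2_set (\<lambda>i. cmod (g n i / fact n)) K = L2_set (\<lambda>i. cmod (g n i)) K / fact n" .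
          then show "L2_set (\<lambda>i. cmod (g n i / fact n)) K \<le> t n"
            using L2_set_le_ell2_norm[OF gn K] by (simp add: t_def divide_right_mono)
        qed
        also have "\<dots> = sum t {..<M} - sum t {..<N}"
          using M sum_diff_nat_ivl[of 0 N M t] by (simp add: atLeast0LessThan)
        also have "\<dots> \<le> suminf t - sum t {..<N}" using sum_le_suminf[OF t, of "{..<M}"] t0 by simp
        finally show "?u M \<le> suminf t - sum t {..<N}" .
      qed
    qed
    have "(\<lambda>N. suminf t - sum t {..<N}) \<longlonglongrightarrow> suminf t - suminf t"
      using summable_LIMSEQ[OF t] by (intro tendsto_diff tendsto_const)
    then have lim0: "(\<lambda>N. suminf t - sum t {..<N}) \<longlonglongrightarrow> 0" by simp
    have "(\<lambda>N. ell2_norm I (h N)) \<longlonglongrightarrow> 0"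
      by (rule real_tendsto_sandwich[OF always_eventually always_eventually tendsto_const lim0])
        (simp_all add: ell2_norm_nonneg bound)
    then show "(\<lambda>N. ell2_norm I (\<lambda>i. D (g 0) i - (\<Sum>n<N. g n i / fact n))) \<longlonglongrightarrow> 0"
      by (simp add: h_def)
  qed
  have "B = D" if B: "is_exp_op I A B" for B
  proof (rule bounded_op_eqI[OF _ bD])
    show bB: "bounded_op I B" using B by (simp add: is_exp_op_def)
    fix i assume i: "i \<in> I"
    define g where "g n = (\<lambda>j. (- complex_of_real (c i)) ^ n * ell2_basis i j)" for n
    have g0: "g 0 = ell2_basis i" by (simp add: g_def)
    have gA: "(g n, g (Suc n)) \<in> A" for n
      using A(3)[OF i, of "(- complex_of_real (c i)) ^ n"] by (simp add: g_def mult_ac)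
    have gn: "g n \<in> ell2 I" for n by (rule A(2)[OF gA])
    have norm_g: "ell2_norm I (g n) = c i ^ n" for n
      unfolding g_def ell2_norm_basis[OF i] using c[OF i] by (simp add: norm_power)
    have sm: "summable (\<lambda>n. ell2_norm I (g n) * r ^ n / fact n)" for r
      using summable_exp[of "c i * r"] unfolding norm_g
      by (simp add: power_mult_distrib divide_inverse mult_ac)
    have conv: "(\<lambda>N. ell2_norm I (\<lambda>j. C (ell2_basis i) j - (\<Sum>n<N. g n j / fact n))) \<longlonglongrightarrow> 0"
      if "is_exp_op I A C" for C
    proof -
      have "(\<lambda>N. ell2_norm I (\<lambda>i. C (g 0) i - (\<Sum>n<N. g n i / fact n))) \<longlonglongrightarrow> 0"
        using that gA sm unfolding is_exp_op_def by blast
      then show ?thesis by (simp add: g0)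
    qed
    have coord: "(\<lambda>N. \<Sum>n<N. g n j / fact n) \<longlonglongrightarrow> C (ell2_basis i) j" if C: "is_exp_op I A C" for C j
    proof -
      have Ci: "C (ell2_basis i) \<in> ell2 I"
        using C ell2_basis_in_ell2[OF i] by (auto simp: is_exp_op_def bounded_op_def)
      have "(\<lambda>j. C (ell2_basis i) j - (\<Sum>n<N. g n j / fact n)) \<in> ell2 I" for N
        using ell2_scale[OF gn, of "inverse (fact _)"]
        by (intro ell2_diff[OF Ci] ell2_sum) (simp add: divide_inverse mult.commute)
      from cmod_le_ell2_norm[OF this, of j]
      have "(\<lambda>N. C (ell2_basis i) j - (\<Sum>n<N. g n j / fact n)) \<longlonglongrightarrow> 0"
        by (intro Lim_null_comparison[OF _ conv[OF C]]) auto
      from tendsto_diff[OF tendsto_const this, of "C (ell2_basis i) j"] show ?thesis by simp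
    qed
    show "B (ell2_basis i) = D (ell2_basis i)"
      using LIMSEQ_unique[OF coord[OF B] coord[OF expD]] by blast
  qed
  with expD show ?thesis unfolding exp_op_def D_def[symmetric] by (rule the_equality)
qed

lemma ell2_inner_basis_diag:
  assumes i: "i \<in> I"
  shows "ell2_inner I (ell2_basis i) (diag_op I w (ell2_basis i)) = of_real (w i)"
proof -
  have "ell2_inner I (ell2_basis i) (diag_op I w (ell2_basis i)) =
    (\<Sum>\<^sub>\<infinity>j\<in>{i}. cnj (ell2_basis i j) * diag_op I w (ell2_basis i) j)"
    unfolding ell2_inner_def by (rule infsum_cong_neutral) (use i in \<open>auto simp: ell2_basis_def\<close>)
  also have "\<dots> = of_real (w i)"
    using ell2_basis_in_ell2[OF i] by (simp add: diag_op_def ell2_basis_def)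
  finally show ?thesis .
qed

text \<open>A diagonal operator with nonnegative entries is positive, so it is its own absolute
  value in \<open>is_abs_op\<close>, and trace class reduces to summability of the entries.\<close>

lemma diag_op_trace:
  assumes w: "\<And>i. i \<in> I \<Longrightarrow> 0 \<le> w i" "\<And>i. i \<in> I \<Longrightarrow> w i \<le> 1" and sum: "w summable_on I"
  shows "trace_class I (diag_op I w)" "op_trace I (diag_op I w) = of_real (infsum w I)"
proof -
  let ?D = "diag_op I w"
  have sum': "((\<lambda>i. complex_of_real (w i)) has_sum of_real (infsum w I)) I"
    by (intro has_sum_of_real has_sum_infsum sum)
  have has: "((\<lambda>i. ell2_inner I (ell2_basis i) (?D (ell2_basis i))) has_sum of_real (infsum w I)) I"
    using sum' by (subst has_sum_cong[OF ell2_inner_basis_diag])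
  show "op_trace I ?D = of_real (infsum w I)"
    unfolding op_trace_def using has by (rule infsumI)
  have b: "bounded_op I ?D" using w by (rule bounded_diag_op)
  have pos: "ell2_inner I f (?D f) \<in> \<real>\<^sub>\<ge>\<^sub>0" if f: "f \<in> ell2 I" for f
  proof -
    have "(\<lambda>i. w i * (cmod (f i))\<^sup>2) summable_on I"
      using w by (intro summable_on_comparison_test[OF ell2_summable[OF f]])
        (auto intro: mult_left_le_one_le mult_nonneg_nonneg)
    then have "((\<lambda>i. complex_of_real (w i * (cmod (f i))\<^sup>2)) has_sum of_real (\<Sum>\<^sub>\<infinity>i\<in>I. w i * (cmod (f i))\<^sup>2)) I"
      by (intro has_sum_of_real has_sum_infsum)
    moreover have "cnj (f i) * ?D f i = complex_of_real (w i * (cmod (f i))\<^sup>2)" for i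
      using f by (simp only: diag_op_def restrict_apply' of_real_mult complex_norm_square mult_ac)
    ultimately have "ell2_inner I f (?D f) = of_real (\<Sum>\<^sub>\<infinity>i\<in>I. w i * (cmod (f i))\<^sup>2)"
      unfolding ell2_inner_def by (intro infsumI) simp
    moreover have "(\<Sum>\<^sub>\<infinity>i\<in>I. w i * (cmod (f i))\<^sup>2) \<ge> 0"
      using w(1) by (intro infsum_nonneg mult_nonneg_nonneg) auto
    ultimately show ?thesis by simp
  qed
  show "trace_class I ?D"
    unfolding trace_class_def is_abs_op_def using b pos has by (auto simp: summable_on_def)
qed

section \<open>The zeta function as a sum over ideals\<close>

context function_field_place
begin

text \<open>The Euler product expands into monomials in the \<open>x v\<close>. By
  \<open>ideal_of_index\<close> the monomial of \<open>m\<close> is the norm of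
  \<open>ideal_of m\<close> to the power -\<beta>, and unique factorisation into primes takes the
  form of \<open>bij_betw_ideal_of\<close>.\<close>

lemma ideal_sum:
  assumes \<beta>: "\<beta> > (1::real)"
  shows "(\<lambda>I. real (idx \<O> I) powr (- \<beta>)) summable_on {I. is_ideal I}"
    and "((\<lambda>G. \<Prod>v\<in>G. 1 / (1 - real (res_card v) powr (- \<beta>))) \<longlongrightarrow>
      (\<Sum>\<^sub>\<infinity>I\<in>{I. is_ideal I}. real (idx \<O> I) powr (- \<beta>))) (finite_subsets_at_top S)"
proof -
  define x where "x v = real (res_card v) powr (- \<beta>)" for v :: "'k \<Rightarrow> int"
  have x: "0 \<le> x v" "x v \<le> 1 / 2" if "v \<in> S" for v
  proof -
    have 2: "real (res_card v) \<ge> 2" using res_card_ge_2[OF fin_place[OF S_place[OF that]]] by simp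
    have "x v \<le> real (res_card v) powr (- 1)"
      unfolding x_def using 2 \<beta> by (intro powr_mono) auto
    also have "\<dots> \<le> 1 / 2" using 2 by (simp add: powr_minus field_simps)
    finally show "x v \<le> 1 / 2" .
    show "0 \<le> x v" by (simp add: x_def)
  qed
  have "x summable_on S" using summable_places[OF \<beta>] by (simp add: x_def[abs_def])
  note euler = euler_product[of S x, OF x this]
  have mon: "monomial x m = real (idx \<O> (ideal_of m)) powr (- \<beta>)" if m: "m \<in> fin_fun S" for m
  proof -
    have "monomial x m = (\<Prod>v | m v \<noteq> 0. real (res_card v ^ m v) powr (- \<beta>))"
      unfolding monomial_def
    proof (rule prod.cong)
      fix v assume "v \<in> {v. m v \<noteq> 0}"
      then have "v \<in> S" using fin_funD(2)[OF m] by simp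
      then have "real (res_card v) > 0" using res_card_pos[OF S_place] by simp
      then show "x v ^ m v = real (res_card v ^ m v) powr (- \<beta>)"
        by (simp add: x_def powr_powr mult.commute flip: powr_realpow)
    qed simp
    also have "\<dots> = (\<Prod>v | m v \<noteq> 0. real (res_card v ^ m v)) powr (- \<beta>)"
      by (rule prod_powr_distrib[symmetric])
    also have "(\<Prod>v | m v \<noteq> 0. real (res_card v ^ m v)) = real (idx \<O> (ideal_of m))"
      unfolding ideal_of_index[OF m] by (simp only: of_nat_prod)
    finally show ?thesis .
  qed
  have "(monomial x has_sum infsum (monomial x) (fin_fun S)) (fin_fun S)"
    by (rule has_sum_infsum[OF euler(1)])
  also have "?this \<longleftrightarrow> ((\<lambda>m. real (idx \<O> (ideal_of m)) powr (- \<beta>)) has_sum infsum (monomial x) (fin_fun S)) (fin_fun S)"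
    by (rule has_sum_cong[OF mon])
  also have "\<dots> \<longleftrightarrow> ((\<lambda>I. real (idx \<O> I) powr (- \<beta>)) has_sum infsum (monomial x) (fin_fun S)) {I. is_ideal I}"
    by (rule has_sum_reindex_bij_betw[OF bij_betw_ideal_of])
  finally have *: "((\<lambda>I. real (idx \<O> I) powr (- \<beta>)) has_sum infsum (monomial x) (fin_fun S)) {I. is_ideal I}" .
  then show "(\<lambda>I. real (idx \<O> I) powr (- \<beta>)) summable_on {I. is_ideal I}"
    by (auto simp: summable_on_def)
  show "((\<lambda>G. \<Prod>v\<in>G. 1 / (1 - real (res_card v) powr (- \<beta>))) \<longlongrightarrow>
      (\<Sum>\<^sub>\<infinity>I\<in>{I. is_ideal I}. real (idx \<O> I) powr (- \<beta>))) (finite_subsets_at_top S)"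
    using euler(2) unfolding infsumI[OF *] by (simp add: x_def)
qed

lemma ideal_index_pos:
  assumes "is_ideal I" shows "idx \<O> I \<ge> 1"
proof -
  obtain m where m: "m \<in> fin_fun S" "I = ideal_of m" using ideal_eq_ideal_of[OF assms] by blast
  have "(\<Prod>v | m v \<noteq> 0. res_card v ^ m v) \<ge> 1"
  proof (rule prod_ge_1)
    fix v assume "v \<in> {v. m v \<noteq> 0}"
    then have "v \<in> S" using fin_funD(2)[OF m(1)] by simp
    then show "1 \<le> res_card v ^ m v" using res_card_pos[OF S_place] by (simp add: Suc_leI)
  qed
  then show ?thesis unfolding m(2) ideal_of_index[OF m(1)] .
qed

end

section \<open>Transfer to field structures on a carrier\<close>

locale field_iso = K: Ring.field K for K :: "('a, 'b) ring_scheme" (structure) +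
  fixes r :: "'k::field \<Rightarrow> 'a"
  assumes bij: "bij_betw r UNIV (carrier K)"
    and add: "r (x + y) = r x \<oplus> r y"
    and mult: "r (x * y) = r x \<otimes> r y"
begin

abbreviation s :: "'a \<Rightarrow> 'k" where "s \<equiv> inv_into UNIV r"

lemma closed [simp]: "r x \<in> carrier K"
  using bij by (auto simp: bij_betw_def)

lemma eq_iff [simp]: "r x = r y \<longleftrightarrow> x = y"
  using bij by (auto simp: bij_betw_def inj_on_def)

lemma s_r [simp]: "s (r x) = x"
  by (rule inv_into_f_f) (auto simp: inj_on_def)

lemma r_s [simp]: "y \<in> carrier K \<Longrightarrow> r (s y) = y"
  using bij by (auto simp: bij_betw_def intro: f_inv_into_f)

lemma carrier_eq: "carrier K = range r"
  using bij by (auto simp: bij_betw_def)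

lemma zero: "r 0 = \<zero>"
  using add[of 0 0] K.add.l_cancel_one'[of "r 0" "r 0"] by simp

lemma zero_iff [simp]: "r x = \<zero> \<longleftrightarrow> x = 0"
  using eq_iff[of x 0] by (simp add: zero)

lemma one: "r 1 = \<one>"
proof -
  have "r 1 \<otimes> r 1 = r 1 \<otimes> \<one>" using mult[of 1 1] by simp
  then show ?thesis using K.m_lcancel[of "r 1" "r 1" \<one>] by simp
qed

lemma uminus: "r (- x) = \<ominus> r x"
proof -
  have "r (- x) \<oplus> r x = \<zero>" by (simp add: zero flip: add)
  then show ?thesis using K.minus_equality[of "r (- x)" "r x"] by simp
qed

lemma inverse: "x \<noteq> 0 \<Longrightarrow> r (inverse x) = inv r x"
  by (rule K.comm_inv_char[symmetric]) (simp_all add: one flip: mult)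

lemma of_nat: "r (of_nat m) = [m] \<cdot> \<one>"
  by (induction m) (simp_all add: zero one add K.add.nat_pow_Suc K.a_comm)

lemma of_int_generate: "r (of_int i) \<in> generate_field K H"
proof -
  have nat: "r (of_nat m) \<in> generate_field K H" for m
  proof (induction m)
    case 0
    show ?case using K.zero_in_generate by (simp add: zero)
  next
    case (Suc m)
    then show ?case by (simp add: add one generate_field.one generate_field.eng_add)
  qed
  show ?thesis
  proof (cases i rule: int_cases2)
    case (nonneg m)
    then show ?thesis using nat[of m] by simp
  next
    case (nonpos m)
    then show ?thesis using generate_field.a_inv[OF nat[of m]] by (simp add: uminus)
  qed
qed

text \<open>Coefficient lists for \<open>K.eval\<close> start with the leading coefficient, those
  for \<open>Poly\<close> with the constant one; hence \<open>rev\<close>.\<close>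

lemma eval_poly: "K.eval (map r (rev cs)) (r t) = r (poly (Poly cs) t)"
proof (induction cs)
  case (Cons c cs)
  have "K.eval (map r (rev cs) @ [r c]) (r t) = K.eval (map r (rev cs)) (r t) \<otimes> r t \<oplus> r c"
    by (rule K.eval_append_aux) auto
  then show ?case using Cons by (simp add: add mult K.a_comm K.m_comm)
qed (simp add: zero)

lemma combine: "length ks = length us \<Longrightarrow> K.combine (map r ks) (map r us) = r (\<Sum>i<length us. ks ! i * us ! i)"
proof (induction ks us rule: list_induct2)
  case (Cons k ks u us)
  then show ?case by (simp add: add mult sum.lessThan_Suc_shift del: sum.lessThan_Suc)
qed (simp add: zero)

text \<open>\<open>F\<close> is the image of the integers, finite since \<open>p\<close> is 0 in the
  field. Elements of the field generated by \<open>T0\<close> are quotients of polynomials in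
  \<open>T\<close> (\<open>frac\<close>), so a basis over it spans after clearing denominators; its
  independence applies to polynomial coefficients by \<open>poly_E\<close>.\<close>

lemma function_field_exists:
  assumes "global_function_field K"
  shows "\<exists>(F :: 'k set) T n e. function_field F T n e"
proof -
  obtain p :: nat and T0 where p: "Factorial_Ring.prime p" "[p] \<cdot> \<one> = \<zero>" and T0: "T0 \<in> carrier K"
    and tr: "K.transcendental (generate_field K {}) T0"
    and fd: "K.finite_dimension (generate_field K {T0}) (carrier K)"
    using assms unfolding global_function_field_def by blast
  define F where "F = range (of_int :: int \<Rightarrow> 'k)"
  define T where "T = s T0"
  have rT: "r T = T0" using T0 by (simp add: T_def)
  have F: "is_subring F"
    unfolding is_subring_def add_subgroup_def F_def
    by (auto intro: range_eqI[of _ _ 0] range_eqI[of _ _ 1] simp flip: of_int_diff of_int_mult)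
  have p0: "of_nat p = (0::'k)" using p(2) by (simp flip: of_nat zero_iff)
  have "F \<subseteq> of_int ` {0..<int p}"
  proof
    fix x assume "x \<in> F"
    then obtain i where "x = of_int i" by (auto simp: F_def)
    also have "of_int i = (of_int (int p * (i div int p) + i mod int p) :: 'k)" by simp
    also have "\<dots> = of_int (i mod int p)" unfolding of_int_add of_int_mult of_int_of_nat_eq p0 by simp
    finally show "x \<in> of_int ` {0..<int p}" using prime_gt_0_nat[OF p(1)] by auto
  qed
  then have finF: "finite F" by (rule finite_subset) simp
  define A where "A = (\<lambda>f. poly f T) ` polys_over F"
  have A: "is_subring A" unfolding A_def by (rule is_subring_adjoin[OF F])
  have transc: "f = 0" if f: "f \<in> polys_over F" "poly f T = 0" for f
  proof (rule ccontr)
    assume "f \<noteq> 0"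
    define l where "l = map r (rev (coeffs f))"
    have ne: "coeffs f \<noteq> []" using \<open>f \<noteq> 0\<close> by simp
    have "set (coeffs f) \<subseteq> F"
      using f(1) unfolding polys_over_def by (auto simp: coeffs_def)
    then have "set l \<subseteq> generate_field K {}"
      using of_int_generate by (auto simp: l_def F_def)
    moreover have "hd l = r (last (coeffs f))" using ne by (simp add: l_def hd_map hd_rev)
    then have "hd l \<noteq> \<zero>" using \<open>f \<noteq> 0\<close> by (simp add: last_coeffs_eq_coeff_degree)
    ultimately have "polynomial\<^bsub>K\<^esub> (generate_field K {}) l" by (simp add: polynomial_def)
    then have 1: "l \<in> carrier (univ_poly K (generate_field K {}))" by (simp add: univ_poly_carrier)
    have 2: "[] \<in> carrier (univ_poly K (generate_field K {}))"
      by (simp add: univ_poly_carrier[symmetric] polynomial_def)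
    have "K.eval l T0 = \<zero>" using eval_poly[of "coeffs f" T] f(2) by (simp add: l_def rT)
    then have "K.eval l T0 = K.eval [] T0" by simp
    with tr[unfolded K.transcendental_def] have "l = []" by (rule inj_onD) (rule 1, rule 2)
    then show False using ne by (simp add: l_def)
  qed
  have subfield: "subfield (generate_field K {T0}) K"
    using T0 by (intro K.generate_field_is_subfield) simp
  have r1: "\<one> = r 1" by (rule one[symmetric])
  have frac: "\<exists>a b. a \<in> A \<and> b \<in> A \<and> b \<noteq> 0 \<and> y = r (a / b)" if "y \<in> generate_field K {T0}" for y
    using that
  proof (induction rule: generate_field.induct)
    case one
    show ?case using subring_one[OF A] by (intro exI[of _ 1]) (simp add: r1)
  next
    case (incl h)
    have "[:0, 1:] \<in> polys_over F"
      by (intro polys_over_pCons polys_over_zero subring_zero subring_one F)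
    then have "poly [:0, 1:] T \<in> A" unfolding A_def by (rule imageI)
    then show ?case using incl subring_one[OF A] rT by (intro exI[of _ T] exI[of _ 1]) simp
  next
    case (a_inv h)
    then obtain a b where "a \<in> A" "b \<in> A" "b \<noteq> 0" "h = r (a / b)" by blast
    then show ?case using subring_uminus[OF A, of a]
      by (intro exI[of _ "- a"] exI[of _ b]) (simp flip: uminus)
  next
    case (m_inv h)
    then obtain a b where ab: "a \<in> A" "b \<in> A" "b \<noteq> 0" "h = r (a / b)" by blast
    then have "a \<noteq> 0" using m_inv by auto
    then show ?case using ab inverse[of "a / b"]
      by (intro exI[of _ b] exI[of _ a]) simp
  next
    case (eng_add h h')
    then obtain a b a' b' where ab: "a \<in> A" "b \<in> A" "b \<noteq> 0" "h = r (a / b)"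
      "a' \<in> A" "b' \<in> A" "b' \<noteq> 0" "h' = r (a' / b')" by blast
    then have "h \<oplus> h' = r ((a * b' + a' * b) / (b * b'))" by (simp add: add_frac_eq flip: add)
    moreover have "a * b' + a' * b \<in> A" "b * b' \<in> A" "b * b' \<noteq> 0"
      using ab A by (auto intro: subring_add subring_mult)
    ultimately show ?case by blast
  next
    case (eng_mult h h')
    then obtain a b a' b' where ab: "a \<in> A" "b \<in> A" "b \<noteq> 0" "h = r (a / b)"
      "a' \<in> A" "b' \<in> A" "b' \<noteq> 0" "h' = r (a' / b')" by blast
    then have "h \<otimes> h' = r ((a * a') / (b * b'))" by (simp flip: mult)
    moreover have "a * a' \<in> A" "b * b' \<in> A" "b * b' \<noteq> 0" using ab A by (auto intro: subring_mult)
    ultimately show ?case by blast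
  qed
  have poly_E: "r (poly f T) \<in> generate_field K {T0}" if "f \<in> polys_over F" for f
    using that
  proof (induction f rule: pCons_induct)
    case 0
    then show ?case using K.zero_in_generate by (simp add: zero)
  next
    case (pCons a g)
    have "Polynomial.coeff (pCons a g) 0 \<in> F" "\<And>i. Polynomial.coeff (pCons a g) (Suc i) \<in> F"
      using pCons.prems unfolding polys_over_def by blast+
    then have "a \<in> F" "g \<in> polys_over F" by (auto simp: polys_over_def)
    then have "r a \<in> generate_field K {T0}" "r (poly g T) \<in> generate_field K {T0}"
      using pCons.IH of_int_generate by (auto simp: F_def)
    moreover have "T0 \<in> generate_field K {T0}" by (rule generate_field.incl) simp
    ultimately show ?case
      by (simp add: add mult rT generate_field.eng_add generate_field.eng_mult)
  qed
  obtain n where "K.dimension n (generate_field K {T0}) (carrier K)"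
    using fd unfolding K.finite_dimension_def by blast
  then obtain Us where Us: "set Us \<subseteq> carrier K" "K.independent (generate_field K {T0}) Us"
    "length Us = n" "K.Span (generate_field K {T0}) Us = carrier K"
    using K.exists_base[OF subfield] by blast
  define e where "e j = s (Us ! j)" for j
  have Us_eq: "Us = map r (map s Us)"
    using Us(1) by (simp add: map_idI subset_iff)
  have comb: "K.combine (map r ks) Us = r (\<Sum>i<n. ks ! i * e i)" if "length ks = n" for ks
  proof -
    have "K.combine (map r ks) Us = r (\<Sum>i<length (map s Us). ks ! i * map s Us ! i)"
      by (subst Us_eq, rule combine) (use that Us(3) in simp)
    also have "(\<Sum>i<length (map s Us). ks ! i * map s Us ! i) = (\<Sum>i<n. ks ! i * e i)"
      using Us(3) by (intro sum.cong) (auto simp: e_def)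
    finally show ?thesis .
  qed
  have "function_field F T n e"
  proof
    show "is_subring F" "finite F" by fact+
    show "f = 0" if "f \<in> polys_over F" "poly f T = 0" for f by (rule transc[OF that])
    show "a j = 0" if a: "\<And>i. i < n \<Longrightarrow> a i \<in> (\<lambda>f. poly f T) ` polys_over F" "(\<Sum>i<n. a i * e i) = 0" "j < n" for a j
    proof -
      have "K.combine (map r (map a [0..<n])) Us = r (\<Sum>i<n. map a [0..<n] ! i * e i)" by (rule comb) simp
      also have "(\<Sum>i<n. map a [0..<n] ! i * e i) = 0" using a(2) by simp
      finally have "K.combine (map r (map a [0..<n])) Us = \<zero>" by (simp add: zero)
      moreover have "set (map r (map a [0..<n])) \<subseteq> generate_field K {T0}"
        using a(1) poly_E by fastforce
      ultimately have "set (take (length Us) (map r (map a [0..<n]))) \<subseteq> {\<zero>}"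
        using K.independent_imp_trivial_combine[OF subfield Us(2)] by blast
      then show ?thesis using a(3) Us(3) by (auto simp: image_subset_iff)
    qed
    fix x
    have "r x \<in> K.Span (generate_field K {T0}) Us" unfolding Us(4) by (rule closed)
    then obtain Ks where Ks: "set Ks \<subseteq> generate_field K {T0}" "length Ks = n" "r x = K.combine Ks Us"
      using K.unique_decomposition[OF subfield Us(2)] Us(3) by metis
    have "\<forall>i. \<exists>a b. i < n \<longrightarrow> a \<in> A \<and> b \<in> A \<and> b \<noteq> 0 \<and> Ks ! i = r (a / b)"
      using frac Ks(1,2) nth_mem by (metis subset_iff)
    then obtain a b where ab: "\<And>i. i < n \<Longrightarrow> a i \<in> A" "\<And>i. i < n \<Longrightarrow> b i \<in> A"
      "\<And>i. i < n \<Longrightarrow> b i \<noteq> 0" "\<And>i. i < n \<Longrightarrow> Ks ! i = r (a i / b i)" by metis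
    have "Ks = map r (map (\<lambda>i. a i / b i) [0..<n])"
      using Ks(2) ab(4) by (intro nth_equalityI) auto
    then have "r x = r (\<Sum>i<n. map (\<lambda>i. a i / b i) [0..<n] ! i * e i)"
      using Ks(3) comb[of "map (\<lambda>i. a i / b i) [0..<n]"] by simp
    then have x: "x = (\<Sum>i<n. a i / b i * e i)" by simp
    \<comment> \<open>The product of the denominators of all coordinates clears them at
      once.\<close>
    define d where "d = (\<Prod>i<n. b i)"
    have prodA: "prod b M \<in> A" if "M \<subseteq> {..<n}" for M
      using finite_subset[OF that] that by (induction M) (auto intro: subring_one subring_mult A ab(2))
    have x_eq: "d * x = (\<Sum>i<n. (prod b ({..<n} - {i}) * a i) * e i)"
      unfolding x sum_distrib_left
    proof (rule sum.cong)
      fix i assume "i \<in> {..<n}"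
      then have "d = b i * prod b ({..<n} - {i})" "b i \<noteq> 0" using ab(3) by (auto simp: d_def prod.remove)
      then show "d * (a i / b i * e i) = prod b ({..<n} - {i}) * a i * e i" by simp
    qed simp
    have dA: "d \<in> A" unfolding d_def by (rule prodA) simp
    have d0: "d \<noteq> 0" using ab(3) by (simp add: d_def)
    have aA: "prod b ({..<n} - {i}) * a i \<in> A" if "i < n" for i
      using that ab(1) by (intro subring_mult[OF A] prodA) auto
    show "\<exists>d a. d \<in> (\<lambda>f. poly f T) ` polys_over F \<and> d \<noteq> 0 \<and>
      (\<forall>i<n. a i \<in> (\<lambda>f. poly f T) ` polys_over F) \<and> d * x = (\<Sum>i<n. a i * e i)"
      unfolding A_def[symmetric]
      by (intro exI[of _ d] exI[of _ "\<lambda>i. prod b ({..<n} - {i}) * a i"] conjI allI impI dA d0 aA x_eq)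
  qed
  then show ?thesis by blast
qed

section \<open>Places and quotients under the isomorphism\<close>

definition pull :: "('a \<Rightarrow> int) \<Rightarrow> 'k \<Rightarrow> int" where
  "pull v x = (if x = 0 then 0 else v (r x))"

text \<open>Both sides fix the irrelevant values: members of \<open>places K\<close> are extensional
  off the nonzero elements, places on the type are 0 at 0. So the two transfers are inverse to each
  other as functions.\<close>

lemma bij_betw_pull: "bij_betw pull (places K) {v. is_place v}"
proof (rule bij_betw_byWitness[where f' = "\<lambda>w. \<lambda>y\<in>carrier K - {\<zero>}. w (s y)"])
  have s0: "s y = 0 \<longleftrightarrow> y = \<zero>" if "y \<in> carrier K" for y
    using zero_iff[of "s y"] that by simp
  show "\<forall>v\<in>places K. (\<lambda>y\<in>carrier K - {\<zero>}. pull v (s y)) = v"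
  proof
    fix v assume v: "v \<in> places K"
    show "(\<lambda>y\<in>carrier K - {\<zero>}. pull v (s y)) = v"
    proof (rule extensionalityI[of _ "carrier K - {\<zero>}"])
      show "v \<in> extensional (carrier K - {\<zero>})" using v by (simp add: places_def)
    qed (auto simp: pull_def s0)
  qed
  show "\<forall>w\<in>{v. is_place v}. pull (\<lambda>y\<in>carrier K - {\<zero>}. w (s y)) = w"
    by (auto simp: pull_def fun_eq_iff is_place_def)
  show "pull ` places K \<subseteq> {v. is_place v}"
  proof clarify
    fix v assume "v \<in> places K"
    then have v: "v ` (carrier K - {\<zero>}) = UNIV"
      "\<And>x y. x \<in> carrier K - {\<zero>} \<Longrightarrow> y \<in> carrier K - {\<zero>} \<Longrightarrow> v (x \<otimes> y) = v x + v y"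
      "\<And>x y. x \<in> carrier K - {\<zero>} \<Longrightarrow> y \<in> carrier K - {\<zero>} \<Longrightarrow> x \<oplus> y \<noteq> \<zero> \<Longrightarrow> min (v x) (v y) \<le> v (x \<oplus> y)"
      unfolding places_def by auto
    have m: "r x \<in> carrier K - {\<zero>}" if "x \<noteq> 0" for x using that by simp
    show "is_place (pull v)"
      unfolding is_place_def
    proof (intro conjI allI impI)
      show "pull v 0 = 0" by (simp add: pull_def)
      obtain y where y: "y \<in> carrier K - {\<zero>}" "v y = 1" using v(1) by (metis UNIV_I imageE)
      then have "s y \<noteq> 0 \<and> pull v (s y) = 1" using s0 by (simp add: pull_def)
      then show "\<exists>x. x \<noteq> 0 \<and> pull v x = 1" by blast
      fix x y :: 'k assume xy: "x \<noteq> 0" "y \<noteq> 0"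
      show "pull v (x * y) = pull v x + pull v y"
        using v(2)[OF m[OF xy(1)] m[OF xy(2)]] xy by (simp add: pull_def mult)
      assume "x + y \<noteq> 0"
      moreover from this have "r x \<oplus> r y \<noteq> \<zero>" by (simp flip: add)
      ultimately show "min (pull v x) (pull v y) \<le> pull v (x + y)"
        using v(3)[OF m[OF xy(1)] m[OF xy(2)]] xy by (simp add: pull_def add)
    qed
  qed
  show "(\<lambda>w. \<lambda>y\<in>carrier K - {\<zero>}. w (s y)) ` {v. is_place v} \<subseteq> places K"
  proof clarify
    fix w :: "'k \<Rightarrow> int" assume w: "is_place w"
    have surj: "(\<lambda>y\<in>carrier K - {\<zero>}. w (s y)) ` (carrier K - {\<zero>}) = UNIV"
    proof (rule UNIV_eq_I[symmetric])
      fix m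
      obtain x where "x \<noteq> 0" "w x = m" using place_value[OF w] by blast
      then show "m \<in> (\<lambda>y\<in>carrier K - {\<zero>}. w (s y)) ` (carrier K - {\<zero>})"
        by (intro image_eqI[of _ _ "r x"]) simp_all
    qed
    have val: "(\<lambda>y\<in>carrier K - {\<zero>}. w (s y)) (r x) = w x" if "x \<noteq> 0" for x
      using that by simp
    have main: "(\<lambda>y\<in>carrier K - {\<zero>}. w (s y)) (r x \<otimes> r y) = w x + w y \<and>
      (r x \<oplus> r y \<noteq> \<zero> \<longrightarrow> min (w x) (w y) \<le> (\<lambda>y\<in>carrier K - {\<zero>}. w (s y)) (r x \<oplus> r y))"
      if "x \<noteq> 0" "y \<noteq> 0" for x y
    proof -
      have "w (x * y) = w x + w y" "x + y \<noteq> 0 \<Longrightarrow> min (w x) (w y) \<le> w (x + y)"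
        using w that by (simp_all add: is_place_def)
      then show ?thesis using that by (simp add: flip: add mult)
    qed
    show "(\<lambda>y\<in>carrier K - {\<zero>}. w (s y)) \<in> places K"
      unfolding places_def
    proof (intro CollectI conjI ballI surj restrict_extensional)
      fix x y assume "x \<in> carrier K - {\<zero>}" "y \<in> carrier K - {\<zero>}"
      then have "s x \<noteq> 0" "s y \<noteq> 0" "r (s x) = x" "r (s y) = y" using s0 by auto
      then show "(\<lambda>y\<in>carrier K - {\<zero>}. w (s y)) (x \<otimes> y) =
          (\<lambda>y\<in>carrier K - {\<zero>}. w (s y)) x + (\<lambda>y\<in>carrier K - {\<zero>}. w (s y)) y"
        "x \<oplus> y \<noteq> \<zero> \<longrightarrow> min ((\<lambda>y\<in>carrier K - {\<zero>}. w (s y)) x) ((\<lambda>y\<in>carrier K - {\<zero>}. w (s y)) y)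
          \<le> (\<lambda>y\<in>carrier K - {\<zero>}. w (s y)) (x \<oplus> y)"
        using main[of "s x" "s y"] val[of "s x"] val[of "s y"] by simp_all
    qed
  qed
qed

lemma valuation_sets:
  "valuation_ring_set K v = r ` vball (pull v) 0" "valuation_ideal K v = r ` vball (pull v) 1"
proof -
  have *: "r x = \<zero> \<or> m \<le> v (r x) \<longleftrightarrow> vge (pull v) m x" for x m
    by (simp add: vge_def pull_def)
  have "valuation_ring_set K v = r ` {x. r x = \<zero> \<or> 0 \<le> v (r x)}"
    unfolding valuation_ring_set_def carrier_eq by blast
  then show "valuation_ring_set K v = r ` vball (pull v) 0" by (simp only: * vball_def)
  have "valuation_ideal K v = r ` {x. r x = \<zero> \<or> 1 \<le> v (r x)}"
    unfolding valuation_ideal_def carrier_eq int_one_le_iff_zero_less by blast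
  then show "valuation_ideal K v = r ` vball (pull v) 1" by (simp only: * vball_def)
qed

text \<open>The cosets formed by \<open>Quot\<close> are the images under \<open>r\<close> of those
  in \<open>quot\<close>, and taking images under an injection is injective.\<close>

lemma card_Quot:
  assumes B: "add_subgroup B"
  shows "card (carrier ((K\<lparr>carrier := r ` A\<rparr>) Quot (r ` B))) = idx A B"
proof -
  have coset: "(\<Union>h\<in>r ` B. {h \<oplus> r a}) = r ` (+) a ` B" for a
    by (auto simp: image_iff add K.a_comm)
  have "carrier ((K\<lparr>carrier := r ` A\<rparr>) Quot (r ` B)) = (\<Union>y\<in>r ` A. {\<Union>h\<in>r ` B. {h \<oplus> y}})"
    by (simp add: FactRing_def A_RCOSETS_def' a_r_coset_def')
  also have "\<dots> = (\<lambda>a. \<Union>h\<in>r ` B. {h \<oplus> r a}) ` A"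
    by (simp only: UNION_singleton_eq_range image_image)
  also have "\<dots> = (`) r ` quot A B"
    by (simp only: quot_def image_image[of "(`) r"] coset)
  finally show ?thesis
    using card_image[of "(`) r" "quot A B"] by (simp add: inj_on_def inj_image_eq_iff)
qed

end

locale function_field_iso = field_iso K r + function_field_place F T n e pinf
  for K :: "('a, 'b) ring_scheme" (structure) and r :: "'k::field \<Rightarrow> 'a"
    and F :: "'k set" and T n e and pinf
begin

lemma regular_ring_eq:
  assumes "v0 \<in> places K" "pull v0 = pinf"
  shows "regular_ring K v0 = K\<lparr>carrier := r ` \<O>\<rparr>"
proof -
  have "{x \<in> carrier K. \<forall>v\<in>places K - {v0}. x \<in> valuation_ring_set K v} = r ` \<O>"
  proof -
    have "r x \<in> valuation_ring_set K v \<longleftrightarrow> vge (pull v) 0 x" for x v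
      unfolding valuation_sets by (auto simp: vball_def image_iff)
    moreover have "pull ` (places K - {v0}) = S"
      using bij_betw_pull assms by (simp add: S_def bij_betw_def inj_on_image_set_diff[of pull "places K"])
    moreover have "x \<in> \<O> \<longleftrightarrow> (\<forall>w\<in>S. vge w 0 x)" for x by (simp add: \<O>_def vset_def)
    ultimately have "(\<forall>v\<in>places K - {v0}. r x \<in> valuation_ring_set K v) \<longleftrightarrow> x \<in> \<O>" for x
      by (simp flip: \<open>pull ` (places K - {v0}) = S\<close>)
    then show ?thesis unfolding carrier_eq by blast
  qed
  then show ?thesis by (simp add: regular_ring_def)
qed

lemma is_subring_\<O>: "is_subring \<O>"
  unfolding \<O>_def by (rule is_subring_vset[OF S_place])

lemma ring_\<O>: "ring (K\<lparr>carrier := r ` \<O>\<rparr>)"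
proof (rule K.subring_is_ring, rule K.subringI)
  show "r ` \<O> \<subseteq> carrier K" by auto
  show "\<one> \<in> r ` \<O>" using subring_one[OF is_subring_\<O>] by (simp flip: one)
  fix x y assume "x \<in> r ` \<O>" "y \<in> r ` \<O>"
  then obtain a b where ab: "a \<in> \<O>" "b \<in> \<O>" "x = r a" "y = r b" by blast
  show "\<ominus> x \<in> r ` \<O>" "x \<otimes> y \<in> r ` \<O>" "x \<oplus> y \<in> r ` \<O>"
    using ab is_subring_\<O> subring_uminus[of \<O> a] subring_mult[of \<O> a b] subring_add[of \<O> a b]
    by (auto simp flip: uminus mult add)
qed

lemma nonzero_ideals_eq: "nonzero_ideals (K\<lparr>carrier := r ` \<O>\<rparr>) = (`) r ` {I. is_ideal I}"
proof -
  let ?R = "K\<lparr>carrier := r ` \<O>\<rparr>"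
  interpret R: ring ?R by (rule ring_\<O>)
  have neg: "\<ominus>\<^bsub>?R\<^esub> (r x) = r (- x)" if "x \<in> \<O>" for x
    by (rule R.minus_equality) (use that subring_uminus[OF is_subring_\<O>] in \<open>auto simp: zero simp flip: add\<close>)
  show ?thesis
  proof (intro equalityI subsetI)
    fix J assume "J \<in> nonzero_ideals ?R"
    then have J: "ideal J ?R" "J \<noteq> {\<zero>}" by (auto simp: nonzero_ideals_def)
    interpret J: ideal J ?R by (rule J(1))
    define I where "I = {x. r x \<in> J}"
    have sub: "J \<subseteq> r ` \<O>" using J.a_subset by simp
    then have JI: "J = r ` I" by (auto simp: I_def)
    have IO: "I \<subseteq> \<O>" using sub by (auto simp: I_def)
    have "is_ideal I"
      unfolding is_ideal_def add_subgroup_def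
    proof (intro conjI ballI IO)
      show "0 \<in> I" using J.zero_closed by (simp add: I_def zero)
      show "I \<noteq> {0}" using J(2) JI by (auto simp: zero)
      fix x y assume xy: "x \<in> I" "y \<in> I"
      then have "\<ominus>\<^bsub>?R\<^esub> (r y) \<in> J" using J.a_inv_closed by (simp add: I_def)
      moreover have "y \<in> \<O>" using IO xy(2) by (rule subsetD)
      ultimately have "r (- y) \<in> J" by (simp add: neg)
      then have "r x \<oplus> r (- y) \<in> J"
        using J.a_closed[of "r x" "r (- y)"] xy(1) by (simp add: I_def)
      then show "x - y \<in> I" by (simp add: I_def flip: add)
    next
      fix a x assume "a \<in> \<O>" "x \<in> I"
      then show "a * x \<in> I" using J.I_l_closed[of "r x" "r a"] by (simp add: I_def mult)
    qed
    then show "J \<in> (`) r ` {I. is_ideal I}" using JI by blast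
  next
    fix J assume "J \<in> (`) r ` {I. is_ideal I}"
    then obtain I where I: "is_ideal I" "J = r ` I" by blast
    then have grp: "add_subgroup I" and IO: "I \<subseteq> \<O>" and abs: "\<And>a x. a \<in> \<O> \<Longrightarrow> x \<in> I \<Longrightarrow> a * x \<in> I"
      and ne: "I \<noteq> {0}" by (auto simp: is_ideal_def)
    have "ideal J ?R"
    proof (rule idealI[OF ring_\<O>])
      show "subgroup J (add_monoid ?R)"
      proof (rule R.add.subgroupI)
        show "J \<subseteq> carrier ?R" using IO I(2) by auto
        show "J \<noteq> {}" using add_subgroup_zero[OF grp] I(2) by auto
        show "\<ominus>\<^bsub>?R\<^esub> a \<in> J" if "a \<in> J" for a
          using that IO add_subgroup_uminus[OF grp] by (auto simp: I(2) neg)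
        show "a \<oplus>\<^bsub>?R\<^esub> b \<in> J" if "a \<in> J" "b \<in> J" for a b
          using that add_subgroup_add[OF grp] by (auto simp: I(2) simp flip: add)
      qed
      fix a x assume "a \<in> J" "x \<in> carrier ?R"
      then obtain b y where "b \<in> I" "a = r b" "y \<in> \<O>" "x = r y" using I(2) by auto
      then show "x \<otimes>\<^bsub>?R\<^esub> a \<in> J" "a \<otimes>\<^bsub>?R\<^esub> x \<in> J"
        using abs[of y b] by (auto simp: I(2) mult.commute simp flip: mult)
    qed
    moreover have "J \<noteq> {\<zero>}"
    proof
      assume "J = {\<zero>}"
      then have "r ` I = r ` {0}" using I(2) by (simp add: zero)
      moreover have "inj r" by (simp add: inj_on_def)
      ultimately show False using ne inj_image_eq_iff by metis
    qed
    ultimately show "J \<in> nonzero_ideals ?R" by (simp add: nonzero_ideals_def)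
  qed
qed

end

text \<open>The arithmetic half of the theorem, stated without any type of class
  \<open>field\<close>, so that it can be proved through an isomorphism and negated in
  \<open>counterexample\<close>.\<close>

definition zeta_data :: "('a, 'b) ring_scheme \<Rightarrow> ('a \<Rightarrow> int) \<Rightarrow> real \<Rightarrow> bool" where
  "zeta_data K v0 \<beta> \<longleftrightarrow>
     (let R = regular_ring K v0; N = (\<lambda>I. real (ideal_norm R I) powr (- \<beta>)) in
       N summable_on nonzero_ideals R \<and> (\<forall>I\<in>nonzero_ideals R. ideal_norm R I \<ge> 1) \<and>
       ((\<lambda>G. \<Prod>v\<in>G. 1 / (1 - real (place_norm K v) powr (- \<beta>))) \<longlongrightarrow> infsum N (nonzero_ideals R))
         (finite_subsets_at_top (places K - {v0})))"

context function_field_iso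
begin

lemma place_norm_eq:
  assumes "v \<in> places K" shows "place_norm K v = res_card (pull v)"
proof -
  have "is_place (pull v)" using bij_betw_pull assms by (auto simp: bij_betw_def)
  then show ?thesis
    unfolding place_norm_def valuation_sets res_card_def by (intro card_Quot add_subgroup_vball)
qed

lemma ideal_norm_eq: "is_ideal I \<Longrightarrow> ideal_norm (K\<lparr>carrier := r ` \<O>\<rparr>) (r ` I) = idx \<O> I"
  unfolding ideal_norm_def by (rule card_Quot) (simp add: is_ideal_def)

lemma zeta_data:
  assumes v0: "v0 \<in> places K" "pull v0 = pinf" and \<beta>: "\<beta> > 1"
  shows "zeta_data K v0 \<beta>"
proof -
  define R where "R = K\<lparr>carrier := r ` \<O>\<rparr>"
  have R: "regular_ring K v0 = R" unfolding R_def by (rule regular_ring_eq[OF v0])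
  have J: "nonzero_ideals R = (`) r ` {I. is_ideal I}" unfolding R_def by (rule nonzero_ideals_eq)
  have inj: "inj_on ((`) r) A" for A
    using eq_iff by (auto simp: inj_on_def inj_image_eq_iff)
  define N where "N = (\<lambda>I. real (ideal_norm R I) powr (- \<beta>))"
  define Z where "Z = (\<Sum>\<^sub>\<infinity>I\<in>{I. is_ideal I}. real (idx \<O> I) powr (- \<beta>))"
  have "((\<lambda>I. real (idx \<O> I) powr (- \<beta>)) has_sum Z) {I. is_ideal I}"
    unfolding Z_def by (rule has_sum_infsum[OF ideal_sum(1)[OF \<beta>]])
  also have "?this \<longleftrightarrow> ((N \<circ> (`) r) has_sum Z) {I. is_ideal I}"
    by (rule has_sum_cong) (simp add: N_def R_def ideal_norm_eq)
  also have "\<dots> \<longleftrightarrow> (N has_sum Z) (nonzero_ideals R)"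
    unfolding J by (rule has_sum_reindex[OF inj, symmetric])
  finally have sum: "(N has_sum Z) (nonzero_ideals R)" .
  have inj_pull: "inj_on pull (places K)" and pull_S: "S = pull ` (places K - {v0})"
    using bij_betw_pull v0 by (simp_all add: S_def bij_betw_def inj_on_image_set_diff[of pull "places K"])
  have "((\<lambda>G. \<Prod>v\<in>G. 1 / (1 - real (res_card v) powr (- \<beta>))) \<longlongrightarrow> Z) (finite_subsets_at_top S)"
    unfolding Z_def by (rule ideal_sum(2)[OF \<beta>])
  also have "finite_subsets_at_top S = filtermap ((`) pull) (finite_subsets_at_top (places K - {v0}))"
    unfolding pull_S by (rule filtermap_image_finite_subsets_at_top[symmetric])
      (rule inj_on_subset[OF inj_pull], simp)
  finally have "((\<lambda>G. \<Prod>v\<in>pull ` G. 1 / (1 - real (res_card v) powr (- \<beta>))) \<longlongrightarrow> Z)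
      (finite_subsets_at_top (places K - {v0}))"
    by (simp add: filterlim_filtermap)
  also have "?this \<longleftrightarrow> ((\<lambda>G. \<Prod>v\<in>G. 1 / (1 - real (place_norm K v) powr (- \<beta>))) \<longlongrightarrow> Z)
      (finite_subsets_at_top (places K - {v0}))"
  proof (rule tendsto_cong, rule eventually_finite_subsets_at_top_weakI)
    fix G assume G: "finite G" "G \<subseteq> places K - {v0}"
    have "inj_on pull G" by (rule inj_on_subset[OF inj_pull]) (use G in blast)
    then have "(\<Prod>v\<in>pull ` G. 1 / (1 - real (res_card v) powr (- \<beta>))) =
      (\<Prod>v\<in>G. 1 / (1 - real (res_card (pull v)) powr (- \<beta>)))"
      by (simp add: prod.reindex)
    also have "\<dots> = (\<Prod>v\<in>G. 1 / (1 - real (place_norm K v) powr (- \<beta>)))"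
    proof (rule prod.cong)
      fix v assume "v \<in> G"
      then have "v \<in> places K" using G by blast
      then show "1 / (1 - real (res_card (pull v)) powr (- \<beta>)) = 1 / (1 - real (place_norm K v) powr (- \<beta>))"
        by (simp add: place_norm_eq)
    qed simp
    finally show "(\<Prod>v\<in>pull ` G. 1 / (1 - real (res_card v) powr (- \<beta>))) =
      (\<Prod>v\<in>G. 1 / (1 - real (place_norm K v) powr (- \<beta>)))" .
  qed
  finally have prod: "((\<lambda>G. \<Prod>v\<in>G. 1 / (1 - real (place_norm K v) powr (- \<beta>))) \<longlongrightarrow> Z)
      (finite_subsets_at_top (places K - {v0}))" .
  have "ideal_norm R I \<ge> 1" if "I \<in> nonzero_ideals R" for I
  proof -
    from that J obtain I' where "is_ideal I'" "I = r ` I'" by blast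
    then show ?thesis using ideal_index_pos[of I'] ideal_norm_eq[of I'] by (simp add: R_def)
  qed
  then show ?thesis
    using sum prod infsumI[OF sum]
    unfolding zeta_data_def R Let_def N_def[symmetric] by (auto simp: summable_on_def)
qed

end

lemma (in field_iso) zeta_data_of_iso:
  assumes "global_function_field K" "v0 \<in> places K" "\<beta> > 1"
  shows "zeta_data K v0 \<beta>"
proof -
  obtain F :: "'k set" and T n e where "function_field F T n e"
    using function_field_exists[OF assms(1)] by blast
  moreover have "is_place (pull v0)" using bij_betw_pull assms(2) by (auto simp: bij_betw_def)
  ultimately interpret function_field_iso K r F T n e "pull v0"
    by (intro function_field_iso.intro function_field_place.intro function_field_place_axioms.intro field_iso_axioms)
  show ?thesis by (rule zeta_data[OF assms(2) refl assms(3)])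
qed

text \<open>The results above concern types of class \<open>field\<close>, whereas the field of the theorem is a record on a
  carrier set. A type cannot depend on such a record, but it can be the carrier of one fixed choice:
  of a counterexample if there is one, and of an arbitrary field otherwise.\<close>

definition counterexample :: "('a, 'b) ring_scheme \<Rightarrow> bool" where
  "counterexample K \<longleftrightarrow> global_function_field K \<and> (\<exists>v0\<in>places K. \<exists>\<beta>>1. \<not> zeta_data K v0 \<beta>)"

definition rat_field :: "rat ring" where
  "rat_field = \<lparr>carrier = UNIV, monoid.mult = (*), one = 1, ring.zero = 0, add = (+)\<rparr>"

lemma field_rat_field: "Ring.field rat_field"
proof (rule cring.cring_fieldI2)
  show "cring rat_field"
  proof (rule cringI)
    show "abelian_group rat_field"
      by (rule abelian_groupI) (auto simp: rat_field_def algebra_simps intro: exI[of _ "- _"])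
    show "Group.comm_monoid rat_field"
      by (rule comm_monoidI) (auto simp: rat_field_def)
  qed (auto simp: rat_field_def algebra_simps)
  show "\<exists>b\<in>carrier rat_field. a \<otimes>\<^bsub>rat_field\<^esub> b = \<one>\<^bsub>rat_field\<^esub>"
    if "a \<in> carrier rat_field" "a \<noteq> \<zero>\<^bsub>rat_field\<^esub>" for a
    using that by (auto simp: rat_field_def intro: exI[of _ "inverse a"])
qed (simp add: rat_field_def)

text \<open>The sum type gives both alternatives one element type, and the \<open>itself\<close>
  argument carries the type of rings over which the choice ranges.\<close>

definition model_field :: "('a, 'b) ring_scheme itself \<Rightarrow> ('a + rat) ring" where
  "model_field _ =
     (if \<exists>K :: ('a, 'b) ring_scheme. counterexample K
      then image_ring Inl (SOME K :: ('a, 'b) ring_scheme. counterexample K)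
      else image_ring Inr rat_field)"

lemma field_model_field: "Ring.field (model_field (t :: ('a, 'b) ring_scheme itself))"
proof (cases "\<exists>K :: ('a, 'b) ring_scheme. counterexample K")
  case True
  then have "counterexample (SOME K :: ('a, 'b) ring_scheme. counterexample K)" by (rule someI_ex)
  then have "Ring.field (SOME K :: ('a, 'b) ring_scheme. counterexample K)"
    by (simp add: counterexample_def global_function_field_def)
  then show ?thesis
    unfolding model_field_def if_P[OF True] by (rule field.inj_imp_image_ring_is_field) simp
next
  case False
  show ?thesis
    unfolding model_field_def if_not_P[OF False]
    by (rule field.inj_imp_image_ring_is_field[OF field_rat_field]) simp
qed

lemma model_field_closed:
  fixes t :: "('a, 'b) ring_scheme itself"
  defines "M \<equiv> model_field t"
  shows "\<zero>\<^bsub>M\<^esub> \<in> carrier M" "\<one>\<^bsub>M\<^esub> \<in> carrier M"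
    and "x \<in> carrier M \<Longrightarrow> y \<in> carrier M \<Longrightarrow> x \<oplus>\<^bsub>M\<^esub> y \<in> carrier M"
    and "x \<in> carrier M \<Longrightarrow> y \<in> carrier M \<Longrightarrow> x \<ominus>\<^bsub>M\<^esub> y \<in> carrier M"
    and "x \<in> carrier M \<Longrightarrow> \<ominus>\<^bsub>M\<^esub> x \<in> carrier M"
    and "x \<in> carrier M \<Longrightarrow> y \<in> carrier M \<Longrightarrow> x \<otimes>\<^bsub>M\<^esub> y \<in> carrier M"
    and "x \<in> carrier M \<Longrightarrow> (if x = \<zero>\<^bsub>M\<^esub> then x else inv\<^bsub>M\<^esub> x) \<in> carrier M"
proof -
  interpret M: Ring.field M unfolding M_def by (rule field_model_field)
  show "\<zero>\<^bsub>M\<^esub> \<in> carrier M" "\<one>\<^bsub>M\<^esub> \<in> carrier M"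
    "x \<in> carrier M \<Longrightarrow> y \<in> carrier M \<Longrightarrow> x \<oplus>\<^bsub>M\<^esub> y \<in> carrier M"
    "x \<in> carrier M \<Longrightarrow> y \<in> carrier M \<Longrightarrow> x \<ominus>\<^bsub>M\<^esub> y \<in> carrier M"
    "x \<in> carrier M \<Longrightarrow> \<ominus>\<^bsub>M\<^esub> x \<in> carrier M"
    "x \<in> carrier M \<Longrightarrow> y \<in> carrier M \<Longrightarrow> x \<otimes>\<^bsub>M\<^esub> y \<in> carrier M"
    "x \<in> carrier M \<Longrightarrow> (if x = \<zero>\<^bsub>M\<^esub> then x else inv\<^bsub>M\<^esub> x) \<in> carrier M"
    by (simp_all add: M.field_Units)
qed

typedef (overloaded) ('a, 'b) model = "carrier (model_field TYPE(('a, 'b) ring_scheme))"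
  using model_field_closed(1) by blast

setup_lifting type_definition_model

instantiation model :: (type, type) field
begin

lift_definition zero_model :: "('a, 'b) model" is "ring.zero (model_field TYPE(('a, 'b) ring_scheme))"
  by (rule model_field_closed)

lift_definition one_model :: "('a, 'b) model" is "monoid.one (model_field TYPE(('a, 'b) ring_scheme))"
  by (rule model_field_closed)

lift_definition plus_model :: "('a, 'b) model \<Rightarrow> ('a, 'b) model \<Rightarrow> ('a, 'b) model"
  is "ring.add (model_field TYPE(('a, 'b) ring_scheme))"
  by (rule model_field_closed)

lift_definition minus_model :: "('a, 'b) model \<Rightarrow> ('a, 'b) model \<Rightarrow> ('a, 'b) model"
  is "a_minus (model_field TYPE(('a, 'b) ring_scheme))"
  by (rule model_field_closed)

lift_definition uminus_model :: "('a, 'b) model \<Rightarrow> ('a, 'b) model"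
  is "a_inv (model_field TYPE(('a, 'b) ring_scheme))"
  by (rule model_field_closed)

lift_definition times_model :: "('a, 'b) model \<Rightarrow> ('a, 'b) model \<Rightarrow> ('a, 'b) model"
  is "monoid.mult (model_field TYPE(('a, 'b) ring_scheme))"
  by (rule model_field_closed)

lift_definition inverse_model :: "('a, 'b) model \<Rightarrow> ('a, 'b) model"
  is "\<lambda>x. if x = ring.zero (model_field TYPE(('a, 'b) ring_scheme)) then x
      else m_inv (model_field TYPE(('a, 'b) ring_scheme)) x"
  by (rule model_field_closed)

definition divide_model :: "('a, 'b) model \<Rightarrow> ('a, 'b) model \<Rightarrow> ('a, 'b) model" where
  "divide_model x y = x * inverse y"

instance
proof
  interpret mf: Ring.field "model_field TYPE(('a, 'b) ring_scheme)" by (rule field_model_field)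
  fix x y z :: "('a, 'b) model"
  show "x * y * z = x * (y * z)" by transfer (rule mf.m_assoc)
  show "x * y = y * x" by transfer (rule mf.m_comm)
  show "1 * x = x" by transfer (rule mf.l_one)
  show "x + y + z = x + (y + z)" by transfer (rule mf.a_assoc)
  show "x + y = y + x" by transfer (rule mf.a_comm)
  show "0 + x = x" by transfer (rule mf.l_zero)
  show "- x + x = 0" by transfer (rule mf.l_neg)
  show "x - y = x + - y" by transfer (rule mf.minus_eq)
  show "(x + y) * z = x * z + y * z" by transfer (rule mf.l_distr)
  show "(0 :: ('a, 'b) model) \<noteq> 1" by transfer (rule mf.zero_not_one)
  show "x \<noteq> 0 \<Longrightarrow> inverse x * x = 1" by transfer (simp add: mf.field_Units)
  show "x div y = x * inverse y" by (rule divide_model_def)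
  show "inverse (0 :: ('a, 'b) model) = 0" by transfer simp
qed

end

text \<open>If the claim fails for some \<open>k\<close>, then the chosen \<open>K\<close>, possibly
  different from \<open>k\<close>, is a counterexample too, and \<open>model\<close> is a copy of it
  of class \<open>field\<close>. Then \<open>zeta_data_of_iso\<close> for \<open>K\<close>
  contradicts the choice.\<close>

theorem zeta_data_global_function_field:
  fixes k :: "('a, 'b) ring_scheme"
  assumes "global_function_field k" "v0 \<in> places k" "\<beta> > 1"
  shows "zeta_data k v0 \<beta>"
proof (rule ccontr)
  assume "\<not> zeta_data k v0 \<beta>"
  then have "counterexample k" using assms by (auto simp: counterexample_def)
  then have ex: "\<exists>K :: ('a, 'b) ring_scheme. counterexample K" by blast
  define K :: "('a, 'b) ring_scheme" where "K = (SOME K. counterexample K)"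
  have K: "counterexample K" unfolding K_def using ex by (rule someI_ex)
  interpret K: Ring.field K using K by (simp add: counterexample_def global_function_field_def)
  have model: "model_field TYPE(('a, 'b) ring_scheme) = image_ring Inl K"
    unfolding model_field_def if_P[OF ex] K_def ..
  define r :: "('a, 'b) model \<Rightarrow> 'a" where "r x = inv_into (carrier K) Inl (Rep_model x)" for x
  have inv_Inl: "inv_into (carrier K) Inl (Inl a :: 'a + rat) = a" if "a \<in> carrier K" for a
    by (rule inv_into_f_f[OF _ that]) simp
  have rep: "Rep_model x \<in> Inl ` carrier K" for x :: "('a, 'b) model"
    using Rep_model[of x] unfolding model image_ring_carrier .
  have r_closed: "r x \<in> carrier K" for x unfolding r_def by (rule inv_into_into[OF rep])
  have Inl_r: "Inl (r x) = Rep_model x" for x unfolding r_def by (rule f_inv_into_f[OF rep])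
  interpret field_iso K r
  proof
    show "bij_betw r UNIV (carrier K)"
    proof (rule bij_betwI')
      show "r x = r y \<longleftrightarrow> x = y" for x y using Inl_r[of x] Inl_r[of y] Rep_model_inject[of x y] by metis
      show "r x \<in> carrier K" for x by (rule r_closed)
      fix a assume a: "a \<in> carrier K"
      then have "Inl a \<in> carrier (model_field TYPE(('a, 'b) ring_scheme))"
        unfolding model image_ring_carrier by blast
      then have "r (Abs_model (Inl a)) = a" using a by (simp add: r_def Abs_model_inverse inv_Inl)
      then show "\<exists>x\<in>UNIV. a = r x" by (intro bexI[of _ "Abs_model (Inl a)"]) simp_all
    qed
    fix x y
    have "Rep_model (x + y) = Inl (r x \<oplus>\<^bsub>K\<^esub> r y)"
      unfolding plus_model.rep_eq model by (simp add: image_ring_def image_group_def monoid.defs r_def)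
    then show "r (x + y) = r x \<oplus>\<^bsub>K\<^esub> r y" unfolding r_def[of "x + y"] by (simp add: inv_Inl r_closed)
    have "Rep_model (x * y) = Inl (r x \<otimes>\<^bsub>K\<^esub> r y)"
      unfolding times_model.rep_eq model by (simp add: image_ring_def image_group_def monoid.defs r_def)
    then show "r (x * y) = r x \<otimes>\<^bsub>K\<^esub> r y" unfolding r_def[of "x * y"] by (simp add: inv_Inl r_closed)
  qed
  show False using K zeta_data_of_iso by (auto simp: counterexample_def)
qed

section \<open>The trace and the zeta function\<close>

lemma euler_partial_product_real:
  "euler_partial_product k (of_real \<beta>) G = of_real (\<Prod>v\<in>G. 1 / (1 - real (place_norm k v) powr (- \<beta>)))"
proof -
  have "(of_nat N :: complex) powr (- of_real \<beta>) = of_real (real N powr (- \<beta>))" for N :: nat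
    using powr_of_real[of "real N" "- \<beta>"] by simp
  then show ?thesis by (simp add: euler_partial_product_def divide_inverse)
qed

text \<open>Norms of at least 1 have nonnegative logarithms, so \<open>exp_op_diagonal\<close>
  applies with the weights \<beta> times log of the norm.\<close>

lemma exp_op_hamiltonian:
  assumes "\<And>I. I \<in> nonzero_ideals R \<Longrightarrow> ideal_norm R I \<ge> 1" and \<beta>: "\<beta> > 0"
  shows "exp_op (nonzero_ideals R) (scale_op (- of_real \<beta>) (hamiltonian R)) =
    diag_op (nonzero_ideals R) (\<lambda>I. exp (- (\<beta> * ln (real (ideal_norm R I)))))"
proof (rule exp_op_diagonal)
  let ?A = "scale_op (- of_real \<beta>) (hamiltonian R)"
  fix I assume I: "I \<in> nonzero_ideals R"
  then show "0 \<le> \<beta> * ln (real (ideal_norm R I))"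
    using assms(1)[OF I] \<beta> by (intro mult_nonneg_nonneg ln_ge_zero) auto
  fix z :: complex
  have "(\<lambda>j. z * ell2_basis I j, \<lambda>j. of_real (ln (real (ideal_norm R I))) * (z * ell2_basis I j)) \<in> hamiltonian R"
    unfolding hamiltonian_def mem_Collect_eq prod.case
  proof (intro conjI ballI)
    show z: "(\<lambda>j. z * ell2_basis I j) \<in> ell2 (nonzero_ideals R)" by (rule ell2_basis_scaled_in_ell2[OF I])
    show "(\<lambda>j. of_real (ln (real (ideal_norm R I))) * (z * ell2_basis I j)) \<in> ell2 (nonzero_ideals R)"
      by (rule ell2_scale[OF z])
    show "of_real (ln (real (ideal_norm R I))) * (z * ell2_basis I a) =
      of_real (ln (real (ideal_norm R a))) * (z * ell2_basis I a)" for a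
      by (cases "a = I") (simp_all add: ell2_basis_def)
  qed
  then have "(\<lambda>j. z * ell2_basis I j, \<lambda>j. - of_real \<beta> * (of_real (ln (real (ideal_norm R I))) * (z * ell2_basis I j))) \<in> ?A"
    unfolding scale_op_def mem_Collect_eq
    by (intro exI[of _ "\<lambda>j. z * ell2_basis I j"]
        exI[of _ "\<lambda>j. of_real (ln (real (ideal_norm R I))) * (z * ell2_basis I j)"] conjI refl)
  then show "(\<lambda>j. z * ell2_basis I j, \<lambda>j. - of_real (\<beta> * ln (real (ideal_norm R I))) * (z * ell2_basis I j)) \<in> ?A"
    by (simp add: mult.assoc)
next
  fix f g I assume fg: "(f, g) \<in> scale_op (- of_real \<beta>) (hamiltonian R)"
  then show "f \<in> ell2 (nonzero_ideals R)" by (auto simp: scale_op_def hamiltonian_def)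
  assume "I \<in> nonzero_ideals R"
  then show "g I = - of_real (\<beta> * ln (real (ideal_norm R I))) * f I"
    using fg by (auto simp: scale_op_def hamiltonian_def)
qed

text \<open>Trace class and convergence belong to the conclusion because \<open>op_trace\<close> and
  \<open>zeta_away\<close> are total and carry their meaning only under these conditions.\<close>

theorem lemma4p3p3:
  fixes k :: "('a, 'b) ring_scheme" and pinf :: "'a \<Rightarrow> int" and \<beta> :: real
  assumes "global_function_field k"
    and "pinf \<in> places k"
    and "\<beta> > 1"
  defines "J \<equiv> nonzero_ideals (regular_ring k pinf)"
    and "H \<equiv> hamiltonian (regular_ring k pinf)"
  shows "trace_class J (exp_op J (scale_op (- of_real \<beta>) H)) \<and>
    euler_product_converges k pinf (of_real \<beta>) \<and>
    op_trace J (exp_op J (scale_op (- of_real \<beta>) H)) = zeta_away k pinf (of_real \<beta>)"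
proof -
  define R where "R = regular_ring k pinf"
  define N where "N = (\<lambda>I. real (ideal_norm R I) powr (- \<beta>))"
  have J: "J = nonzero_ideals R" and H: "H = hamiltonian R" by (simp_all add: J_def H_def R_def)
  have "zeta_data k pinf \<beta>" by (rule zeta_data_global_function_field[OF assms(1-3)])
  then have sum: "N summable_on J" and pos: "\<And>I. I \<in> J \<Longrightarrow> ideal_norm R I \<ge> 1"
    and euler: "((\<lambda>G. \<Prod>v\<in>G. 1 / (1 - real (place_norm k v) powr (- \<beta>))) \<longlongrightarrow> infsum N J)
      (finite_subsets_at_top (places k - {pinf}))"
    by (simp_all add: zeta_data_def Let_def N_def J flip: R_def)
  have "exp_op J (scale_op (- of_real \<beta>) H) = diag_op J (\<lambda>I. exp (- (\<beta> * ln (real (ideal_norm R I)))))"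
    unfolding J H by (rule exp_op_hamiltonian) (use pos assms(3) in \<open>auto simp: J\<close>)
  also have "\<dots> = diag_op J N"
  proof -
    have "exp (- (\<beta> * ln (real (ideal_norm R I)))) = N I" if "I \<in> J" for I
      using pos[OF that] by (simp add: N_def powr_def)
    \<comment> \<open>Outside \<open>J\<close> the two weights may differ, but vectors of
      \<open>ell2 J\<close> vanish there.\<close>
    then show ?thesis
      unfolding diag_op_def by (intro restrict_ext ext) (metis ell2_outside mult_zero_right)
  qed
  finally have exp: "exp_op J (scale_op (- of_real \<beta>) H) = diag_op J N" .
  have N: "0 \<le> N I" "N I \<le> 1" if "I \<in> J" for I
  proof -
    show "0 \<le> N I" by (simp add: N_def)
    have "real (ideal_norm R I) powr (- \<beta>) \<le> real (ideal_norm R I) powr 0"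
      using pos[OF that] assms(3) by (intro powr_mono) auto
    then show "N I \<le> 1" using pos[OF that] by (simp add: N_def)
  qed
  note trace = diag_op_trace[OF N sum]
  have lim: "(euler_partial_product k (of_real \<beta>) \<longlongrightarrow> of_real (infsum N J)) (finite_subsets_at_top (places k - {pinf}))"
    unfolding euler_partial_product_real[abs_def] by (intro tendsto_of_real euler)
  then have "zeta_away k pinf (of_real \<beta>) = of_real (infsum N J)"
    unfolding zeta_away_def by (intro tendsto_Lim) auto
  then show ?thesis
    using trace lim unfolding exp euler_product_converges_def by auto
qed

end
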